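(* For $1\le d\le 10$ let $m=\lfloor d/2\rfloor$ and consider the homomorphism of $\mathbb{Q}$-algebras from a polynomial algebra on $m$ variables to $\mathcal{A}(d)$ that sends the variables, in order, to $\gamma_2,\dots,\gamma_{m+1}$. The variables are the first $m$ of $(x,y,z,w)$ for $d\le 8$, with $(x,y,z,w)\mapsto(\gamma_2,\gamma_3,\gamma_4,\gamma_5)$; they are $(a,b,c,d)\mapsto(\gamma_2,\gamma_3,\gamma_4,\gamma_5)$ for $\mathcal{A}(9)$ and $(a,b,c,d,e)\mapsto(\gamma_2,\dots,\gamma_6)$ for $\mathcal{A}(10)$ (here $d$ denotes a variable). This homomorphism is surjective and gives the following minimal presentations, i.e. the listed polynomials form a set of minimal relations. $\mathcal{A}(1)\cong\mathbb{Q}$; $\mathcal{A}(2)\cong\mathbb{Q}[x]/(x^2)$; $\mathcal{A}(3)\cong\mathbb{Q}[x]/(x^3)$; $\mathcal{A}(4)\cong\mathbb{Q}[x,y]/(x^3-4xy,\ x^4,\ y^2)$; $\mathcal{A}(5)\cong\mathbb{Q}[x,y]/(x^4-5x^2y,\ x^4-25y^2,\ x^5)$; $\mathcal{A}(6)\cong\mathbb{Q}[x,y,z]/(x^4-11x^2y+24xz+6y^2,\ x^5-6x^3y,\ x^5-36x^2z,\ x^5-216yz,\ x^6,\ z^2)$; $\mathcal{A}(7)\cong\mathbb{Q}[x,y,z]/(x^5-13x^3y+28x^2z+14xy^2,\ 11x^5-129x^3y+280x^2z+588yz,\ x^6-7x^4y,\ x^6-49x^3z,\ x^6-343y^3,\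 x^6-2401z^2,\ x^7)$; $\mathcal{A}(8)\cong\mathbb{Q}[x,y,z,w]/J$, where $J$ is generated by $x^5-21x^3y+92x^2z+54xy^2-240xw-96yz$, $x^6-15x^4y+32x^3z+24x^2y^2$, $x^6+9x^4y-304x^3z+1440x^2w-96y^3$, $-x^6+87x^4y-1232x^3z+5472x^2w-5376yw$, $17x^6-135x^4y-784x^3z+5760x^2w+3584z^2$, $x^7-8x^5y$, $x^7-64x^4z$, $x^7-512x^3w$, $x^7-32768zw$, $x^8$, $w^2$. $\mathcal{A}(9)\cong\mathbb{Q}[a,b,c,d]/J$, where $J$ is generated by $-a^6+24a^4b-104a^3c-87a^2b^2+270a^2d+216abc+18b^3$, $-11a^6+258a^4b-1120a^3c-837a^2b^2+2910a^2d+1488abc+2160bd+864c^2$, $a^7-17a^5b+36a^4c+36a^3b^2$, $a^7-11a^5b-30a^4c+270a^3d+162a^2bc$, $251a^7-3895a^5b+16284a^4c-50328a^3d+326592abd$, $37a^7-1001a^5b+9636a^4c-37800a^3d+46656b^2c$, $85a^7-857a^5b-2652a^4c+26712a^3d+373248cd$, $a^8-9a^6b$, $a^8-81a^5c$, $a^8-729a^4d$, $a^8-59049b^2d$, $a^8-531441d^2$, $a^9$. $\mathcal{A}(10)\cong\mathbb{Q}[a,b,c,d,e]/J$, where $J$ is generated by $a^6-34a^4b+224a^3c+207a^2b^2-1170a^2d-1136abc+3360ae-108b^3+1200bd+480c^2$, $-a^7+27a^5b-116a^4c-126a^3b^2+300a^3d+360a^2bc+60ab^3$, $-3a^7+86a^5b-468a^4c-393a^3b^2+1950a^3d+1420a^2bc-4200a^2e+600b^2c$,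 $-7a^7+229a^5b-1652a^4c-1152a^3b^2+9450a^3d+6080a^2bc-29460a^2e-6600abd+21600be$, $-59a^7+1283a^5b-2404a^4c-3654a^3b^2-18450a^3d-10040a^2bc+140700a^2e+46200abd+108000cd$, $a^8-19a^6b+40a^5c+50a^4b^2$, $7a^8-83a^6b-320a^5c+2500a^4d+2000a^3bc$, $21a^8-249a^6b+40a^5c-5500a^4d+60000a^3e+30000a^2bd$, $221a^8-2049a^6b-1960a^5c-167500a^4d+1680000a^3e+30000b^4$, $1457a^8-14133a^6b-5320a^5c-1049500a^4d+10320000a^3e+2700000b^2d$, $-2659a^8+10671a^6b+191840a^5c+2835500a^4d-32592000a^3e+97200000ce$, $18341a^8-142329a^6b-813160a^5c-8483500a^4d+122640000a^3e+243000000d^2$, $a^9-10a^7b$, $a^9-100a^6c$, $a^9-1000a^5d$, $a^9-10^7de$, $a^{10}$, $e^2$.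
   Context: For $n\ge1$ and $\sigma$ in the symmetric group $\mathfrak{S}_n$ let $N(\sigma)$ (the norm) be the minimal number of transpositions whose product is $\sigma$ (equivalently, $n$ minus the number of cycles of $\sigma$, fixed points included). Let $\mathrm{grad}^N\mathbb{Q}[\mathfrak{S}_n]$ be the $\mathbb{Q}$-vector space with basis $\{[\sigma]:\sigma\in\mathfrak{S}_n\}$, graded by the norm, with multiplication $[\sigma]\cdot[\tau]=[\sigma\tau]$ if $N(\sigma\tau)=N(\sigma)+N(\tau)$, and $[\sigma]\cdot[\tau]=0$ otherwise. $\mathcal{A}(n)$ is the (commutative) subalgebra of invariants under the conjugation action of $\mathfrak{S}_n$; by Lehn and Sorger it is isomorphic to $H^*(\mathrm{Hilb}^n(\mathbb{C}^2);\mathbb{Q})$, with elements of norm $j$ in cohomological degree $2j$. For $2\le i\le n$, $\gamma_i\in\mathcal{A}(n)$ is the sum of $[\sigma]$ over all $\sigma\in\mathfrak{S}_n$ whose cycle decomposition consists of one $i$-cycle and fixed points; it has norm $i-1$. If $P$ is a polynomial algebra graded by giving the variable sent to $\gamma_{i+1}$ norm $i$, $P_+$ is the ideal of $P$ spanned by monomials of positive norm, and $I$ is the kernel of the graded homomorphism $P\to\mathcal{A}(n)$, then a set of minimal relations is a set of homogeneous elements of $I$ projecting to a vector space basis of $I/(P_+\cdot I)$; such a set generates the ideal $I$. *)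

theory Defs
  imports
    Complex_Main
    "HOL-Library.Poly_Mapping"
    "HOL-Algebra.Sym_Groups"
    "HOL-Algebra.QuotRing"
    "HOL-Algebra.Ideal_Product"
    "HOL-Algebra.Module"
begin

abbreviation scale :: "rat \<Rightarrow> ('a \<Rightarrow>\<^sub>0 rat) \<Rightarrow> ('a \<Rightarrow>\<^sub>0 rat)"
  where "scale c \<equiv> Poly_Mapping.map ((*) c)"

definition alg_hom ::
  "(rat, 'a, 'c) module_scheme \<Rightarrow> (rat, 'b, 'd) module_scheme \<Rightarrow> ('a \<Rightarrow> 'b) set"
  where "alg_hom R S =
    {\<phi> \<in> ring_hom R S. \<forall>c. \<forall>p \<in> carrier R. \<phi> (c \<odot>\<^bsub>R\<^esub> p) = c \<odot>\<^bsub>S\<^esub> \<phi> p}"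

type_synonym perm_comb = "(nat \<Rightarrow> nat) \<Rightarrow>\<^sub>0 rat"

abbreviation basis_elt :: "(nat \<Rightarrow> nat) \<Rightarrow> perm_comb"
  where "basis_elt \<sigma> \<equiv> Poly_Mapping.single \<sigma> 1"

definition transpositions :: "nat \<Rightarrow> (nat \<Rightarrow> nat) set"
  where "transpositions n = {transpose a b | a b. a \<in> {1..n} \<and> b \<in> {1..n} \<and> a \<noteq> b}"

definition perm_norm :: "nat \<Rightarrow> (nat \<Rightarrow> nat) \<Rightarrow> nat"
  where "perm_norm n \<sigma> =
    (LEAST k. \<exists>ts. length ts = k \<and> set ts \<subseteq> transpositions n \<and> foldr (\<circ>) ts id = \<sigma>)"

definition graded_mult :: "nat \<Rightarrow> perm_comb \<Rightarrow> perm_comb \<Rightarrow> perm_comb"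
  where "graded_mult n f g =
    (\<Sum>\<sigma> \<in> Poly_Mapping.keys f. \<Sum>\<tau> \<in> Poly_Mapping.keys g.
       if perm_norm n (\<sigma> \<circ> \<tau>) = perm_norm n \<sigma> + perm_norm n \<tau>
       then scale (Poly_Mapping.lookup f \<sigma> * Poly_Mapping.lookup g \<tau>) (basis_elt (\<sigma> \<circ> \<tau>)) else 0)"

definition graded_group_algebra :: "nat \<Rightarrow> (rat, perm_comb) module"
  where "graded_group_algebra n =
    \<lparr>carrier = {f. Poly_Mapping.keys f \<subseteq> carrier (sym_group n)},
     mult = graded_mult n, one = basis_elt id, zero = 0, add = (+), smult = scale\<rparr>"

definition conj_action :: "(nat \<Rightarrow> nat) \<Rightarrow> perm_comb \<Rightarrow> perm_comb"
  where "conj_action \<sigma> f =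
    (\<Sum>\<tau> \<in> Poly_Mapping.keys f. scale (Poly_Mapping.lookup f \<tau>) (basis_elt (\<sigma> \<circ> \<tau> \<circ> inv' \<sigma>)))"

definition invariant_algebra :: "nat \<Rightarrow> (rat, perm_comb) module"
  where "invariant_algebra n = (graded_group_algebra n)
    \<lparr>carrier := {f \<in> carrier (graded_group_algebra n).
                  \<forall>\<sigma> \<in> carrier (sym_group n). conj_action \<sigma> f = f}\<rparr>"

definition cycle_class :: "nat \<Rightarrow> nat \<Rightarrow> perm_comb"
  where "cycle_class n i =
    (\<Sum>\<sigma> \<in> {cycle_of_list cs | cs. cycle cs \<and> length cs = i \<and> set cs \<subseteq> {1..n}}. basis_elt \<sigma>)"

text \<open>A monomial is the finitely supported function giving the exponent of each variable; the
  variables of the polynomial algebra on \<open>m\<close> variables are numbered \<open>0, \<dots>, m - 1\<close>.\<close>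

type_synonym rat_mpoly = "(nat \<Rightarrow>\<^sub>0 nat) \<Rightarrow>\<^sub>0 rat"

definition var :: "nat \<Rightarrow> rat_mpoly"
  where "var i = Poly_Mapping.single (Poly_Mapping.single i 1) 1"

definition polynomial_algebra :: "nat \<Rightarrow> (rat, rat_mpoly) module"
  where "polynomial_algebra m =
    \<lparr>carrier = {p. \<forall>u \<in> Poly_Mapping.keys p. Poly_Mapping.keys u \<subseteq> {..<m}},
     mult = (*), one = 1, zero = 0, add = (+), smult = scale\<rparr>"

text \<open>Variable \<open>i\<close> is sent to the sum of all \<open>(i + 2)\<close>-cycles, so it has norm \<open>i + 1\<close>.\<close>

definition monomial_norm :: "(nat \<Rightarrow>\<^sub>0 nat) \<Rightarrow> nat"
  where "monomial_norm u = (\<Sum>i \<in> Poly_Mapping.keys u. Poly_Mapping.lookup u i * (i + 1))"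

definition homogeneous :: "rat_mpoly \<Rightarrow> bool"
  where "homogeneous p \<longleftrightarrow> (\<exists>k. \<forall>u \<in> Poly_Mapping.keys p. monomial_norm u = k)"

definition positive_ideal :: "nat \<Rightarrow> rat_mpoly set"
  where "positive_ideal m =
    {p \<in> carrier (polynomial_algebra m). \<forall>u \<in> Poly_Mapping.keys p. monomial_norm u > 0}"

definition generator_homs :: "nat \<Rightarrow> (rat_mpoly \<Rightarrow> perm_comb) set"
  where "generator_homs d =
    {\<phi> \<in> alg_hom (polynomial_algebra (d div 2)) (invariant_algebra d).
       \<forall>i < d div 2. \<phi> (var i) = cycle_class d (i + 2)}"

text \<open>The last two conjuncts say that the cosets of the elements of \<open>R\<close> modulo \<open>P\<^sub>+ \<cdot> I\<close> are
  pairwise distinct, linearly independent, and span \<open>I / (P\<^sub>+ \<cdot> I)\<close>.\<close>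

definition minimal_relations :: "nat \<Rightarrow> rat_mpoly set \<Rightarrow> rat_mpoly set \<Rightarrow> bool"
  where "minimal_relations m I R \<longleftrightarrow>
    R \<subseteq> I \<and> (\<forall>r \<in> R. homogeneous r) \<and>
    (\<forall>F c. finite F \<and> F \<subseteq> R \<and>
       (\<Sum>r \<in> F. scale (c r) r) \<in> positive_ideal m \<cdot>\<^bsub>polynomial_algebra m\<^esub> I
       \<longrightarrow> (\<forall>r \<in> F. c r = 0)) \<and>
    (\<forall>p \<in> I. \<exists>F c. finite F \<and> F \<subseteq> R \<and>
       p - (\<Sum>r \<in> F. scale (c r) r) \<in> positive_ideal m \<cdot>\<^bsub>polynomial_algebra m\<^esub> I)"

text \<open>Elements of \<^const>\<open>generator_homs\<close> are uniquely determined on the carrier of the polynomial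
  algebra, so the two clauses below speak about the homomorphism fixed by the images of the
  variables: it exists, and it has the stated properties.\<close>

definition minimal_presentation :: "nat \<Rightarrow> rat_mpoly set \<Rightarrow> bool"
  where "minimal_presentation d R \<longleftrightarrow>
    (let P = polynomial_algebra (d div 2); A = invariant_algebra d in
      generator_homs d \<noteq> {} \<and>
      (\<forall>\<phi> \<in> generator_homs d.
         \<phi> ` carrier P = carrier A \<and>
         minimal_relations (d div 2) (a_kernel P A \<phi>) R \<and>
         a_kernel P A \<phi> = genideal P R) \<and>
      P Quot (genideal P R) \<simeq> A)"

end

theory Submission
  imports Defs
begin

text \<open>
  An element of \<open>\<A>(d)\<close> is a class function on \<open>\<SS>\<^sub>d\<close>, so it is determined by its values on the cycle
  types, and these are the partitions of \<open>d\<close>. The proof rests on a formula for the product with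
  \<open>\<gamma>\<^sub>i\<close> in terms of these values. By definition \<open>(\<gamma>\<^sub>i f)(\<rho>)\<close> is the sum of \<open>f(\<sigma>\<inverse>\<rho>)\<close> over the
  \<open>i\<close>-cycles \<open>\<sigma>\<close> for which \<open>\<sigma>\<inverse>\<rho>\<close> has norm \<open>i - 1\<close> less than \<open>\<rho>\<close>. A cycle
  \<open>\<sigma> = (a\<^sub>1 a\<^sub>2)(a\<^sub>2 a\<^sub>3) \<cdots> (a\<^bsub>i-1\<^esub> a\<^sub>i)\<close> has this property exactly if each of the transpositions,
  applied to \<open>\<rho>\<close> in turn, splits a cycle in two. The first one cuts off the part of the cycle of
  \<open>a\<^sub>1\<close> that runs from \<open>a\<^sub>1\<close> up to \<open>a\<^sub>2\<close>, the next one cuts the part up to \<open>a\<^sub>3\<close> off the rest, and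
  so on. Altogether one cycle, of length \<open>l\<close> say, is replaced by \<open>i\<close> cycles whose lengths form a
  composition of \<open>l\<close>, and given \<open>a\<^sub>1\<close> every composition occurs once. As every \<open>i\<close>-cycle has \<open>i\<close>
  notations, this gives \<open>i \<cdot> (\<gamma>\<^sub>i f)(\<mu>) = \<Sum>\<^sub>l l \<cdot> \<Sum>\<^bsub>k\<^sub>1 + \<dots> + k\<^sub>i = l\<^esub> f(\<mu>[l \<rightarrow> k\<^sub>1, \<dots>, k\<^sub>i])\<close> where
  \<open>l\<close> runs over the parts of \<open>\<mu>\<close> and is replaced by the \<open>k\<^sub>j\<close> on the right (theorem
  \<open>class_val_cycle_class_mult\<close>). The values of all monomials in the \<open>\<gamma>\<^sub>i\<close> on all cycle types follow
  by recursion, without any enumeration of permutations.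

  Once the values are known, the claims are linear algebra, and the certificate is small. The listed
  relations form a Groebner basis, with the last written term of each of them as leading term; only
  for \<open>d = 10\<close> one more element, which expresses \<open>a\<^sup>4e\<close> by \<open>a\<^sup>9\<close>, has to be added. Therefore the
  \<^emph>\<open>standard\<close> monomials, which no leading monomial divides, span the polynomial algebra modulo the
  ideal of the relations (lemma \<open>reducible_monom\<close>). There are as many of them as partitions of \<open>d\<close>,
  and the matrix of their values on the cycle types is invertible. This shows at once that the
  relations generate the kernel and that the homomorphism is surjective (lemmas \<open>kernel_eq_J\<close> and
  \<open>eval_poly_surjective\<close>). For minimality, every relation comes with a linear functional on the
  polynomials that does not vanish on it, but vanishes on the other relations and on all products of
  relations with nonconstant monomials, hence on \<open>P\<^sub>+ \<cdot> I\<close> (lemmas \<open>functional_vanishes\<close> and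
  \<open>relations_independent\<close>).
\<close>

section \<open>Disjoint cycles\<close>

text \<open>
  The lists in \<open>css\<close> are the cycles of \<open>\<rho>\<close>, fixed points included. That \<open>\<rho>\<close> permutes a cycle \<open>cs\<close>
  cyclically is expressed by \<open>map \<rho> cs = rotate1 cs\<close>: in this form a cycle can be cut, joined,
  rotated and conjugated by list manipulation, and the order of the cycles does not matter.
\<close>

definition cycle_form :: "'a set \<Rightarrow> ('a \<Rightarrow> 'a) \<Rightarrow> 'a list list \<Rightarrow> bool"
  where "cycle_form S \<rho> css \<longleftrightarrow>
    distinct (concat css) \<and> set (concat css) = S \<and> [] \<notin> set css \<and>
    (\<forall>cs \<in> set css. map \<rho> cs = rotate1 cs) \<and> (\<forall>x. x \<notin> S \<longrightarrow> \<rho> x = x)"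

lemma distinct_concat_mset:
  assumes "mset css = mset css'"
  shows "distinct (concat css) \<longleftrightarrow> distinct (concat css')"
proof -
  have "mset (concat css) = mset (concat css')" if "mset css = mset css'"
    for css css' :: "'a list list"
  proof -
    have "mset (concat xss) = (\<Sum>xs\<in>#mset xss. mset xs)" for xss :: "'a list list"
      by (induction xss) auto
    then show ?thesis using that by simp
  qed
  from this[OF assms] show ?thesis by (rule mset_eq_imp_distinct_iff)
qed

lemma cycle_form_mset:
  assumes "cycle_form S \<rho> css" "mset css = mset css'"
  shows "cycle_form S \<rho> css'"
  using assms distinct_concat_mset[OF assms(2)] mset_eq_setD[OF assms(2)]
  by (simp add: cycle_form_def)

lemma cycle_form_rotate:
  assumes "cycle_form S \<rho> (cs # css)"
  shows "cycle_form S \<rho> (rotate k cs # css)"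
proof -
  have "map \<rho> (rotate k cs) = rotate k (map \<rho> cs)" by (simp add: rotate_map)
  also have "\<dots> = rotate1 (rotate k cs)"
    using assms by (simp add: cycle_form_def rotate1_rotate_swap)
  finally have "map \<rho> (rotate k cs) = rotate1 (rotate k cs)" .
  moreover have "[] \<notin> set (rotate k cs # css)"
  proof
    assume "[] \<in> set (rotate k cs # css)"
    then have "rotate k cs = [] \<or> [] \<in> set css" by fastforce
    then show False using assms by (simp add: cycle_form_def)
  qed
  ultimately show ?thesis using assms by (simp add: cycle_form_def)
qed

lemma cycle_form_length:
  assumes "cycle_form S \<rho> css"
  shows "sum_list (map length css) = card S"
  using assms distinct_card[of "concat css"] by (simp add: cycle_form_def length_concat)

lemma cycle_form_insert:
  assumes form: "cycle_form S \<rho> css" and cs: "distinct cs" "cs \<noteq> []" "set cs \<inter> S = {}"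
  shows "cycle_form (set cs \<union> S) (cycle_of_list cs \<circ> \<rho>) (cs # css)"
proof -
  have out: "\<rho> x = x" if "x \<notin> S" for x using form that by (simp add: cycle_form_def)
  have "map (cycle_of_list cs) cs = rotate1 cs"
    using cyclic_rotation[OF cs(1), of 1] by simp
  moreover have "map (cycle_of_list cs \<circ> \<rho>) cs = map (cycle_of_list cs) cs"
  proof (rule map_cong[OF refl])
    fix x assume "x \<in> set cs"
    then have "x \<notin> S" using cs(3) by auto
    then show "(cycle_of_list cs \<circ> \<rho>) x = cycle_of_list cs x" by (simp add: out)
  qed
  moreover have "map (cycle_of_list cs \<circ> \<rho>) ds = rotate1 ds" if "ds \<in> set css" for ds
  proof -
    have ds: "map \<rho> ds = rotate1 ds" and sub: "set ds \<subseteq> S"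
      using form that by (auto simp: cycle_form_def)
    have "map (cycle_of_list cs \<circ> \<rho>) ds = map (cycle_of_list cs) (rotate1 ds)"
      by (metis ds map_map)
    also have "\<dots> = rotate1 ds"
      using sub cs(3) by (intro map_idI id_outside_supp) auto
    finally show ?thesis .
  qed
  ultimately show ?thesis
    using form cs by (auto simp: cycle_form_def id_outside_supp)
qed

text \<open>
  Every cycle of a decomposition into disjoint cycles is put in front of the list; empty cycles are
  the identity and are left out.
\<close>

lemma cycle_form_exists:
  assumes "\<rho> permutes S" "finite S"
  shows "\<exists>css. cycle_form S \<rho> css"
  using cycle_decomposition[OF assms]
proof (induction rule: cycle_decomp.induct)
  case empty
  then show ?case by (intro exI[of _ "[]"]) (simp add: cycle_form_def)
next
  case (comp I p cs)
  then obtain css where css: "cycle_form I p css" by auto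
  show ?case
  proof (cases "cs = []")
    case False
    from cycle_form_insert[OF css comp.hyps(2) False comp.hyps(3)] show ?thesis by blast
  qed (use css in auto)
qed

lemma cycle_form_permutes:
  assumes "cycle_form S \<rho> css"
  shows "\<rho> permutes S"
proof (rule bij_imp_permutes)
  have "finite S" using assms by (auto simp: cycle_form_def)
  have "\<rho> ` S = S"
  proof -
    have "\<rho> ` set cs = set cs" if "cs \<in> set css" for cs
      using assms that by (metis cycle_form_def list.set_map set_rotate1)
    moreover have "S = (\<Union>cs\<in>set css. set cs)" using assms by (simp add: cycle_form_def)
    ultimately show ?thesis by (simp add: image_UN)
  qed
  then show "bij_betw \<rho> S S"
    using \<open>finite S\<close> by (simp add: bij_betw_def eq_card_imp_inj_on)
  show "\<rho> x = x" if "x \<notin> S" for x using assms that by (simp add: cycle_form_def)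
qed

text \<open>
  Every partition is the cycle type of some permutation: consecutive blocks of numbers are taken as
  cycles.
\<close>

lemma cycle_form_with_lengths:
  assumes "0 \<notin> set ks"
  shows "\<exists>\<rho> css. cycle_form {1..sum_list ks} \<rho> css \<and> map length css = ks"
  using assms
proof (induction ks)
  case Nil
  then show ?case by (intro exI[of _ id] exI[of _ "[]"]) (simp add: cycle_form_def)
next
  case (Cons k ks)
  then obtain \<rho> css where *: "cycle_form {1..sum_list ks} \<rho> css" "map length css = ks" by auto
  define cs where "cs = [Suc (sum_list ks)..<Suc (sum_list ks + k)]"
  have "cycle_form (set cs \<union> {1..sum_list ks}) (cycle_of_list cs \<circ> \<rho>) (cs # css)"
    using Cons.prems by (intro cycle_form_insert[OF *(1)]) (auto simp: cs_def simp del: upt_Suc)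
  moreover have "set cs \<union> {1..sum_list ks} = {1..sum_list (k # ks)}"
    by (auto simp: cs_def simp del: upt_Suc)
  moreover have "length cs = k" by (simp add: cs_def del: upt_Suc)
  ultimately have "cycle_form {1..sum_list (k # ks)} (cycle_of_list cs \<circ> \<rho>) (cs # css)"
      "map length (cs # css) = k # ks" using *(2) by simp_all
  then show ?case by (intro exI conjI)
qed

lemma cycle_form_conj_lists:
  assumes form: "cycle_form S \<rho> css" "cycle_form S \<rho>' (map (map \<pi>) css)" and "\<pi> permutes S"
  shows "\<rho>' = \<pi> \<circ> \<rho> \<circ> inv' \<pi>"
proof -
  have "\<rho>' (\<pi> x) = \<pi> (\<rho> x)" for x
  proof (cases "x \<in> S")
    case True
    then obtain cs where cs: "cs \<in> set css" "x \<in> set cs" using form(1) by (auto simp: cycle_form_def)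
    have "map \<rho>' (map \<pi> cs) = rotate1 (map \<pi> cs)"
      using form(2) cs(1) by (simp add: cycle_form_def)
    also have "\<dots> = map \<pi> (map \<rho> cs)"
      using form(1) cs(1) by (simp add: cycle_form_def rotate1_map)
    finally show ?thesis using cs(2) by auto
  next
    case False
    moreover have "\<pi> x = x" using False \<open>\<pi> permutes S\<close> by (simp add: permutes_not_in)
    ultimately show ?thesis using form by (auto simp: cycle_form_def)
  qed
  then have "\<rho>' \<circ> \<pi> = \<pi> \<circ> \<rho>" by auto
  then have "\<rho>' \<circ> \<pi> \<circ> inv' \<pi> = \<pi> \<circ> \<rho> \<circ> inv' \<pi>" by simp
  then show ?thesis using \<open>\<pi> permutes S\<close> by (simp add: comp_assoc permutes_inv_o(1))
qed

lemma mset_map_eq_reorder: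
  assumes "mset (map f xs) = mset ys"
  shows "\<exists>xs'. mset xs' = mset xs \<and> map f xs' = ys"
  using assms
proof (induction ys arbitrary: xs)
  case Nil
  then show ?case by simp
next
  case (Cons y ys)
  then have "y \<in> f ` set xs" by (metis list.set_intros(1) list.set_map set_mset_mset)
  then obtain x where x: "x \<in> set xs" "f x = y" by auto
  then obtain as bs where xs: "xs = as @ x # bs" by (meson split_list)
  have "mset (map f (as @ bs)) = mset ys" using Cons.prems x(2) by (simp add: xs)
  from Cons.IH[OF this] obtain zs where "mset zs = mset (as @ bs)" "map f zs = ys" by auto
  then show ?case using x(2) by (intro exI[of _ "x # zs"]) (simp add: xs)
qed

lemma map_concat_same_lengths:
  assumes "map length xss = map length yss" "map f (concat xss) = concat yss"
  shows "map (map f) xss = yss"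
  using assms
proof (induction xss arbitrary: yss)
  case (Cons xs xss)
  then obtain ys yss' where "yss = ys # yss'" "length xs = length ys" "map length xss
    = map length yss'" by auto
  then show ?case using Cons by auto
qed simp

lemma permutation_between_lists:
  assumes "distinct xs" "distinct ys" "set xs = S" "set ys = S"
  shows "\<exists>\<pi>. \<pi> permutes S \<and> map \<pi> xs = ys"
proof -
  have len: "length xs = length ys" using assms distinct_card by metis
  define \<pi> where "\<pi> x = (case map_of (zip xs ys) x of None \<Rightarrow> x | Some y \<Rightarrow> y)" for x
  have map: "map \<pi> xs = ys"
    by (rule nth_equalityI) (simp_all add: \<pi>_def len map_of_zip_nth assms)
  have "\<pi> x = x" if "x \<notin> S" for x
  proof -
    have "map_of (zip xs ys) x = None" using that assms len by (simp add: map_of_zip_is_None)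
    then show ?thesis by (simp add: \<pi>_def)
  qed
  moreover have "bij_betw \<pi> S S"
  proof -
    have "\<pi> ` S = S" using map assms by (metis list.set_map)
    moreover have "finite S" using assms(3) by auto
    ultimately show ?thesis by (simp add: bij_betw_def eq_card_imp_inj_on)
  qed
  ultimately show ?thesis using map bij_imp_permutes by blast
qed

text \<open>
  After a reordering of the cycles, corresponding cycles have equal lengths, and the map that sends
  the concatenation of the first list of cycles to that of the second one conjugates.
\<close>

lemma same_cycle_type_conjugate:
  assumes form: "cycle_form S \<rho> css" "cycle_form S \<rho>' css'"
    and "mset (map length css) = mset (map length css')"
  shows "\<exists>\<pi>. \<pi> permutes S \<and> \<rho>' = \<pi> \<circ> \<rho> \<circ> inv' \<pi>"
proof -
  obtain dss where dss: "mset dss = mset css" "map length dss = map length css'"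
    using mset_map_eq_reorder[OF assms(3)] by auto
  have form': "cycle_form S \<rho> dss" using cycle_form_mset[OF form(1)] dss(1) by simp
  obtain \<pi> where \<pi>: "\<pi> permutes S" "map \<pi> (concat dss) = concat css'"
    using permutation_between_lists[of "concat dss" "concat css'" S] form' form(2)
    by (auto simp: cycle_form_def)
  then have "map (map \<pi>) dss = css'" using map_concat_same_lengths dss(2) by blast
  then show ?thesis using cycle_form_conj_lists[OF form'] form(2) \<pi>(1) by blast
qed

lemma cycle_form_conj:
  assumes form: "cycle_form S \<rho> css" and "\<pi> permutes S"
  shows "cycle_form S (\<pi> \<circ> \<rho> \<circ> inv' \<pi>) (map (map \<pi>) css)"
proof -
  have inj: "inj \<pi>" using \<open>\<pi> permutes S\<close> by (rule permutes_inj)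
  have inv: "inv' \<pi> (\<pi> x) = x" for x using inj by simp
  have "\<pi> ` S = S" using \<open>\<pi> permutes S\<close> by (rule permutes_image)
  have "concat (map (map \<pi>) css) = map \<pi> (concat css)" by (simp add: map_concat)
  moreover have "map (\<pi> \<circ> \<rho> \<circ> inv' \<pi>) (map \<pi> cs) = rotate1 (map \<pi> cs)" if "cs \<in> set css" for cs
  proof -
    have "map (\<pi> \<circ> \<rho> \<circ> inv' \<pi>) (map \<pi> cs) = map \<pi> (map \<rho> cs)" by (simp add: inv)
    also have "\<dots> = rotate1 (map \<pi> cs)" using form that by (simp add: cycle_form_def rotate1_map)
    finally show ?thesis .
  qed
  moreover have "(\<pi> \<circ> \<rho> \<circ> inv' \<pi>) x = x" if "x \<notin> S" for x
  proof -
    have "inv' \<pi> x = x" using that \<open>\<pi> permutes S\<close> by (metis permutes_inv permutes_not_in)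
    then show ?thesis using form that \<open>\<pi> permutes S\<close> by (simp add: cycle_form_def permutes_not_in)
  qed
  moreover have "distinct (map \<pi> (concat css))"
    using form inj by (simp add: cycle_form_def distinct_map inj_on_subset[OF inj])
  moreover have "[] \<notin> set (map (map \<pi>) css)" using form by (auto simp: cycle_form_def)
  moreover have "set (map \<pi> (concat css)) = S"
    using form \<open>\<pi> ` S = S\<close> by (simp only: cycle_form_def set_map)
  ultimately show ?thesis unfolding cycle_form_def by auto
qed

lemma map_transpose_id: "a \<notin> set xs \<Longrightarrow> b \<notin> set xs \<Longrightarrow> map (transpose a b) xs = xs"
  by (intro map_idI) (auto simp: transpose_def)

text \<open>
  Only the cycles through \<open>a\<close> and \<open>b\<close> change: it suffices to exhibit the new cycles on the points of
  these.
\<close>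

lemma cycle_form_transpose_cycles:
  assumes form: "cycle_form S \<rho> (dss @ css)" and ab: "a \<in> set (concat dss)" "b \<in> set (concat dss)"
    and mset: "mset (concat dss) = mset (concat ess)" and ne: "[] \<notin> set ess"
    and cycles: "\<And>cs. cs \<in> set ess \<Longrightarrow> map (transpose a b \<circ> \<rho>) cs = rotate1 cs"
  shows "cycle_form S (transpose a b \<circ> \<rho>) (ess @ css)"
proof -
  have dist: "distinct (concat dss @ concat css)" and S: "set (concat dss @ concat css) = S"
    and rest: "\<And>cs. cs \<in> set css \<Longrightarrow> map \<rho> cs = rotate1 cs" and ne': "[] \<notin> set css"
    and out: "\<And>x. x \<notin> S \<Longrightarrow> \<rho> x = x"
    using form by (simp_all add: cycle_form_def)
  have "mset (concat dss @ concat css) = mset (concat ess @ concat css)" using mset by simp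
  from mset_eq_imp_distinct_iff[OF this] mset_eq_setD[OF this]
  have new: "distinct (concat (ess @ css))" "set (concat (ess @ css)) = S"
    using dist S by (simp_all only: concat_append)
  have other: "map (transpose a b \<circ> \<rho>) cs = rotate1 cs" if "cs \<in> set css" for cs
  proof -
    have "a \<notin> set (concat css)" "b \<notin> set (concat css)" using dist ab
      by (meson disjoint_iff distinct_append)+
    then have "map (transpose a b) (rotate1 cs) = rotate1 cs" using that by (intro map_transpose_id) auto
    then show ?thesis unfolding rest[OF that, symmetric] by simp
  qed
  have "a \<in> S" "b \<in> S" using ab S by auto
  then have "(transpose a b \<circ> \<rho>) x = x" if "x \<notin> S" for x
    using out[OF that] that by (auto simp: transpose_def)
  moreover have "map (transpose a b \<circ> \<rho>) cs = rotate1 cs" if "cs \<in> set (ess @ css)" for cs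
    using that cycles other by (metis Un_iff set_append)
  moreover have "[] \<notin> set (ess @ css)" using ne ne' by simp
  ultimately show ?thesis using new unfolding cycle_form_def by (intro conjI ballI allI impI)
qed

text \<open>
  A transposition of two points of the same cycle cuts this cycle in two, and, conversely
  (\<open>cycle_form_merge\<close>), a transposition of points of two cycles joins them.
\<close>

lemma cycle_form_split:
  assumes "cycle_form S \<rho> ((a # ys @ b # zs) # css)"
  shows "cycle_form S (transpose a b \<circ> \<rho>) ((b # zs) # (a # ys) # css)"
proof -
  have dist: "distinct (a # ys @ b # zs)" using assms by (auto simp: cycle_form_def)
  have "map \<rho> (a # ys @ b # zs) = ys @ b # zs @ [a]" using assms by (simp add: cycle_form_def)
  then have "map \<rho> (a # ys) @ map \<rho> (b # zs) = (ys @ [b]) @ (zs @ [a])" by simp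
  then have "map \<rho> (a # ys) = ys @ [b] \<and> map \<rho> (b # zs) = zs @ [a]"
    by (rule iffD1[OF append_eq_append_conv, rotated]) simp
  then have \<rho>: "map \<rho> (a # ys) = ys @ [b]" "map \<rho> (b # zs) = zs @ [a]" by blast+
  have "map (transpose a b \<circ> \<rho>) (a # ys) = map (transpose a b) (ys @ [b])"
    "map (transpose a b \<circ> \<rho>) (b # zs) = map (transpose a b) (zs @ [a])"
    unfolding \<rho>[symmetric] by simp_all
  then have cut: "map (transpose a b \<circ> \<rho>) (a # ys) = rotate1 (a # ys)"
    "map (transpose a b \<circ> \<rho>) (b # zs) = rotate1 (b # zs)"
    using dist by (simp_all add: map_transpose_id)
  have "cycle_form S (transpose a b \<circ> \<rho>) ([b # zs, a # ys] @ css)"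
  proof (rule cycle_form_transpose_cycles[where dss = "[a # ys @ b # zs]"])
    fix cs assume "cs \<in> set [b # zs, a # ys]"
    then consider "cs = b # zs" | "cs = a # ys" by auto
    then show "map (transpose a b \<circ> \<rho>) cs = rotate1 cs" by cases (simp_all only: cut)
  qed (use assms in auto)
  then show ?thesis by simp
qed

lemma cycle_form_merge:
  assumes "cycle_form S \<rho> ((b # zs) # (a # ys) # css)"
  shows "cycle_form S (transpose a b \<circ> \<rho>) ((a # ys @ b # zs) # css)"
proof -
  have \<rho>: "map \<rho> (a # ys) = ys @ [a]" "map \<rho> (b # zs) = zs @ [b]"
    using assms by (simp_all add: cycle_form_def)
  have dist: "distinct (concat [b # zs, a # ys])" using assms by (auto simp: cycle_form_def)
  have "map (transpose a b \<circ> \<rho>) (a # ys) = map (transpose a b) (ys @ [a])"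
    "map (transpose a b \<circ> \<rho>) (b # zs) = map (transpose a b) (zs @ [b])"
    unfolding \<rho>[symmetric] by simp_all
  then have "map (transpose a b \<circ> \<rho>) (a # ys) = ys @ [b]" "map (transpose a b \<circ> \<rho>) (b # zs) = zs @ [a]"
    using dist by (simp_all add: map_transpose_id)
  then have "map (transpose a b \<circ> \<rho>) ((a # ys) @ b # zs) = (ys @ [b]) @ zs @ [a]"
    by (simp only: map_append)
  then have join: "map (transpose a b \<circ> \<rho>) (a # ys @ b # zs) = rotate1 (a # ys @ b # zs)" by simp
  have "cycle_form S (transpose a b \<circ> \<rho>) ([a # ys @ b # zs] @ css)"
  proof (rule cycle_form_transpose_cycles[where dss = "[b # zs, a # ys]"])
    fix cs assume "cs \<in> set [a # ys @ b # zs]"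
    then have "cs = a # ys @ b # zs" by simp
    then show "map (transpose a b \<circ> \<rho>) cs = rotate1 cs" by (simp only: join)
  qed (use assms in auto)
  then show ?thesis by simp
qed

lemma cycle_form_head:
  assumes "cycle_form S \<rho> css" "a \<in> S"
  shows "\<exists>xs css'. cycle_form S \<rho> ((a # xs) # css') \<and> length css' + 1 = length css"
proof -
  obtain cs where cs: "cs \<in> set css" "a \<in> set cs" using assms by (auto simp: cycle_form_def)
  obtain us vs where css: "css = us @ cs # vs" using cs(1) by (meson split_list)
  obtain ys zs where "cs = ys @ a # zs" using cs(2) by (meson split_list)
  then have "rotate (length ys) cs = a # zs @ ys" by (simp add: rotate_append)
  moreover have "cycle_form S \<rho> (cs # us @ vs)"
    by (rule cycle_form_mset[OF assms(1)]) (simp add: css)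
  ultimately show ?thesis using cycle_form_rotate[of S \<rho> cs "us @ vs" "length ys"] css
    by (intro exI[of _ "zs @ ys"] exI[of _ "us @ vs"]) auto
qed

text \<open>
  Hence the number of cycles changes by exactly one, in a direction that depends only on whether the
  two points lie on a common cycle.
\<close>

lemma cycle_form_transpose:
  assumes form: "cycle_form S \<rho> ((a # xs) # css)" and b: "b \<in> S" "b \<noteq> a"
  shows "\<exists>css'. cycle_form S (transpose a b \<circ> \<rho>) css' \<and>
    length css' = (if b \<in> set xs then length css + 2 else length css)"
proof (cases "b \<in> set xs")
  case True
  then obtain ys zs where "xs = ys @ b # zs" by (meson split_list)
  then show ?thesis using cycle_form_split[of S \<rho> a ys b zs css] form True
    by (intro exI[of _ "(b # zs) # (a # ys) # css"]) auto
next
  case False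
  then obtain cs where cs: "cs \<in> set css" "b \<in> set cs" using form b by (auto simp: cycle_form_def)
  obtain us vs where css: "css = us @ cs # vs" using cs(1) by (meson split_list)
  obtain ys zs where "cs = ys @ b # zs" using cs(2) by (meson split_list)
  then have "rotate (length ys) cs = b # zs @ ys" by (simp add: rotate_append)
  moreover have "cycle_form S \<rho> (cs # (a # xs) # us @ vs)"
    by (rule cycle_form_mset[OF form]) (simp add: css)
  ultimately have "cycle_form S \<rho> ((b # zs @ ys) # (a # xs) # us @ vs)"
    using cycle_form_rotate by metis
  from cycle_form_merge[OF this] show ?thesis using False css
    by (intro exI[of _ "(a # xs @ b # zs @ ys) # us @ vs"]) auto
qed

section \<open>The norm of a permutation\<close>

lemma sum_list_length_singletons:
  "(\<And>cs. cs \<in> set css \<Longrightarrow> length cs = 1) \<Longrightarrow> sum_list (map length css) = length css"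
  by (induction css) auto

text \<open>
  Since a transposition changes the number of cycles by one, and the identity has \<open>n\<close> cycles, a
  product of \<open>k\<close> transpositions has at least \<open>n - k\<close> cycles. The induction is for all lists of
  cycles of the permutation, so that their number need not be known to be unique.
\<close>

lemma transposition_words_lower_bound:
  assumes "set ts \<subseteq> transpositions n" "cycle_form {1..n} (foldr (\<circ>) ts id) css"
  shows "n \<le> length ts + length css"
  using assms
proof (induction ts arbitrary: css)
  case Nil
  have "length cs = 1" if "cs \<in> set css" for cs
  proof -
    have "rotate1 cs = cs" "distinct cs" "cs \<noteq> []"
      using Nil that by (auto simp: cycle_form_def distinct_concat_iff)
    then show ?thesis by (cases cs rule: remdups_adj.cases) auto
  qed
  then have "sum_list (map length css) = length css" by (rule sum_list_length_singletons)
  then show ?case using cycle_form_length[OF Nil(2)] by simp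
next
  case (Cons t ts)
  obtain a b where t: "t = transpose a b" "a \<in> {1..n}" "b \<in> {1..n}" "a \<noteq> b"
    using Cons.prems(1) by (auto simp: transpositions_def)
  let ?\<rho> = "foldr (\<circ>) (t # ts) id"
  have eq: "foldr (\<circ>) ts id = transpose a b \<circ> ?\<rho>" by (simp add: t(1) comp_assoc[symmetric])
  obtain xs css' where 1: "cycle_form {1..n} ?\<rho> ((a # xs) # css')" "length css' + 1 = length css"
    using cycle_form_head[OF Cons.prems(2) t(2)] by blast
  obtain dss where dss: "cycle_form {1..n} (foldr (\<circ>) ts id) dss"
      "length dss = (if b \<in> set xs then length css' + 2 else length css')"
    unfolding eq using cycle_form_transpose[OF 1(1) t(3) t(4)[symmetric]] by blast
  then have "n \<le> length ts + length dss" "length dss \<le> length css + 1"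
    using Cons.IH[OF _ dss(1)] Cons.prems(1) 1(2) by (auto split: if_splits)
  then show ?case by simp
qed

text \<open>
  As long as there is a cycle of length at least two, a transposition of two of its neighbours
  splits it.
\<close>

lemma transposition_word_exists:
  assumes "cycle_form {1..n} \<rho> css"
  shows "\<exists>ts. length ts + length css = n \<and> set ts \<subseteq> transpositions n \<and> foldr (\<circ>) ts id = \<rho>"
  using assms
proof (induction "n - length css" arbitrary: \<rho> css rule: less_induct)
  case less
  have sum: "sum_list (map length css) = n" using cycle_form_length[OF less.prems] by simp
  have le: "length css \<le> sum_list (map length css)" if "[] \<notin> set css" for css :: "nat list list"
    using that
  proof (induction css)
    case (Cons c css)
    then have "length c \<ge> 1" by (cases c) auto
    with Cons show ?case by auto
  qed simp
  have nonempty: "[] \<notin> set css" using less.prems by (simp add: cycle_form_def)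
  show ?case
  proof (cases "\<exists>cs \<in> set css. length cs > 1")
    case True
    then obtain cs where cs: "cs \<in> set css" "length cs > 1" by auto
    obtain us vs where css: "css = us @ cs # vs" using cs(1) by (meson split_list)
    obtain a b zs where cs_eq: "cs = a # b # zs"
      using cs(2) by (cases cs rule: remdups_adj.cases) auto
    have form: "cycle_form {1..n} \<rho> ((a # [] @ b # zs) # us @ vs)"
      by (rule cycle_form_mset[OF less.prems]) (simp add: css cs_eq)
    let ?css = "(b # zs) # (a # []) # us @ vs"
    have split: "cycle_form {1..n} (transpose a b \<circ> \<rho>) ?css"
      by (rule cycle_form_split[OF form])
    have "length ?css \<le> n"
      using le[of ?css] cycle_form_length[OF split] split by (simp add: cycle_form_def)
    then have "n - length ?css < n - length css" by (simp add: css)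
    then obtain ts where ts: "length ts + length ?css = n" "set ts \<subseteq> transpositions n"
        "foldr (\<circ>) ts id = transpose a b \<circ> \<rho>"
      using less.hyps[OF _ split] by blast
    have "a \<in> {1..n}" "b \<in> {1..n}" "a \<noteq> b" using form by (auto simp: cycle_form_def)
    then have "transpose a b \<in> transpositions n" by (auto simp: transpositions_def)
    then show ?thesis using ts
      by (intro exI[of _ "transpose a b # ts"]) (auto simp: css comp_assoc[symmetric])
  next
    case False
    have one: "\<exists>x. cs = [x]" if "cs \<in> set css" for cs
      using that False nonempty by (cases cs rule: remdups_adj.cases) auto
    have "\<rho> x = x" for x
    proof (cases "x \<in> {1..n}")
      case True
      then have "x \<in> set (concat css)" using less.prems unfolding cycle_form_def by blast
      then obtain cs where "cs \<in> set css" "x \<in> set cs" by auto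
      with one have "[x] \<in> set css" by fastforce
      then have "map \<rho> [x] = rotate1 [x]" using less.prems unfolding cycle_form_def by blast
      then show ?thesis by simp
    qed (use less.prems in \<open>simp add: cycle_form_def\<close>)
    then have "\<rho> = id" by auto
    moreover have "sum_list (map length css) = length css"
      using one by (intro sum_list_length_singletons) fastforce
    ultimately show ?thesis using sum by (intro exI[of _ "[]"]) auto
  qed
qed

lemma perm_norm_cycle_form:
  assumes "cycle_form {1..n} \<rho> css"
  shows "perm_norm n \<rho> + length css = n"
proof -
  obtain ts where ts: "length ts + length css = n" "set ts \<subseteq> transpositions n" "foldr (\<circ>) ts id = \<rho>"
    using transposition_word_exists[OF assms] by auto
  have "perm_norm n \<rho> = length ts"
    unfolding perm_norm_def
  proof (rule Least_equality)
    fix k assume "\<exists>ts. length ts = k \<and> set ts \<subseteq> transpositions n \<and> foldr (\<circ>) ts id = \<rho>"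
    then show "length ts \<le> k"
      using transposition_words_lower_bound[of _ n css] assms ts(1) by fastforce
  qed (use ts in blast)
  then show ?thesis using ts(1) by simp
qed

lemma permutes_norm_word:
  assumes "\<rho> permutes {1..n}"
  shows "\<exists>ts. length ts = perm_norm n \<rho> \<and> set ts \<subseteq> transpositions n \<and> foldr (\<circ>) ts id = \<rho>"
proof -
  obtain css where css: "cycle_form {1..n} \<rho> css" using cycle_form_exists[OF assms] by auto
  from transposition_word_exists[OF this] perm_norm_cycle_form[OF this] show ?thesis by auto
qed

lemma foldr_comp_append: "foldr (\<circ>) (ts @ us) id = foldr (\<circ>) ts id \<circ> foldr (\<circ>) us id"
  by (induction ts) (auto simp: comp_assoc)

lemma perm_norm_le:
  "set ts \<subseteq> transpositions n \<Longrightarrow> perm_norm n (foldr (\<circ>) ts id) \<le> length ts"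
  unfolding perm_norm_def by (rule Least_le) blast

lemma perm_norm_comp_le:
  assumes "\<sigma> permutes {1..n}" "\<tau> permutes {1..n}"
  shows "perm_norm n (\<sigma> \<circ> \<tau>) \<le> perm_norm n \<sigma> + perm_norm n \<tau>"
proof -
  obtain ts where ts: "length ts = perm_norm n \<sigma>" "set ts \<subseteq> transpositions n" "foldr (\<circ>) ts id = \<sigma>"
    using permutes_norm_word[OF assms(1)] by auto
  obtain us where us: "length us = perm_norm n \<tau>" "set us \<subseteq> transpositions n" "foldr (\<circ>) us id = \<tau>"
    using permutes_norm_word[OF assms(2)] by auto
  show ?thesis using perm_norm_le[of "ts @ us" n] ts us foldr_comp_append[of ts us] by auto
qed

lemma perm_norm_id: "perm_norm n id = 0"
  using perm_norm_le[of "[]" n] by simp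

lemma perm_norm_conj:
  assumes "\<sigma> permutes {1..n}" "\<pi> permutes {1..n}"
  shows "perm_norm n (\<pi> \<circ> \<sigma> \<circ> inv' \<pi>) = perm_norm n \<sigma>"
proof -
  obtain css where css: "cycle_form {1..n} \<sigma> css" using cycle_form_exists[OF assms(1)] by auto
  from perm_norm_cycle_form[OF css] perm_norm_cycle_form[OF cycle_form_conj[OF css assms(2)]]
  show ?thesis by simp
qed

text \<open>
  The criterion behind the product formula: a transposition lowers the norm if and only if it
  transposes two points of the same cycle.
\<close>

lemma perm_norm_transpose:
  assumes "cycle_form {1..n} \<rho> ((a # xs) # css)" "b \<in> {1..n}"
  shows "perm_norm n (transpose a b \<circ> \<rho>) =
    (if b = a then perm_norm n \<rho> else if b \<in> set xs then perm_norm n \<rho> - 1 else perm_norm n \<rho> + 1)"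
    and "b \<in> set xs \<Longrightarrow> perm_norm n \<rho> > 0"
proof -
  have *: "perm_norm n \<rho> + length css + 1 = n" using perm_norm_cycle_form[OF assms(1)] by simp
  show "perm_norm n (transpose a b \<circ> \<rho>) =
    (if b = a then perm_norm n \<rho> else if b \<in> set xs then perm_norm n \<rho> - 1 else perm_norm n \<rho> + 1)"
  proof (cases "b = a")
    case False
    obtain css' where "cycle_form {1..n} (transpose a b \<circ> \<rho>) css'"
        "length css' = (if b \<in> set xs then length css + 2 else length css)"
      using cycle_form_transpose[OF assms False] by auto
    from perm_norm_cycle_form[OF this(1)] this(2) * False show ?thesis by (auto split: if_splits)
  qed simp
  assume "b \<in> set xs"
  moreover have "a \<notin> set xs" using assms(1) by (simp add: cycle_form_def)
  ultimately obtain css' where "cycle_form {1..n} (transpose a b \<circ> \<rho>) css'" "length css'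
    = length css + 2"
    using cycle_form_transpose[OF assms] by force
  from perm_norm_cycle_form[OF this(1)] this(2) * show "perm_norm n \<rho> > 0" by auto
qed

declare One_nat_def [simp del]

section \<open>The algebra of invariants is a commutative ring\<close>

abbreviation coeff :: "('a \<Rightarrow>\<^sub>0 rat) \<Rightarrow> 'a \<Rightarrow> rat" where
  "coeff \<equiv> Poly_Mapping.lookup"

lemma lookup_scale [simp]: "coeff (scale c f) x = c * coeff f x"
  by (simp add: Poly_Mapping.map.rep_eq when_def)

abbreviation coeff_support :: "perm_comb \<Rightarrow> (nat \<Rightarrow> nat) set" where
  "coeff_support f \<equiv> Poly_Mapping.keys f"

lemma permutes_comp_eq_iff:
  assumes "\<sigma> permutes S"
  shows "\<sigma> \<circ> \<tau> = \<rho> \<longleftrightarrow> \<tau> = inv' \<sigma> \<circ> \<rho>"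
proof
  assume "\<sigma> \<circ> \<tau> = \<rho>"
  then have "inv' \<sigma> \<circ> \<rho> = (inv' \<sigma> \<circ> \<sigma>) \<circ> \<tau>" by (simp add: comp_assoc)
  then show "\<tau> = inv' \<sigma> \<circ> \<rho>" using permutes_inv_o(2)[OF assms] by simp
next
  assume "\<tau> = inv' \<sigma> \<circ> \<rho>"
  then have "\<sigma> \<circ> \<tau> = (\<sigma> \<circ> inv' \<sigma>) \<circ> \<rho>" by (simp add: comp_assoc)
  then show "\<sigma> \<circ> \<tau> = \<rho>" using permutes_inv_o(1)[OF assms] by simp
qed

lemma conj_eq_iff:
  assumes "\<pi> permutes S"
  shows "\<pi> \<circ> \<tau> \<circ> inv' \<pi> = \<pi> \<circ> \<rho> \<circ> inv' \<pi> \<longleftrightarrow> \<tau> = \<rho>"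
proof
  assume "\<pi> \<circ> \<tau> \<circ> inv' \<pi> = \<pi> \<circ> \<rho> \<circ> inv' \<pi>"
  then have "inv' \<pi> \<circ> (\<pi> \<circ> \<tau> \<circ> inv' \<pi>) \<circ> \<pi> = inv' \<pi> \<circ> (\<pi> \<circ> \<rho> \<circ> inv' \<pi>) \<circ> \<pi>" by simp
  then have "(inv' \<pi> \<circ> \<pi>) \<circ> \<tau> \<circ> (inv' \<pi> \<circ> \<pi>) = (inv' \<pi> \<circ> \<pi>) \<circ> \<rho> \<circ> (inv' \<pi> \<circ> \<pi>)"
    by (simp add: comp_assoc)
  then show "\<tau> = \<rho>" using permutes_inv_o(2)[OF assms] by simp
qed simp

text \<open>
  In \<open>\<sigma> \<circ> \<tau> = \<rho>\<close> the second factor is determined by the first, which turns the product into a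
  convolution with a single summation variable.
\<close>

lemma lookup_graded_mult:
  assumes f: "coeff_support f \<subseteq> {p. p permutes {1..n}}" and g: "coeff_support g \<subseteq> {p. p permutes {1..n}}"
  shows "coeff (graded_mult n f g) \<rho> = (if \<rho> permutes {1..n} then
    \<Sum>\<sigma> | \<sigma> permutes {1..n}. if perm_norm n \<rho> = perm_norm n \<sigma> + perm_norm n (inv' \<sigma> \<circ> \<rho>)
      then coeff f \<sigma> * coeff g (inv' \<sigma> \<circ> \<rho>) else 0 else 0)"
proof -
  let ?S = "{p. p permutes {1..n}}"
  define t where "t \<sigma> \<tau> = (if perm_norm n (\<sigma> \<circ> \<tau>) = perm_norm n \<sigma> + perm_norm n \<tau> \<and> \<sigma> \<circ> \<tau> = \<rho>
    then coeff f \<sigma> * coeff g \<tau> else 0)" for \<sigma> \<tau>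
  have fin: "finite ?S" by (simp add: finite_permutations)
  have "coeff (graded_mult n f g) \<rho> = (\<Sum>\<sigma>\<in>coeff_support f. \<Sum>\<tau>\<in>coeff_support g. t \<sigma> \<tau>)"
    unfolding graded_mult_def lookup_sum t_def
    by (intro sum.cong refl) (auto simp: lookup_single when_def)
  also have "\<dots> = (\<Sum>\<sigma>\<in>coeff_support f. \<Sum>\<tau>\<in>?S. t \<sigma> \<tau>)"
    by (intro sum.cong refl sum.mono_neutral_left fin g) (auto simp: t_def in_keys_iff)
  also have "\<dots> = (\<Sum>\<sigma>\<in>?S. \<Sum>\<tau>\<in>?S. t \<sigma> \<tau>)"
    by (intro sum.mono_neutral_left fin f) (auto simp: t_def in_keys_iff intro!: sum.neutral)
  also have "\<dots> = (if \<rho> permutes {1..n} then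
    \<Sum>\<sigma>\<in>?S. if perm_norm n \<rho> = perm_norm n \<sigma> + perm_norm n (inv' \<sigma> \<circ> \<rho>)
      then coeff f \<sigma> * coeff g (inv' \<sigma> \<circ> \<rho>) else 0 else 0)"
  proof (cases "\<rho> permutes {1..n}")
    case True
    have "(\<Sum>\<tau>\<in>?S. t \<sigma> \<tau>) = (if perm_norm n \<rho> = perm_norm n \<sigma> + perm_norm n (inv' \<sigma> \<circ> \<rho>)
      then coeff f \<sigma> * coeff g (inv' \<sigma> \<circ> \<rho>) else 0)" (is "_ = ?r") if "\<sigma> \<in> ?S" for \<sigma>
    proof -
      have \<sigma>: "\<sigma> permutes {1..n}" using that by simp
      have cancel: "\<sigma> \<circ> (inv' \<sigma> \<circ> \<rho>) = \<rho>" using permutes_comp_eq_iff[OF \<sigma>] by blast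
      have "(\<Sum>\<tau>\<in>?S. t \<sigma> \<tau>) = (\<Sum>\<tau>\<in>?S. if \<tau> = inv' \<sigma> \<circ> \<rho> then ?r else 0)"
        by (intro sum.cong refl) (auto simp: t_def permutes_comp_eq_iff[OF \<sigma>] cancel)
      also have "\<dots> = ?r"
        using fin permutes_compose[OF True permutes_inv[OF \<sigma>]] by (simp add: sum.delta)
      finally show ?thesis .
    qed
    then show ?thesis using True by simp
  next
    case False
    then have "t \<sigma> \<tau> = 0" if "\<sigma> \<in> ?S" "\<tau> \<in> ?S" for \<sigma> \<tau>
      using that permutes_compose[of \<tau> "{1..n}" \<sigma>] by (auto simp: t_def)
    then show ?thesis using False by simp
  qed
  finally show ?thesis .
qed

lemma invariant_algebra_simps [simp]:
  "mult (invariant_algebra n) = graded_mult n" "one (invariant_algebra n) = basis_elt id"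
  "zero (invariant_algebra n) = 0" "add (invariant_algebra n) = (+)" "smult (invariant_algebra n)
    = scale"
  by (simp_all add: invariant_algebra_def graded_group_algebra_def)

lemma lookup_conj_action:
  assumes "\<pi> permutes {1..n}"
  shows "coeff (conj_action \<pi> f) (\<pi> \<circ> \<rho> \<circ> inv' \<pi>) = coeff f \<rho>"
proof -
  have "coeff (conj_action \<pi> f) (\<pi> \<circ> \<rho> \<circ> inv' \<pi>) =
      (\<Sum>\<tau>\<in>coeff_support f. if \<tau> = \<rho> then coeff f \<tau> else 0)"
    unfolding conj_action_def lookup_sum
    by (intro sum.cong refl) (simp add: lookup_single when_def conj_eq_iff[OF assms])
  then show ?thesis by (simp add: in_keys_iff)
qed

lemma invariant_algebra_carrier:
  "f \<in> carrier (invariant_algebra n) \<longleftrightarrow> coeff_support f \<subseteq> {p. p permutes {1..n}} \<and>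
    (\<forall>\<pi> \<rho>. \<pi> permutes {1..n} \<longrightarrow> \<rho> permutes {1..n} \<longrightarrow> coeff f (\<pi> \<circ> \<rho> \<circ> inv' \<pi>) = coeff f \<rho>)"
proof -
  have "conj_action \<pi> f = f" if supp: "coeff_support f \<subseteq> {p. p permutes {1..n}}"
    and inv: "\<forall>\<pi> \<rho>. \<pi> permutes {1..n} \<longrightarrow> \<rho> permutes {1..n} \<longrightarrow> coeff f (\<pi> \<circ> \<rho> \<circ> inv' \<pi>) = coeff f \<rho>"
    and \<pi>: "\<pi> permutes {1..n}" for \<pi>
  proof (rule poly_mapping_eqI)
    fix \<rho>
    define \<rho>' where "\<rho>' = inv' \<pi> \<circ> \<rho> \<circ> \<pi>"
    have "\<pi> \<circ> \<rho>' \<circ> inv' \<pi> = (\<pi> \<circ> inv' \<pi>) \<circ> \<rho> \<circ> (\<pi> \<circ> inv' \<pi>)" by (simp add: \<rho>'_def comp_assoc)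
    then have \<rho>: "\<rho> = \<pi> \<circ> \<rho>' \<circ> inv' \<pi>" using permutes_inv_o(1)[OF \<pi>] by simp
    have "coeff (conj_action \<pi> f) \<rho> = coeff f \<rho>'" using lookup_conj_action[OF \<pi>, of f \<rho>'] \<rho> by simp
    also have "\<dots> = coeff f \<rho>"
    proof (cases "\<rho>' permutes {1..n}")
      case True
      then show ?thesis using inv \<pi> \<rho> by metis
    next
      case False
      have "\<not> \<rho> permutes {1..n}"
        using False \<rho>'_def permutes_compose[OF permutes_compose[OF \<pi>] permutes_inv[OF \<pi>]]
        by (metis comp_assoc)
      then show ?thesis using False supp by (metis in_keys_iff mem_Collect_eq subsetD)
    qed
    finally show "coeff (conj_action \<pi> f) \<rho> = coeff f \<rho>" .
  qed
  moreover have "coeff f (\<pi> \<circ> \<rho> \<circ> inv' \<pi>) = coeff f \<rho>"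
    if "conj_action \<pi> f = f" "\<pi> permutes {1..n}" for \<pi> \<rho>
    using lookup_conj_action[OF that(2), of f \<rho>] that(1) by simp
  ultimately show ?thesis
    by (auto simp: invariant_algebra_def graded_group_algebra_def sym_group_def)
qed

lemma invariant_support:
  "f \<in> carrier (invariant_algebra n) \<Longrightarrow> coeff_support f \<subseteq> {p. p permutes {1..n}}"
  by (simp add: invariant_algebra_carrier)

lemma invariant_conj:
  "\<lbrakk>f \<in> carrier (invariant_algebra n); \<pi> permutes {1..n}; \<rho> permutes {1..n}\<rbrakk>
    \<Longrightarrow> coeff f (\<pi> \<circ> \<rho> \<circ> inv' \<pi>) = coeff f \<rho>"
  by (simp add: invariant_algebra_carrier)

lemma lookup_mult_invariant:
  assumes "f \<in> carrier (invariant_algebra n)" "g \<in> carrier (invariant_algebra n)"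
  shows "coeff (graded_mult n f g) \<rho> = (if \<rho> permutes {1..n} then
    \<Sum>\<sigma> | \<sigma> permutes {1..n}. if perm_norm n \<rho> = perm_norm n \<sigma> + perm_norm n (inv' \<sigma> \<circ> \<rho>)
      then coeff f \<sigma> * coeff g (inv' \<sigma> \<circ> \<rho>) else 0 else 0)"
  by (rule lookup_graded_mult) (use assms in \<open>simp_all add: invariant_support\<close>)

lemma invariant_eqI:
  assumes "coeff_support f \<subseteq> {p. p permutes {1..n}}" "coeff_support g \<subseteq> {p. p permutes {1..n}}"
    and "\<And>\<rho>. \<rho> permutes {1..n} \<Longrightarrow> coeff f \<rho> = coeff g \<rho>"
  shows "f = g"
proof (rule poly_mapping_eqI)
  show "coeff f \<rho> = coeff g \<rho>" for \<rho>
    using assms by (metis in_keys_iff mem_Collect_eq subsetD)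
qed

lemma permutes_conj:
  "\<lbrakk>\<pi> permutes S; \<sigma> permutes S\<rbrakk> \<Longrightarrow> \<pi> \<circ> \<sigma> \<circ> inv' \<pi> permutes S"
  by (metis permutes_compose permutes_inv)

lemma conj_inv_comp:
  assumes "\<pi> permutes S" "\<sigma> permutes S"
  shows "inv' (\<pi> \<circ> \<sigma> \<circ> inv' \<pi>) \<circ> (\<pi> \<circ> \<rho> \<circ> inv' \<pi>) = \<pi> \<circ> (inv' \<sigma> \<circ> \<rho>) \<circ> inv' \<pi>"
proof -
  have "(\<pi> \<circ> \<sigma> \<circ> inv' \<pi>) \<circ> (\<pi> \<circ> (inv' \<sigma> \<circ> \<rho>) \<circ> inv' \<pi>)
      = \<pi> \<circ> (\<sigma> \<circ> (inv' \<pi> \<circ> \<pi>) \<circ> inv' \<sigma>) \<circ> \<rho> \<circ> inv' \<pi>" by (simp add: comp_assoc)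
  also have "\<dots> = \<pi> \<circ> \<rho> \<circ> inv' \<pi>"
    using permutes_inv_o[OF assms(1)] permutes_inv_o[OF assms(2)] by simp
  finally show ?thesis using permutes_comp_eq_iff[OF permutes_conj[OF assms]] by metis
qed

lemma invariant_mult_closed:
  assumes f: "f \<in> carrier (invariant_algebra n)" and g: "g \<in> carrier (invariant_algebra n)"
  shows "graded_mult n f g \<in> carrier (invariant_algebra n)"
proof -
  let ?S = "{p. p permutes {1..n}}"
  have "coeff (graded_mult n f g) (\<pi> \<circ> \<rho> \<circ> inv' \<pi>) = coeff (graded_mult n f g) \<rho>"
    if \<pi>: "\<pi> permutes {1..n}" and \<rho>: "\<rho> permutes {1..n}" for \<pi> \<rho>
  proof -
    define c where "c \<sigma> = \<pi> \<circ> \<sigma> \<circ> inv' \<pi>" for \<sigma>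
    define t where "t \<rho> \<sigma> = (if perm_norm n \<rho> = perm_norm n \<sigma> + perm_norm n (inv' \<sigma> \<circ> \<rho>)
      then coeff f \<sigma> * coeff g (inv' \<sigma> \<circ> \<rho>) else 0)" for \<rho> \<sigma>
    have inj: "inj_on c ?S" by (rule inj_onI) (simp add: c_def conj_eq_iff[OF \<pi>])
    have "c ` ?S \<subseteq> ?S" using permutes_conj[OF \<pi>] by (auto simp: c_def)
    then have image: "c ` ?S = ?S" using inj by (simp add: endo_inj_surj finite_permutations)
    have eq: "t (c \<rho>) (c \<sigma>) = t \<rho> \<sigma>" if "\<sigma> \<in> ?S" for \<sigma>
    proof -
      have \<sigma>: "\<sigma> permutes {1..n}" using that by simp
      have d: "inv' \<sigma> \<circ> \<rho> permutes {1..n}" using \<sigma> \<rho> by (intro permutes_compose permutes_inv)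
      show ?thesis
        unfolding t_def c_def conj_inv_comp[OF \<pi> \<sigma>] perm_norm_conj[OF \<rho> \<pi>] perm_norm_conj[OF \<sigma> \<pi>]
          perm_norm_conj[OF d \<pi>] invariant_conj[OF f \<pi> \<sigma>] invariant_conj[OF g \<pi> d] ..
    qed
    have "(\<Sum>\<sigma>\<in>?S. t (c \<rho>) \<sigma>) = (\<Sum>\<sigma>\<in>?S. t \<rho> \<sigma>)"
      by (rule sum.reindex_cong[where g = "t (c \<rho>)" and h = "t \<rho>", OF inj image[symmetric] eq])
    then show ?thesis using \<rho> permutes_conj[OF \<pi> \<rho>] by (simp add: lookup_mult_invariant[OF f g]
      t_def c_def)
  qed
  moreover have "coeff_support (graded_mult n f g) \<subseteq> ?S"
    by (auto simp: in_keys_iff lookup_mult_invariant[OF f g] split: if_splits)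
  ultimately show ?thesis by (simp add: invariant_algebra_carrier)
qed

text \<open>
  Every product can be rewritten as \<open>\<sigma> \<circ> \<tau> = (\<sigma> \<circ> \<tau> \<circ> \<sigma>\<inverse>) \<circ> \<sigma>\<close>, and a class function has the same
  value at \<open>\<tau>\<close> and at its conjugate. In terms of the convolution this is the substitution
  \<open>\<sigma> \<mapsto> \<rho> \<circ> \<sigma>\<inverse>\<close>.
\<close>

lemma invariant_mult_comm:
  assumes f: "f \<in> carrier (invariant_algebra n)" and g: "g \<in> carrier (invariant_algebra n)"
  shows "graded_mult n f g = graded_mult n g f"
proof (rule invariant_eqI)
  show "coeff_support (graded_mult n f g) \<subseteq> {p. p permutes {1..n}}"
    "coeff_support (graded_mult n g f) \<subseteq> {p. p permutes {1..n}}"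
    using invariant_mult_closed[OF f g] invariant_mult_closed[OF g f]
      by (simp_all add: invariant_algebra_carrier)
next
  let ?S = "{p. p permutes {1..n}}"
  fix \<rho> assume \<rho>: "\<rho> permutes {1..n}"
  define t where "t f g \<sigma> = (if perm_norm n \<rho> = perm_norm n \<sigma> + perm_norm n (inv' \<sigma> \<circ> \<rho>)
      then coeff f \<sigma> * coeff g (inv' \<sigma> \<circ> \<rho>) else 0)" for f g :: perm_comb and \<sigma>
  define i where "i \<sigma> = \<rho> \<circ> inv' \<sigma>" for \<sigma> :: "nat \<Rightarrow> nat"
  have i: "i \<sigma> permutes {1..n}" "inv' (i \<sigma>) \<circ> \<rho> = \<sigma>" if "\<sigma> permutes {1..n}" for \<sigma>
  proof -
    show 1: "i \<sigma> permutes {1..n}" unfolding i_def using \<rho> that by (intro permutes_compose permutes_inv)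
    have "i \<sigma> \<circ> \<sigma> = \<rho>" using permutes_inv_o(2)[OF that] by (simp add: i_def comp_assoc)
    then show "inv' (i \<sigma>) \<circ> \<rho> = \<sigma>" using permutes_comp_eq_iff[OF 1] by metis
  qed
  have inj: "inj_on i ?S"
    by (rule inj_onI) (metis i(2) mem_Collect_eq)
  have "i ` ?S \<subseteq> ?S" using i(1) by auto
  then have image: "i ` ?S = ?S" using inj by (simp add: endo_inj_surj finite_permutations)
  have eq: "t g f (i \<sigma>) = t f g \<sigma>" if "\<sigma> \<in> ?S" for \<sigma>
  proof -
    have \<sigma>: "\<sigma> permutes {1..n}" using that by simp
    have d: "inv' \<sigma> \<circ> \<rho> permutes {1..n}" using \<sigma> \<rho> by (intro permutes_compose permutes_inv)
    have conj: "\<sigma> \<circ> (inv' \<sigma> \<circ> \<rho>) \<circ> inv' \<sigma> = i \<sigma>"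
      using permutes_inv_o(1)[OF \<sigma>] by (simp add: i_def comp_assoc[symmetric])
    have "perm_norm n (i \<sigma>) = perm_norm n (inv' \<sigma> \<circ> \<rho>)" "coeff g (i \<sigma>) = coeff g (inv' \<sigma> \<circ> \<rho>)"
      using perm_norm_conj[OF d \<sigma>] invariant_conj[OF g \<sigma> d] conj by simp_all
    then show ?thesis using i(2)[OF \<sigma>] by (simp add: t_def add.commute mult.commute)
  qed
  have "(\<Sum>\<sigma>\<in>?S. t g f \<sigma>) = (\<Sum>\<sigma>\<in>?S. t f g \<sigma>)"
    by (rule sum.reindex_cong[where g = "t g f" and h = "t f g", OF inj image[symmetric] eq])
  then show "coeff (graded_mult n f g) \<rho> = coeff (graded_mult n g f) \<rho>"
    using \<rho> by (simp add: lookup_mult_invariant[OF f g] lookup_mult_invariant[OF g f] t_def)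
qed

text \<open>
  Both sides are sums over factorizations of \<open>\<rho>\<close> into three factors. By subadditivity of the norm,
  the two successive conditions on norms hold on either side if and only if the norm is additive on
  all three factors.
\<close>

lemma invariant_mult_assoc:
  assumes f: "f \<in> carrier (invariant_algebra n)" and g: "g \<in> carrier (invariant_algebra n)"
    and h: "h \<in> carrier (invariant_algebra n)"
  shows "graded_mult n (graded_mult n f g) h = graded_mult n f (graded_mult n g h)"
proof (rule invariant_eqI)
  note fg = invariant_mult_closed[OF f g] and gh = invariant_mult_closed[OF g h]
  show "coeff_support (graded_mult n (graded_mult n f g) h) \<subseteq> {p. p permutes {1..n}}"
    "coeff_support (graded_mult n f (graded_mult n g h)) \<subseteq> {p. p permutes {1..n}}"
    using invariant_mult_closed[OF fg h] invariant_mult_closed[OF f gh]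
      by (simp_all add: invariant_algebra_carrier)
  let ?S = "{p. p permutes {1..n}}" and ?N = "perm_norm n"
  fix \<rho> assume \<rho>: "\<rho> permutes {1..n}"
  define u where "u \<sigma> \<tau> = (if ?N \<rho> = ?N \<sigma> + ?N \<tau> + ?N (inv' \<tau> \<circ> (inv' \<sigma> \<circ> \<rho>))
    then coeff f \<sigma> * coeff g \<tau> * coeff h (inv' \<tau> \<circ> (inv' \<sigma> \<circ> \<rho>)) else 0)" for \<sigma> \<tau>
  have right: "(if ?N \<rho> = ?N \<sigma> + ?N (inv' \<sigma> \<circ> \<rho>) then coeff f \<sigma> * coeff (graded_mult n g h)
    (inv' \<sigma> \<circ> \<rho>) else 0)
    = (\<Sum>\<tau>\<in>?S. u \<sigma> \<tau>)" if "\<sigma> \<in> ?S" for \<sigma>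
  proof -
    have \<sigma>: "\<sigma> permutes {1..n}" using that by simp
    have d: "inv' \<sigma> \<circ> \<rho> permutes {1..n}" using \<sigma> \<rho> by (intro permutes_compose permutes_inv)
    have sub: "?N \<rho> \<le> ?N \<sigma> + ?N (inv' \<sigma> \<circ> \<rho>)"
      using perm_norm_comp_le[OF \<sigma> d] permutes_inv_o(1)[OF \<sigma>] by (simp add: comp_assoc[symmetric])
    have sub2: "?N (inv' \<sigma> \<circ> \<rho>) \<le> ?N \<tau> + ?N (inv' \<tau> \<circ> (inv' \<sigma> \<circ> \<rho>))" if "\<tau> permutes {1..n}" for \<tau>
      using perm_norm_comp_le[OF that permutes_compose[OF d permutes_inv[OF that]]]
        permutes_inv_o(1)[OF that]
      by (simp add: comp_assoc[symmetric])
    have "(if ?N \<rho> = ?N \<sigma> + ?N (inv' \<sigma> \<circ> \<rho>) then coeff f \<sigma> * coeff (graded_mult n g h)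
      (inv' \<sigma> \<circ> \<rho>) else 0)
      = (\<Sum>\<tau>\<in>?S. if ?N \<rho> = ?N \<sigma> + ?N (inv' \<sigma> \<circ> \<rho>) \<and> ?N (inv' \<sigma> \<circ> \<rho>) = ?N \<tau> + ?N (inv' \<tau> \<circ> (inv' \<sigma> \<circ> \<rho>))
        then coeff f \<sigma> * coeff g \<tau> * coeff h (inv' \<tau> \<circ> (inv' \<sigma> \<circ> \<rho>)) else 0)"
      using d by (auto simp: lookup_mult_invariant[OF g h] sum_distrib_left intro!: sum.cong)
    also have "\<dots> = (\<Sum>\<tau>\<in>?S. u \<sigma> \<tau>)"
      unfolding u_def
    proof (intro sum.cong refl if_cong)
      fix \<tau> assume "\<tau> \<in> ?S"
      then show "(?N \<rho> = ?N \<sigma> + ?N (inv' \<sigma> \<circ> \<rho>) \<and> ?N (inv' \<sigma> \<circ> \<rho>) = ?N \<tau> + ?N (inv' \<tau> \<circ> (inv' \<sigma> \<circ> \<rho>)))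
        = (?N \<rho> = ?N \<sigma> + ?N \<tau> + ?N (inv' \<tau> \<circ> (inv' \<sigma> \<circ> \<rho>)))"
        using sub sub2[of \<tau>] by auto
    qed
    finally show ?thesis .
  qed
  have left: "(\<Sum>\<pi>\<in>?S. if ?N \<rho> = ?N \<pi> + ?N (inv' \<pi> \<circ> \<rho>) \<and> ?N \<pi> = ?N \<sigma> + ?N (inv' \<sigma> \<circ> \<pi>)
      then coeff f \<sigma> * coeff g (inv' \<sigma> \<circ> \<pi>) * coeff h (inv' \<pi> \<circ> \<rho>) else 0) = (\<Sum>\<tau>\<in>?S. u \<sigma> \<tau>)"
    (is "sum ?v _ = _") if "\<sigma> \<in> ?S" for \<sigma>
  proof -
    have \<sigma>: "\<sigma> permutes {1..n}" using that by simp
    have inj: "inj_on ((\<circ>) \<sigma>) ?S"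
      by (rule inj_onI) (metis permutes_comp_eq_iff[OF \<sigma>])
    have "(\<circ>) \<sigma> ` ?S \<subseteq> ?S" using permutes_compose[OF _ \<sigma>] by auto
    then have image: "(\<circ>) \<sigma> ` ?S = ?S" using inj by (simp add: endo_inj_surj finite_permutations)
    have eq: "?v (\<sigma> \<circ> \<tau>) = u \<sigma> \<tau>" if "\<tau> \<in> ?S" for \<tau>
    proof -
      have \<tau>: "\<tau> permutes {1..n}" using that by simp
      have st: "\<sigma> \<circ> \<tau> permutes {1..n}" by (rule permutes_compose[OF \<tau> \<sigma>])
      have 1: "inv' \<sigma> \<circ> (\<sigma> \<circ> \<tau>) = \<tau>" using permutes_comp_eq_iff[OF \<sigma>] by metis
      have "(\<sigma> \<circ> \<tau>) \<circ> (inv' \<tau> \<circ> (inv' \<sigma> \<circ> \<rho>)) = \<sigma> \<circ> (\<tau> \<circ> inv' \<tau>) \<circ> inv' \<sigma> \<circ> \<rho>"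
        by (simp add: comp_assoc)
      also have "\<dots> = \<rho>" using permutes_inv_o(1)[OF \<sigma>] permutes_inv_o(1)[OF \<tau>] by simp
      finally have 2: "inv' (\<sigma> \<circ> \<tau>) \<circ> \<rho> = inv' \<tau> \<circ> (inv' \<sigma> \<circ> \<rho>)"
        using permutes_comp_eq_iff[OF st] by metis
      have d: "inv' \<tau> \<circ> (inv' \<sigma> \<circ> \<rho>) permutes {1..n}"
        using \<sigma> \<tau> \<rho> by (intro permutes_compose permutes_inv)
      have "?N \<rho> \<le> ?N (\<sigma> \<circ> \<tau>) + ?N (inv' \<tau> \<circ> (inv' \<sigma> \<circ> \<rho>))"
        using perm_norm_comp_le[OF st d] permutes_comp_eq_iff[OF st, of "inv' \<tau> \<circ> (inv' \<sigma> \<circ> \<rho>)" \<rho>] 2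
          by simp
      moreover have "?N (\<sigma> \<circ> \<tau>) \<le> ?N \<sigma> + ?N \<tau>" by (rule perm_norm_comp_le[OF \<sigma> \<tau>])
      ultimately have "(?N \<rho> = ?N (\<sigma> \<circ> \<tau>) + ?N (inv' \<tau> \<circ> (inv' \<sigma> \<circ> \<rho>)) \<and> ?N (\<sigma> \<circ> \<tau>) = ?N \<sigma> + ?N \<tau>)
        = (?N \<rho> = ?N \<sigma> + ?N \<tau> + ?N (inv' \<tau> \<circ> (inv' \<sigma> \<circ> \<rho>)))" by auto
      then show ?thesis unfolding u_def 1 2 by simp
    qed
    show ?thesis by (rule sum.reindex_cong[where g = ?v and h = "u \<sigma>", OF inj image[symmetric] eq])
  qed
  have "coeff (graded_mult n (graded_mult n f g) h) \<rho> =
      (\<Sum>\<pi>\<in>?S. if ?N \<rho> = ?N \<pi> + ?N (inv' \<pi> \<circ> \<rho>) then coeff (graded_mult n f g) \<pi> * coeff h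
        (inv' \<pi> \<circ> \<rho>) else 0)"
    using \<rho> by (simp add: lookup_mult_invariant[OF fg h])
  also have "\<dots> = (\<Sum>\<pi>\<in>?S. \<Sum>\<sigma>\<in>?S. if ?N \<rho> = ?N \<pi> + ?N (inv' \<pi> \<circ> \<rho>) \<and> ?N \<pi> = ?N \<sigma> + ?N (inv' \<sigma> \<circ> \<pi>)
      then coeff f \<sigma> * coeff g (inv' \<sigma> \<circ> \<pi>) * coeff h (inv' \<pi> \<circ> \<rho>) else 0)"
    by (intro sum.cong refl) (auto simp: lookup_mult_invariant[OF f g] sum_distrib_right intro!:
      sum.cong)
  also have "\<dots> = (\<Sum>\<sigma>\<in>?S. \<Sum>\<pi>\<in>?S. if ?N \<rho> = ?N \<pi> + ?N (inv' \<pi> \<circ> \<rho>) \<and> ?N \<pi> = ?N \<sigma> + ?N (inv' \<sigma> \<circ> \<pi>)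
      then coeff f \<sigma> * coeff g (inv' \<sigma> \<circ> \<pi>) * coeff h (inv' \<pi> \<circ> \<rho>) else 0)"
    by (rule sum.swap)
  also have "\<dots> = (\<Sum>\<sigma>\<in>?S. \<Sum>\<tau>\<in>?S. u \<sigma> \<tau>)" by (rule sum.cong[OF refl left])
  also have "\<dots> = (\<Sum>\<sigma>\<in>?S. if ?N \<rho> = ?N \<sigma> + ?N (inv' \<sigma> \<circ> \<rho>)
      then coeff f \<sigma> * coeff (graded_mult n g h) (inv' \<sigma> \<circ> \<rho>) else 0)"
    by (rule sum.cong[OF refl right[symmetric]])
  also have "\<dots> = coeff (graded_mult n f (graded_mult n g h)) \<rho>"
    using \<rho> by (simp add: lookup_mult_invariant[OF f gh])
  finally show "coeff (graded_mult n (graded_mult n f g) h) \<rho> = coeff (graded_mult n f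
    (graded_mult n g h)) \<rho>" .
qed

lemma invariant_add_closed:
  "\<lbrakk>f \<in> carrier (invariant_algebra n); g \<in> carrier (invariant_algebra n)\<rbrakk> \<Longrightarrow> f + g \<in> carrier
    (invariant_algebra n)"
  using keys_add[of f g] by (auto simp: invariant_algebra_carrier lookup_add)

lemma invariant_scale_closed:
  "f \<in> carrier (invariant_algebra n) \<Longrightarrow> scale c f \<in> carrier (invariant_algebra n)"
  by (auto simp: invariant_algebra_carrier in_keys_iff subset_iff)

lemma invariant_zero_closed: "0 \<in> carrier (invariant_algebra n)"
  by (simp add: invariant_algebra_carrier)

lemma invariant_one_closed: "basis_elt id \<in> carrier (invariant_algebra n)"
proof -
  have "coeff (basis_elt id) (\<pi> \<circ> \<rho> \<circ> inv' \<pi>) = coeff (basis_elt id) \<rho>" if "\<pi> permutes {1..n}" for \<pi> \<rho>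
    using conj_eq_iff[OF that, of id \<rho>] permutes_inv_o(1)[OF that]
    by (simp add: lookup_single when_def)
  then show ?thesis by (simp add: invariant_algebra_carrier permutes_id)
qed

lemma invariant_sum_closed:
  "(\<And>i. i \<in> I \<Longrightarrow> f i \<in> carrier (invariant_algebra n)) \<Longrightarrow> sum f I \<in> carrier (invariant_algebra n)"
  by (induction I rule: infinite_finite_induct) (auto intro: invariant_add_closed invariant_zero_closed)

lemma invariant_one_mult:
  assumes f: "f \<in> carrier (invariant_algebra n)"
  shows "graded_mult n (basis_elt id) f = f"
proof (rule invariant_eqI)
  show "coeff_support (graded_mult n (basis_elt id) f) \<subseteq> {p. p permutes {1..n}}"
    using invariant_mult_closed[OF invariant_one_closed f] by (rule invariant_support)
  show "coeff_support f \<subseteq> {p. p permutes {1..n}}" using f by (rule invariant_support)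
  fix \<rho> assume "\<rho> permutes {1..n}"
  then have "coeff (graded_mult n (basis_elt id) f) \<rho> =
     (\<Sum>\<sigma> | \<sigma> permutes {1..n}. if \<sigma> = id then coeff f \<rho> else 0)"
    by (auto simp: lookup_mult_invariant[OF invariant_one_closed f] perm_norm_id lookup_single when_def
      intro!: sum.cong)
  then show "coeff (graded_mult n (basis_elt id) f) \<rho> = coeff f \<rho>"
    by (simp add: finite_permutations permutes_id)
qed

lemma invariant_mult_add_left:
  assumes f: "f \<in> carrier (invariant_algebra n)" and g: "g \<in> carrier (invariant_algebra n)"
    and h: "h \<in> carrier (invariant_algebra n)"
  shows "graded_mult n (f + g) h = graded_mult n f h + graded_mult n g h"
  by (rule poly_mapping_eqI)
    (auto simp: lookup_mult_invariant invariant_add_closed f g h lookup_add distrib_right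
      sum.distrib[symmetric] intro!: sum.cong)

lemma invariant_mult_scale_left:
  assumes f: "f \<in> carrier (invariant_algebra n)" and g: "g \<in> carrier (invariant_algebra n)"
  shows "graded_mult n (scale c f) g = scale c (graded_mult n f g)"
  by (rule poly_mapping_eqI)
    (auto simp: lookup_mult_invariant invariant_scale_closed f g sum_distrib_left mult.assoc intro!:
      sum.cong)

lemma scale_minus_one: "scale (- 1) f + f = 0"
  by (rule poly_mapping_eqI) (simp add: lookup_add)

theorem invariant_algebra_cring: "cring (invariant_algebra n)"
proof (rule cringI)
  show "abelian_group (invariant_algebra n)"
  proof (rule abelian_groupI, simp_all add: invariant_add_closed invariant_zero_closed ac_simps)
    fix f assume "f \<in> carrier (invariant_algebra n)"
    then show "\<exists>g\<in>carrier (invariant_algebra n). f + g = 0"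
      using invariant_scale_closed[of f n "- 1"] scale_minus_one[of f] by (metis add.commute)
  qed
  show "comm_monoid (invariant_algebra n)"
    by (rule comm_monoidI)
      (simp_all add: invariant_mult_closed invariant_one_closed invariant_mult_assoc invariant_one_mult,
       rule invariant_mult_comm)
qed (simp add: invariant_mult_add_left)

section \<open>Multiplication by a sum of cycles\<close>

text \<open>
  The value of a class function on the permutations of cycle type \<open>M\<close>; all choices of the
  permutation agree on class functions, see \<open>coeff_eq_class_val\<close>.
\<close>

definition class_val :: "nat \<Rightarrow> perm_comb \<Rightarrow> nat multiset \<Rightarrow> rat"
  where "class_val n f M =
    coeff f (SOME \<rho>. \<exists>css. cycle_form {1..n} \<rho> css \<and> mset (map length css) = M)"

lemma coeff_eq_class_val:
  assumes f: "f \<in> carrier (invariant_algebra n)" and form: "cycle_form {1..n} \<rho> css"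
  shows "coeff f \<rho> = class_val n f (mset (map length css))"
proof -
  define \<rho>' where "\<rho>' = (SOME \<rho>'. \<exists>css'. cycle_form {1..n} \<rho>' css' \<and> mset (map length css') = mset
    (map length css))"
  have "\<exists>\<rho>' css'. cycle_form {1..n} \<rho>' css' \<and> mset (map length css') = mset (map length css)"
    using form by blast
  then have "\<exists>css'. cycle_form {1..n} \<rho>' css' \<and> mset (map length css') = mset (map length css)"
    unfolding \<rho>'_def by (rule someI_ex)
  then obtain css' where css': "cycle_form {1..n} \<rho>' css'" "mset (map length css') = mset
    (map length css)"
    by blast
  obtain \<pi> where \<pi>: "\<pi> permutes {1..n}" "\<rho>' = \<pi> \<circ> \<rho> \<circ> inv' \<pi>"
    using same_cycle_type_conjugate[OF form css'(1) css'(2)[symmetric]] by blast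
  have "coeff f \<rho>' = coeff f \<rho>"
    unfolding \<pi>(2) by (rule invariant_conj[OF f \<pi>(1) cycle_form_permutes[OF form]])
  then show ?thesis by (simp add: class_val_def \<rho>'_def)
qed

abbreviation cycles :: "nat \<Rightarrow> nat \<Rightarrow> (nat \<Rightarrow> nat) set" where
  "cycles n i \<equiv> {cycle_of_list cs | cs. cycle cs \<and> length cs = i \<and> set cs \<subseteq> {1..n}}"

abbreviation cycle_lists :: "nat \<Rightarrow> nat \<Rightarrow> nat list set" where
  "cycle_lists n i \<equiv> {cs. distinct cs \<and> length cs = i \<and> set cs \<subseteq> {1..n}}"

lemma finite_cycle_lists: "finite (cycle_lists n i)"
  by (rule finite_subset[OF _ finite_lists_length_eq[of "{1..n}" i]]) auto

lemma cycles_eq_image: "cycles n i = cycle_of_list ` cycle_lists n i"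
  by auto

lemma finite_cycles: "finite (cycles n i)"
  unfolding cycles_eq_image by (rule finite_imageI[OF finite_cycle_lists])

lemma cycle_of_list_permutes: "set cs \<subseteq> S \<Longrightarrow> cycle_of_list cs permutes S"
  by (rule permutes_subset[OF cycle_permutes])

lemma coeff_cycle_class: "coeff (cycle_class n i) \<sigma> = (if \<sigma> \<in> cycles n i then 1 else 0)"
proof -
  have "coeff (cycle_class n i) \<sigma> = (\<Sum>\<tau>\<in>cycles n i. if \<tau> = \<sigma> then 1 else 0)"
    unfolding cycle_class_def lookup_sum by (intro sum.cong refl) (simp add: lookup_single when_def)
  also have "\<dots> = (if \<sigma> \<in> cycles n i then 1 else 0)" by (rule sum.delta[OF finite_cycles])
  finally show ?thesis .
qed

lemma cycles_conj:
  assumes "\<sigma> \<in> cycles n i" "\<pi> permutes {1..n}"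
  shows "\<pi> \<circ> \<sigma> \<circ> inv' \<pi> \<in> cycles n i"
proof -
  obtain cs where cs: "\<sigma> = cycle_of_list cs" "distinct cs" "length cs = i" "set cs \<subseteq> {1..n}"
    using assms(1) by blast
  have "\<pi> \<circ> \<sigma> \<circ> inv' \<pi> = cycle_of_list (map \<pi> cs)"
    unfolding cs(1) by (rule conjugation_of_cycle[OF cs(2) permutes_bij[OF assms(2)]])
  moreover have "distinct (map \<pi> cs)"
    using cs(2) inj_on_subset[OF permutes_inj[OF assms(2)] subset_UNIV] by (simp add: distinct_map)
  moreover have "set (map \<pi> cs) \<subseteq> {1..n}"
    using cs(4) permutes_image[OF assms(2)] by (metis image_mono list.set_map)
  ultimately show ?thesis using cs(3) by (metis (mono_tags, lifting) length_map mem_Collect_eq)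
qed

lemma cycle_class_closed: "cycle_class n i \<in> carrier (invariant_algebra n)"
proof -
  have "\<pi> \<circ> \<sigma> \<circ> inv' \<pi> \<in> cycles n i \<longleftrightarrow> \<sigma> \<in> cycles n i" if \<pi>: "\<pi> permutes {1..n}" for \<pi> \<sigma>
  proof
    assume *: "\<pi> \<circ> \<sigma> \<circ> inv' \<pi> \<in> cycles n i"
    have "inv' \<pi> \<circ> (\<pi> \<circ> \<sigma> \<circ> inv' \<pi>) \<circ> \<pi> = (inv' \<pi> \<circ> \<pi>) \<circ> \<sigma> \<circ> (inv' \<pi> \<circ> \<pi>)" by (simp add: comp_assoc)
    also have "\<dots> = \<sigma>" using permutes_inv_o(2)[OF \<pi>] by simp
    finally show "\<sigma> \<in> cycles n i"
      using cycles_conj[OF * permutes_inv[OF \<pi>]] permutes_inv_inv[OF \<pi>] by simp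
  qed (rule cycles_conj[OF _ \<pi>])
  moreover have "coeff_support (cycle_class n i) \<subseteq> {p. p permutes {1..n}}"
    by (auto simp: in_keys_iff coeff_cycle_class cycle_of_list_permutes split: if_splits)
  ultimately show ?thesis by (simp add: invariant_algebra_carrier coeff_cycle_class)
qed

lemma cycle_form_id: "distinct xs \<Longrightarrow> cycle_form (set xs) id (map (\<lambda>x. [x]) xs)"
proof (induction xs)
  case (Cons x xs)
  then show ?case by (auto simp: cycle_form_def)
qed (simp add: cycle_form_def)

lemma perm_norm_cycle:
  assumes "distinct cs" "cs \<noteq> []" "set cs \<subseteq> {1..n}"
  shows "perm_norm n (cycle_of_list cs) = length cs - 1"
proof -
  define xs where "xs = sorted_list_of_set ({1..n} - set cs)"
  have xs: "distinct xs" "set xs = {1..n} - set cs" by (simp_all add: xs_def)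
  have "cycle_form (set cs \<union> set xs) (cycle_of_list cs \<circ> id) (cs # map (\<lambda>x. [x]) xs)"
    by (rule cycle_form_insert[OF cycle_form_id[OF xs(1)] assms(1,2)]) (simp add: xs(2))
  moreover have "set cs \<union> set xs = {1..n}" using assms(3) xs(2) by auto
  ultimately have form: "cycle_form {1..n} (cycle_of_list cs) (cs # map (\<lambda>x. [x]) xs)" by simp
  have "length cs > 0" using assms(2) by simp
  moreover have "length cs + length xs = n"
    using cycle_form_length[OF form] by (simp add: sum_list_triv comp_def)
  ultimately show ?thesis using perm_norm_cycle_form[OF form] by simp
qed

lemma nth_cycle_power:
  assumes "distinct cs" "k < length cs"
  shows "cs ! k = (cycle_of_list cs ^^ k) (hd cs)"
proof -
  have "cs \<noteq> []" using assms(2) by auto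
  then have "(cycle_of_list cs ^^ k) (hd cs) = hd (map (cycle_of_list cs ^^ k) cs)" by (simp add: hd_map)
  also have "\<dots> = hd (rotate k cs)" by (simp only: cyclic_rotation[OF assms(1)])
  also have "\<dots> = cs ! k" using \<open>cs \<noteq> []\<close> assms(2) by (simp add: hd_rotate_conv_nth)
  finally show ?thesis by simp
qed

lemma cycle_moves_support:
  assumes "distinct cs" "length cs \<ge> 2"
  shows "set cs = {x. cycle_of_list cs x \<noteq> x}"
proof -
  have "cycle_of_list cs x \<noteq> x" if x: "x \<in> set cs" for x
  proof -
    obtain k where k: "k < length cs" "cs ! k = x" using x by (auto simp: in_set_conv_nth)
    have "rotate k cs ! 0 = x" "rotate k cs ! 1 \<noteq> x"
    proof -
      have "0 < length cs" "1 < length cs" using assms(2) by linarith+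
      then have "rotate k cs ! 0 = cs ! (k mod length cs)" "rotate k cs ! 1 = cs !
        ((k + 1) mod length cs)"
        using nth_rotate[of 0 cs k] nth_rotate[of 1 cs k] by simp_all
      moreover have "(k + 1) mod length cs \<noteq> k mod length cs"
        using \<open>1 < length cs\<close> k(1) by (cases "k + 1 = length cs") auto
      moreover have "(k + 1) mod length cs < length cs" by (rule mod_less_divisor) (use k(1) in auto)
      ultimately show "rotate k cs ! 0 = x" "rotate k cs ! 1 \<noteq> x"
        using k nth_eq_iff_index_eq[OF assms(1), of "(k + 1) mod length cs" k] by simp_all
    qed
    moreover have "rotate k cs \<noteq> []" "distinct (rotate k cs)" using k assms(1) by auto
    moreover have "1 < length (rotate k cs)" using assms(2) by simp
    moreover have "f ^^ 1 = f" for f :: "'a \<Rightarrow> 'a" by (simp add: One_nat_def)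
    ultimately have "cycle_of_list (rotate k cs) x \<noteq> x"
      using nth_cycle_power[of "rotate k cs" 1] by (simp add: hd_conv_nth)
    then show ?thesis using cycle_of_list_rotate_independent[OF assms(1)] by metis
  qed
  then show ?thesis using id_outside_supp[of _ cs] by blast
qed

lemma card_cycle_notations:
  assumes "\<sigma> \<in> cycles n i" "i \<ge> 2"
  shows "card {cs \<in> cycle_lists n i. cycle_of_list cs = \<sigma>} = i"
proof -
  obtain cs where cs: "\<sigma> = cycle_of_list cs" "distinct cs" "length cs = i" "set cs \<subseteq> {1..n}"
    using assms(1) by blast
  let ?F = "{ds \<in> cycle_lists n i. cycle_of_list ds = \<sigma>}"
  have inj: "inj_on hd ?F"
  proof (rule inj_onI)
    fix ds es assume *: "ds \<in> ?F" "es \<in> ?F" "hd ds = hd es"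
    then have "ds ! k = es ! k" if "k < i" for k
      using nth_cycle_power[of ds k] nth_cycle_power[of es k] that by auto
    then show "ds = es" using * by (intro nth_equalityI) auto
  qed
  have image: "hd ` ?F = set cs"
  proof
    show "hd ` ?F \<subseteq> set cs"
    proof
      fix x assume "x \<in> hd ` ?F"
      then obtain ds where ds: "x = hd ds" "distinct ds" "length ds = i" "cycle_of_list ds = \<sigma>" by blast
      have "ds \<noteq> []" using ds(3) assms(2) by auto
      then have "x \<in> set ds" using ds(1) by simp
      moreover have "set ds = set cs"
        using cycle_moves_support[of ds] cycle_moves_support[of cs] ds cs assms(2) by simp
      ultimately show "x \<in> set cs" by simp
    qed
    show "set cs \<subseteq> hd ` ?F"
    proof
      fix x assume "x \<in> set cs"
      then obtain k where k: "k < length cs" "cs ! k = x" by (auto simp: in_set_conv_nth)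
      then have "cs \<noteq> []" by auto
      then have "hd (rotate k cs) = x" using k by (simp add: hd_rotate_conv_nth)
      moreover have "rotate k cs \<in> ?F"
        using cs by (simp only: mem_Collect_eq distinct_rotate length_rotate set_rotate
          cycle_of_list_rotate_independent[OF cs(2), symmetric])
      ultimately show "x \<in> hd ` ?F" by (rule image_eqI[OF sym])
    qed
  qed
  show ?thesis using card_image[OF inj] unfolding image using distinct_card[OF cs(2)] cs(3) by simp
qed

text \<open>
  Sums over cycles become sums over the lists that denote them; an \<open>i\<close>-cycle is denoted by its \<open>i\<close>
  rotations. Cycles of length one, which all denote the identity, are excluded.
\<close>

lemma sum_cycles:
  fixes g :: "_ \<Rightarrow> rat"
  assumes "i \<ge> 2"
  shows "of_nat i * (\<Sum>\<sigma>\<in>cycles n i. g \<sigma>) = (\<Sum>cs\<in>cycle_lists n i. g (cycle_of_list cs))"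
proof -
  have "(\<Sum>cs\<in>cycle_lists n i. g (cycle_of_list cs)) =
    (\<Sum>\<sigma>\<in>cycle_of_list ` cycle_lists n i. \<Sum>cs\<in>{cs \<in> cycle_lists n i. cycle_of_list cs = \<sigma>}. g
      (cycle_of_list cs))"
    by (rule sum.image_gen[OF finite_cycle_lists])
  also have "\<dots> = (\<Sum>\<sigma>\<in>cycles n i. of_nat i * g \<sigma>)"
    unfolding cycles_eq_image[symmetric]
  proof (rule sum.cong[OF refl])
    fix \<sigma> assume \<sigma>: "\<sigma> \<in> cycles n i"
    have "(\<Sum>cs\<in>{cs \<in> cycle_lists n i. cycle_of_list cs = \<sigma>}. g (cycle_of_list cs)) =
      (\<Sum>cs\<in>{cs \<in> cycle_lists n i. cycle_of_list cs = \<sigma>}. g \<sigma>)" by (intro sum.cong) auto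
    then show "(\<Sum>cs\<in>{cs \<in> cycle_lists n i. cycle_of_list cs = \<sigma>}. g (cycle_of_list cs)) = of_nat i * g \<sigma>"
      using card_cycle_notations[OF \<sigma> assms] by simp
  qed
  finally show ?thesis by (simp add: sum_distrib_left)
qed

text \<open>
  The norm condition in the product with a sum of cycles: the norm of the cycle \<open>cs\<close> is
  \<open>length cs - 1\<close>. It is used for lists with repetitions, too.
\<close>

definition splits_off :: "nat \<Rightarrow> (nat \<Rightarrow> nat) \<Rightarrow> nat list \<Rightarrow> bool" where
  "splits_off n \<rho> cs \<longleftrightarrow> perm_norm n \<rho> = (length cs - 1) + perm_norm n (inv' (cycle_of_list cs) \<circ> \<rho>)"

lemma perm_norm_transpose_le:
  assumes "a \<in> {1..n}" "b \<in> {1..n}"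
  shows "perm_norm n (transpose a b) \<le> 1"
proof (cases "a = b")
  case True
  then show ?thesis by (simp add: perm_norm_id)
next
  case False
  then have "set [transpose a b] \<subseteq> transpositions n" using assms by (auto simp: transpositions_def)
  from perm_norm_le[OF this] show ?thesis by simp
qed

lemma perm_norm_cycle_le:
  "set (a # bs) \<subseteq> {1..n} \<Longrightarrow> perm_norm n (cycle_of_list (a # bs)) \<le> length bs"
proof (induction bs arbitrary: a)
  case Nil
  then show ?case by (simp add: perm_norm_id[unfolded id_def])
next
  case (Cons b bs)
  have "perm_norm n (transpose a b \<circ> cycle_of_list (b # bs)) \<le> perm_norm n
    (transpose a b) + perm_norm n (cycle_of_list (b # bs))"
    using Cons.prems by (intro perm_norm_comp_le permutes_swap_id cycle_of_list_permutes) auto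
  moreover have "perm_norm n (transpose a b) \<le> 1" using Cons.prems by (intro perm_norm_transpose_le) auto
  moreover have "perm_norm n (cycle_of_list (b # bs)) \<le> length bs" using Cons.prems
    by (intro Cons.IH) auto
  ultimately show ?case unfolding cycle_of_list.simps length_Cons by linarith
qed

lemma inv_cycle_Cons:
  assumes "\<rho> permutes S" "set (a # b # bs) \<subseteq> S"
  shows "inv' (cycle_of_list (a # b # bs)) \<circ> \<rho> = inv' (cycle_of_list (b # bs)) \<circ> (transpose a b \<circ> \<rho>)"
proof -
  have "inv' (transpose a b \<circ> cycle_of_list (b # bs)) = inv' (cycle_of_list (b # bs)) \<circ> inv'
    (transpose a b)"
    by (intro o_inv_distrib permutes_bij[OF cycle_permutes] permutes_bij[OF permutes_swap_id[OF
      UNIV_I UNIV_I]])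
  then show ?thesis by (simp add: comp_assoc)
qed

text \<open>
  Each of the \<open>i - 1\<close> transpositions lowers the norm by at most one, so the total drop is \<open>i - 1\<close>
  only if each step contributes one.
\<close>

lemma splits_off_Cons:
  assumes \<rho>: "\<rho> permutes {1..n}" and sub: "set (a # b # bs) \<subseteq> {1..n}"
  shows "splits_off n \<rho> (a # b # bs) \<longleftrightarrow>
    perm_norm n (transpose a b \<circ> \<rho>) + 1 = perm_norm n \<rho> \<and> splits_off n (transpose a b \<circ> \<rho>) (b # bs)"
proof -
  let ?\<rho> = "transpose a b \<circ> \<rho>" and ?\<sigma> = "cycle_of_list (b # bs)"
  have \<rho>': "?\<rho> permutes {1..n}" using sub \<rho> by (intro permutes_compose permutes_swap_id) auto
  have \<sigma>: "?\<sigma> permutes {1..n}" using sub by (intro cycle_of_list_permutes) auto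
  have "transpose a b \<circ> ?\<rho> = \<rho>" by (simp add: comp_assoc[symmetric])
  then have 1: "perm_norm n \<rho> \<le> 1 + perm_norm n ?\<rho>"
    using perm_norm_comp_le[OF permutes_swap_id \<rho>', of a b] perm_norm_transpose_le[of a n b] sub by simp
  have "?\<sigma> \<circ> (inv' ?\<sigma> \<circ> ?\<rho>) = ?\<rho>" using permutes_comp_eq_iff[OF \<sigma>] by blast
  then have "perm_norm n ?\<rho> \<le> perm_norm n ?\<sigma> + perm_norm n (inv' ?\<sigma> \<circ> ?\<rho>)"
    using perm_norm_comp_le[OF \<sigma> permutes_compose[OF \<rho>' permutes_inv[OF \<sigma>]]] by simp
  then have 2: "perm_norm n ?\<rho> \<le> length bs + perm_norm n (inv' ?\<sigma> \<circ> ?\<rho>)"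
    using perm_norm_cycle_le[of b bs n] sub by simp
  show ?thesis
    unfolding splits_off_def inv_cycle_Cons[OF \<rho> sub] using 1 2 by auto
qed

text \<open>
  In \<open>(a b) \<circ> \<rho>\<close> the point \<open>a\<close> is separated from the cycle of \<open>b\<close>, where all further cuts take
  place. Therefore no point occurs twice, and one may sum over all lists of length \<open>i\<close> instead of
  distinct ones.
\<close>

lemma splits_off_distinct:
  assumes "cycle_form {1..n} \<rho> ((a # xs) # css)" "set bs \<subseteq> {1..n}" "splits_off n \<rho> (a # bs)"
  shows "distinct (a # bs) \<and> set bs \<subseteq> set xs"
  using assms
proof (induction bs arbitrary: \<rho> a xs css)
  case Nil
  then show ?case by simp
next
  case (Cons b bs)
  have a: "a \<in> {1..n}" "a \<notin> set xs" using Cons.prems(1) by (auto simp: cycle_form_def)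
  have *: "perm_norm n (transpose a b \<circ> \<rho>) + 1 = perm_norm n \<rho>" "splits_off n (transpose a b \<circ> \<rho>)
    (b # bs)"
    using splits_off_Cons[OF cycle_form_permutes[OF Cons.prems(1)], of a b bs] Cons.prems a by simp_all
  have "b \<in> set xs"
    using perm_norm_transpose(1)[OF Cons.prems(1), of b] * Cons.prems(2) by (auto split: if_splits)
  then obtain ys zs where xs: "xs = ys @ b # zs" by (meson split_list)
  have "cycle_form {1..n} (transpose a b \<circ> \<rho>) ((b # zs) # (a # ys) # css)"
    using Cons.prems(1) xs by (intro cycle_form_split) simp
  from Cons.IH[OF this _ *(2)] Cons.prems(2) have "distinct (b # bs)" "set bs \<subseteq> set zs" by auto
  then show ?case using a xs by auto
qed

primrec compositions :: "nat \<Rightarrow> nat \<Rightarrow> nat list list" where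
  "compositions 0 l = (if l = 0 then [[]] else [])"
| "compositions (Suc i) l = concat (map (\<lambda>k. map ((#) k) (compositions i (l - k))) [1..<Suc l])"

lemma sum_list_concat_map:
  "sum_list (map f (concat (map g xs))) = (\<Sum>x\<leftarrow>xs. sum_list (map f (g x)))"
  by (induction xs) auto

lemma sum_compositions_Suc:
  "(\<Sum>ks\<leftarrow>compositions (Suc i) l. F ks) = (\<Sum>j<l. \<Sum>ks\<leftarrow>compositions i (l - Suc j). F (Suc j # ks))"
  for F :: "nat list \<Rightarrow> 'a :: comm_monoid_add"
proof -
  have "(\<Sum>ks\<leftarrow>compositions (Suc i) l. F ks) = (\<Sum>k\<leftarrow>[1..<Suc l]. \<Sum>ks\<leftarrow>compositions i (l - k). F (k # ks))"
    by (simp add: sum_list_concat_map comp_def del: upt_Suc)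
  also have "\<dots> = (\<Sum>k\<leftarrow>map Suc [0..<l]. \<Sum>ks\<leftarrow>compositions i (l - k). F (k # ks))"
    by (simp add: map_Suc_upt One_nat_def del: upt_Suc)
  also have "\<dots> = (\<Sum>j<l. \<Sum>ks\<leftarrow>compositions i (l - Suc j). F (Suc j # ks))"
    by (simp add: comp_def interv_sum_list_conv_sum_set_nat atLeast0LessThan)
  finally show ?thesis .
qed

text \<open>
  The sum over all ways of cutting up the cycle of \<open>a\<close>. In the induction step \<open>b = xs ! j\<close> cuts off
  a cycle of length \<open>j + 1\<close> through \<open>a\<close>, and the remaining cuts take place on the cycle of \<open>b\<close>,
  which has the \<open>length xs - j\<close> remaining points. Thus the position of \<open>b\<close> is the first part of the
  composition.
\<close>

lemma sum_splitting_cycles: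
  fixes h :: "(nat \<Rightarrow> nat) \<Rightarrow> rat" and F :: "nat multiset \<Rightarrow> rat"
  assumes h: "\<And>\<rho> css. cycle_form {1..n} \<rho> css \<Longrightarrow> h \<rho> = F (mset (map length css))"
    and form: "cycle_form {1..n} \<rho> ((a # xs) # css)"
  shows "(\<Sum>bs | set bs \<subseteq> {1..n} \<and> length bs = k.
      if splits_off n \<rho> (a # bs) then h (inv' (cycle_of_list (a # bs)) \<circ> \<rho>) else 0) =
    (\<Sum>ks\<leftarrow>compositions (Suc k) (Suc (length xs)). F (mset (ks @ map length css)))"
  using form
proof (induction k arbitrary: \<rho> a xs css)
  case 0
  have "{bs. set bs \<subseteq> {1..n} \<and> length bs = 0} = {[]}" by auto
  moreover have "(\<Sum>ks\<leftarrow>compositions (Suc 0) (Suc (length xs)). F (mset (ks @ map length css))) =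
    F (mset (Suc (length xs) # map length css))"
  proof -
    have "(\<Sum>ks\<leftarrow>compositions (Suc 0) (Suc (length xs)). F (mset (ks @ map length css))) =
      (\<Sum>j<Suc (length xs). if j = length xs then F (mset (Suc j # map length css)) else 0)"
      unfolding sum_compositions_Suc by (intro sum.cong refl) auto
    also have "\<dots> = F (mset (Suc (length xs) # map length css))"
      by (subst sum.delta) auto
    finally show ?thesis .
  qed
  ultimately show ?case using h[OF 0] by (simp add: splits_off_def)
next
  case (Suc k)
  let ?T = "\<lambda>k. {bs. set bs \<subseteq> {1..n} \<and> length bs = k}"
  define t where "t \<rho> cs = (if splits_off n \<rho> cs then h (inv' (cycle_of_list cs) \<circ> \<rho>) else 0)" for \<rho> cs
  have \<rho>: "\<rho> permutes {1..n}" by (rule cycle_form_permutes[OF Suc.prems])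
  have a: "a \<in> {1..n}" and dist: "distinct (a # xs)" and sub: "set xs \<subseteq> {1..n}"
    using Suc.prems by (auto simp: cycle_form_def)
  have "?T (Suc k) = (\<lambda>(b, bs). b # bs) ` ({1..n} \<times> ?T k)"
    by (auto simp: image_iff length_Suc_conv)
  moreover have "inj_on (\<lambda>(b, bs). b # bs) ({1..n} \<times> ?T k)" by (auto intro: inj_onI)
  ultimately have "(\<Sum>bs\<in>?T (Suc k). t \<rho> (a # bs)) = (\<Sum>(b, bs)\<in>{1..n} \<times> ?T k. t \<rho> (a # b # bs))"
    by (simp add: sum.reindex case_prod_unfold)
  also have "\<dots> = (\<Sum>b\<in>{1..n}. \<Sum>bs\<in>?T k. t \<rho> (a # b # bs))"
    by (rule sum.cartesian_product[symmetric])
  (* the first transposition has to split the cycle of a, that is, b has to lie on this cycle *)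
  also have "\<dots> = (\<Sum>b\<in>{1..n}. if b \<in> set xs then \<Sum>bs\<in>?T k. t (transpose a b \<circ> \<rho>) (b # bs) else 0)"
  proof (rule sum.cong[OF refl])
    fix b assume b: "b \<in> {1..n}"
    have iff: "perm_norm n (transpose a b \<circ> \<rho>) + 1 = perm_norm n \<rho> \<longleftrightarrow> b \<in> set xs"
      using perm_norm_transpose[OF Suc.prems b] dist by auto
    have "t \<rho> (a # b # bs) = (if b \<in> set xs then t (transpose a b \<circ> \<rho>) (b # bs) else 0)"
      if "bs \<in> ?T k" for bs
    proof -
      have "set (a # b # bs) \<subseteq> {1..n}" using a b that by auto
      then show ?thesis
        unfolding t_def splits_off_Cons[OF \<rho> \<open>set (a # b # bs) \<subseteq> {1..n}\<close>] inv_cycle_Cons[OF \<rho> \<open>set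
          (a # b # bs) \<subseteq> {1..n}\<close>] iff
        by simp
    qed
    then show "(\<Sum>bs\<in>?T k. t \<rho> (a # b # bs)) =
      (if b \<in> set xs then \<Sum>bs\<in>?T k. t (transpose a b \<circ> \<rho>) (b # bs) else 0)" by simp
  qed
  also have "\<dots> = (\<Sum>b\<in>set xs. \<Sum>bs\<in>?T k. t (transpose a b \<circ> \<rho>) (b # bs))"
    using sub by (simp add: sum.If_cases Int_absorb1)
  also have "\<dots> = (\<Sum>j<length xs. \<Sum>bs\<in>?T k. t (transpose a (xs ! j) \<circ> \<rho>) (xs ! j # bs))"
    using dist bij_betw_nth[of xs "{..<length xs}" "set xs"]
      by (intro sum.reindex_bij_betw[symmetric]) auto
  also have "\<dots> = (\<Sum>j<length xs. \<Sum>ks\<leftarrow>compositions (Suc k) (Suc (length xs) - Suc j). F (mset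
    (Suc j # ks @ map length css)))"
  proof (rule sum.cong[OF refl])
    fix j assume j: "j \<in> {..<length xs}"
    have "cycle_form {1..n} (transpose a (xs ! j) \<circ> \<rho>) ((xs ! j # drop (Suc j) xs) #
      (a # take j xs) # css)"
      using Suc.prems j by (intro cycle_form_split) (simp add: id_take_nth_drop[symmetric])
    note IH = Suc.IH[OF this]
    show "(\<Sum>bs\<in>?T k. t (transpose a (xs ! j) \<circ> \<rho>) (xs ! j # bs)) =
        (\<Sum>ks\<leftarrow>compositions (Suc k) (Suc (length xs) - Suc j). F (mset (Suc j # ks @ map length css)))"
      unfolding t_def IH using j by (simp add: Suc_diff_Suc del: compositions.simps)
  qed
  also have "\<dots> = (\<Sum>j<Suc (length xs). \<Sum>ks\<leftarrow>compositions (Suc k) (Suc (length xs) - Suc j). F (mset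
    (Suc j # ks @ map length css)))"
    by (simp add: One_nat_def)
  also have "\<dots> = (\<Sum>ks\<leftarrow>compositions (Suc (Suc k)) (Suc (length xs)). F (mset (ks @ map length css)))"
    by (simp only: sum_compositions_Suc append_Cons)
  finally show ?case by (simp add: t_def)
qed

fun picks :: "'a list \<Rightarrow> ('a \<times> 'a list) list" where
  "picks [] = []"
| "picks (x # xs) = (x, xs) # map (apsnd ((#) x)) (picks xs)"

lemma map_fst_picks: "map fst (picks xs) = xs"
  by (induction xs) (simp_all add: comp_def)

lemma mset_picks: "(x, ys) \<in> set (picks xs) \<Longrightarrow> mset xs = add_mset x (mset ys)"
  by (induction xs arbitrary: ys) auto

lemma picks_map: "picks (map f xs) = map (map_prod f (map f)) (picks xs)"
  by (induction xs) (auto simp: comp_def)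

lemma coeff_cycle_class_mult:
  assumes f: "f \<in> carrier (invariant_algebra n)" and form: "cycle_form {1..n} \<rho> css" and i: "i \<ge> 2"
  shows "of_nat i * coeff (graded_mult n (cycle_class n i) f) \<rho> =
    (\<Sum>(l, rest)\<leftarrow>picks (map length css). of_nat l * (\<Sum>ks\<leftarrow>compositions i l. class_val n f (mset
      (ks @ rest))))"
proof -
  let ?T = "\<lambda>k. {bs. set bs \<subseteq> {1..n} \<and> length bs = k}"
  have \<rho>: "\<rho> permutes {1..n}" by (rule cycle_form_permutes[OF form])
  define t where "t cs = (if splits_off n \<rho> cs then coeff f (inv' (cycle_of_list cs) \<circ> \<rho>) else 0)" for cs
  define G where "G l M = (\<Sum>ks\<leftarrow>compositions i l. class_val n f (mset ks + M))" for l M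
  obtain k where k: "i = Suc k" using i by (cases i) auto
  have "coeff (graded_mult n (cycle_class n i) f) \<rho> =
    (\<Sum>\<sigma> | \<sigma> permutes {1..n}. if \<sigma> \<in> cycles n i then
      if perm_norm n \<rho> = perm_norm n \<sigma> + perm_norm n (inv' \<sigma> \<circ> \<rho>) then coeff f
        (inv' \<sigma> \<circ> \<rho>) else 0 else 0)"
    using \<rho> by (auto simp: lookup_mult_invariant[OF cycle_class_closed f] coeff_cycle_class intro!:
      sum.cong)
  also have "\<dots> = (\<Sum>\<sigma>\<in>cycles n i. if perm_norm n \<rho> = perm_norm n \<sigma> + perm_norm n
    (inv' \<sigma> \<circ> \<rho>) then coeff f (inv' \<sigma> \<circ> \<rho>) else 0)"
  proof -
    have "cycles n i \<subseteq> {p. p permutes {1..n}}" by (auto simp: cycle_of_list_permutes)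
    then show ?thesis by (intro sum.mono_neutral_cong_right) (auto simp: finite_permutations)
  qed
  finally have "of_nat i * coeff (graded_mult n (cycle_class n i) f) \<rho> =
    (\<Sum>cs\<in>cycle_lists n i. if perm_norm n \<rho> = perm_norm n (cycle_of_list cs) + perm_norm n (inv'
      (cycle_of_list cs) \<circ> \<rho>)
      then coeff f (inv' (cycle_of_list cs) \<circ> \<rho>) else 0)"
    by (simp only: sum_cycles[OF i])
  also have "\<dots> = (\<Sum>cs\<in>cycle_lists n i. t cs)"
  proof (intro sum.cong refl)
    fix cs assume cs: "cs \<in> cycle_lists n i"
    then have "cs \<noteq> []" using i by auto
    then have "perm_norm n (cycle_of_list cs) = length cs - 1" using cs by (intro perm_norm_cycle) auto
    then show "(if perm_norm n \<rho> = perm_norm n (cycle_of_list cs) + perm_norm n (inv'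
      (cycle_of_list cs) \<circ> \<rho>)
      then coeff f (inv' (cycle_of_list cs) \<circ> \<rho>) else 0) = t cs"
      by (simp only: t_def splits_off_def)
  qed
  also have "\<dots> = (\<Sum>cs\<in>?T i. t cs)"
  proof (rule sum.mono_neutral_left)
    show "finite (?T i)" by (rule finite_lists_length_eq) simp
    show "\<forall>cs \<in> ?T i - cycle_lists n i. t cs = 0"
    proof
      fix cs assume cs: "cs \<in> ?T i - cycle_lists n i"
      then obtain a bs where abs: "cs = a # bs" using k by (cases cs) auto
      have "\<not> splits_off n \<rho> cs"
      proof
        assume split: "splits_off n \<rho> cs"
        have "a \<in> {1..n}" using cs abs by auto
        then obtain xs css' where "cycle_form {1..n} \<rho> ((a # xs) # css')"
          using cycle_form_head[OF form] by blast
        then have "distinct cs" using splits_off_distinct[of n \<rho> a xs css' bs] split cs abs by auto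
        then show False using cs by auto
      qed
      then show "t cs = 0" by (simp add: t_def)
    qed
  qed auto
  also have "\<dots> = (\<Sum>a\<in>{1..n}. \<Sum>bs\<in>?T k. t (a # bs))"
  proof -
    have "?T (Suc k) = (\<lambda>(b, bs). b # bs) ` ({1..n} \<times> ?T k)" by (auto simp: image_iff length_Suc_conv)
    moreover have "inj_on (\<lambda>(b, bs). b # bs) ({1..n} \<times> ?T k)" by (auto intro: inj_onI)
    ultimately have "(\<Sum>bs\<in>?T (Suc k). t bs) = (\<Sum>(b, bs)\<in>{1..n} \<times> ?T k. t (b # bs))"
      by (simp add: sum.reindex case_prod_unfold)
    then show ?thesis by (simp add: k sum.cartesian_product)
  qed
  also have "\<dots> = (\<Sum>a\<leftarrow>concat css. \<Sum>bs\<in>?T k. t (a # bs))"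
  proof -
    have "distinct (concat css)" "set (concat css) = {1..n}" using form
      by (simp_all only: cycle_form_def)
    then show ?thesis by (simp only: sum.distinct_set_conv_list[symmetric])
  qed
  also have "\<dots> = (\<Sum>cs\<leftarrow>css. \<Sum>a\<leftarrow>cs. \<Sum>bs\<in>?T k. t (a # bs))"
    using sum_list_concat_map[of "\<lambda>a. \<Sum>bs\<in>?T k. t (a # bs)" id css] by simp
  also have "\<dots> = (\<Sum>cs\<leftarrow>map fst (picks css). \<Sum>a\<leftarrow>cs. \<Sum>bs\<in>?T k. t (a # bs))"
    by (simp only: map_fst_picks)
  also have "\<dots> = (\<Sum>p\<leftarrow>picks css. \<Sum>a\<leftarrow>fst p. \<Sum>bs\<in>?T k. t (a # bs))"
    by (simp add: comp_def)
  also have "\<dots> = (\<Sum>p\<leftarrow>picks css. of_nat (length (fst p)) * G (length (fst p)) (mset (map length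
    (snd p))))"
  proof (rule arg_cong[where f = sum_list], rule map_cong[OF refl])
    fix p assume p: "p \<in> set (picks css)"
    obtain cs rest where cs: "p = (cs, rest)" by (cases p)
    have form': "cycle_form {1..n} \<rho> (cs # rest)"
      using mset_picks[of cs rest css] p cs by (intro cycle_form_mset[OF form]) simp
    have "(\<Sum>bs\<in>?T k. t (a # bs)) = G (length cs) (mset (map length rest))" if "a \<in> set cs" for a
    proof -
      obtain ys zs where "cs = ys @ a # zs" using \<open>a \<in> set cs\<close> by (meson split_list)
      then have "rotate (length ys) cs = a # zs @ ys" "length cs = Suc (length (zs @ ys))"
        by (simp_all add: rotate_append)
      with cycle_form_rotate[OF form', of "length ys"]
      have "cycle_form {1..n} \<rho> ((a # zs @ ys) # rest)" "length cs = Suc (length (zs @ ys))" by simp_all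
      from sum_splitting_cycles[where h = "coeff f" and F =
        "class_val n f", OF coeff_eq_class_val[OF f] this(1), of k] this(2)
      show ?thesis by (simp add: t_def G_def k)
    qed
    then have "(\<Sum>a\<leftarrow>cs. \<Sum>bs\<in>?T k. t (a # bs)) = (\<Sum>a\<leftarrow>cs. G (length cs) (mset (map length rest)))"
      by (intro arg_cong[where f = sum_list] map_cong) auto
    then show "(\<Sum>a\<leftarrow>fst p. \<Sum>bs\<in>?T k. t (a # bs)) = of_nat (length (fst p)) * G (length (fst p)) (mset
      (map length (snd p)))"
      by (simp add: cs sum_list_triv)
  qed
  finally show ?thesis
    by (simp add: G_def picks_map comp_def case_prod_unfold)
qed

theorem class_val_cycle_class_mult:
  assumes f: "f \<in> carrier (invariant_algebra n)" and i: "i \<ge> 2"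
    and \<mu>: "0 \<notin> set \<mu>" "sum_list \<mu> = n"
  shows "of_nat i * class_val n (graded_mult n (cycle_class n i) f) (mset \<mu>) =
    (\<Sum>(l, rest)\<leftarrow>picks \<mu>. of_nat l * (\<Sum>ks\<leftarrow>compositions i l. class_val n f (mset (ks @ rest))))"
proof -
  obtain \<rho> css where form: "cycle_form {1..n} \<rho> css" "map length css = \<mu>"
    using cycle_form_with_lengths[OF \<mu>(1)] \<mu>(2) by blast
  show ?thesis
    using coeff_cycle_class_mult[OF f form(1) i] coeff_eq_class_val[OF invariant_mult_closed[OF
      cycle_class_closed f] form(1)]
    by (simp add: form(2))
qed

section \<open>Polynomials and their evaluation at the sums of cycles\<close>

lemma polynomial_algebra_simps [simp]:
  "mult (polynomial_algebra m) = (*)" "one (polynomial_algebra m) = 1"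
  "zero (polynomial_algebra m) = 0" "add (polynomial_algebra m) = (+)" "smult (polynomial_algebra m)
    = scale"
  by (simp_all add: polynomial_algebra_def)

lemma polynomial_algebra_carrier:
  "p \<in> carrier (polynomial_algebra m) \<longleftrightarrow> (\<forall>u \<in> Poly_Mapping.keys p. Poly_Mapping.keys u \<subseteq> {..<m})"
  by (simp add: polynomial_algebra_def)

lemma scale_eq_mult: "scale c p = Poly_Mapping.single 0 c * p" for p :: rat_mpoly
  by (rule mult_map_scale_conv_mult)

lemma polynomial_add_closed:
  "\<lbrakk>p \<in> carrier (polynomial_algebra m); q \<in> carrier (polynomial_algebra m)\<rbrakk> \<Longrightarrow> p + q \<in> carrier
    (polynomial_algebra m)"
  using keys_add[of p q] by (auto simp: polynomial_algebra_carrier)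

lemma polynomial_mult_closed:
  assumes "p \<in> carrier (polynomial_algebra m)" "q \<in> carrier (polynomial_algebra m)"
  shows "p * q \<in> carrier (polynomial_algebra m)"
  unfolding polynomial_algebra_carrier
proof
  fix u assume "u \<in> Poly_Mapping.keys (p * q)"
  then obtain a b where "u = a + b" "a \<in> Poly_Mapping.keys p" "b \<in> Poly_Mapping.keys q"
    using keys_mult[of p q] by blast
  then show "Poly_Mapping.keys u \<subseteq> {..<m}"
    using assms keys_add[of a b] by (fastforce simp: polynomial_algebra_carrier)
qed

lemma polynomial_scale_closed:
  "p \<in> carrier (polynomial_algebra m) \<Longrightarrow> scale c p \<in> carrier (polynomial_algebra m)"
  by (simp add: polynomial_algebra_carrier in_keys_iff)

lemma polynomial_zero_closed: "0 \<in> carrier (polynomial_algebra m)"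
  by (simp add: polynomial_algebra_carrier)

lemma polynomial_one_closed: "1 \<in> carrier (polynomial_algebra m)"
  by (simp add: polynomial_algebra_carrier)

lemma polynomial_uminus_closed:
  "p \<in> carrier (polynomial_algebra m) \<Longrightarrow> - p \<in> carrier (polynomial_algebra m)"
  by (simp add: polynomial_algebra_carrier in_keys_iff)

lemma polynomial_diff_closed:
  "\<lbrakk>p \<in> carrier (polynomial_algebra m); q \<in> carrier (polynomial_algebra m)\<rbrakk> \<Longrightarrow> p - q \<in> carrier
    (polynomial_algebra m)"
  using polynomial_add_closed[of p m "- q"] polynomial_uminus_closed[of q m] by simp

lemma polynomial_sum_closed:
  "(\<And>i. i \<in> I \<Longrightarrow> f i \<in> carrier (polynomial_algebra m)) \<Longrightarrow> sum f I \<in> carrier (polynomial_algebra m)"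
  by (induction I rule: infinite_finite_induct) (auto intro: polynomial_add_closed
    polynomial_zero_closed)

lemma polynomial_single_closed:
  "Poly_Mapping.keys u \<subseteq> {..<m} \<Longrightarrow> Poly_Mapping.single u c \<in> carrier (polynomial_algebra m)"
  by (simp add: polynomial_algebra_carrier)

lemma polynomial_var_closed: "i < m \<Longrightarrow> var i \<in> carrier (polynomial_algebra m)"
  by (simp add: var_def polynomial_algebra_carrier)

theorem polynomial_algebra_cring: "cring (polynomial_algebra m)"
proof (rule cringI)
  show "abelian_group (polynomial_algebra m)"
  proof (rule abelian_groupI, simp_all add: polynomial_add_closed polynomial_zero_closed ac_simps)
    fix p assume "p \<in> carrier (polynomial_algebra m)"
    then show "\<exists>q\<in>carrier (polynomial_algebra m). p + q = 0"
      by (intro bexI[of _ "- p"]) (simp_all add: polynomial_uminus_closed)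
  qed
  show "comm_monoid (polynomial_algebra m)"
    by (rule comm_monoidI) (simp_all add: polynomial_mult_closed polynomial_one_closed ac_simps)
qed (simp add: distrib_right)

lemma sum_single_keys: "(\<Sum>u\<in>Poly_Mapping.keys p. Poly_Mapping.single u (Poly_Mapping.lookup p u)) = p"
  for p :: "'a \<Rightarrow>\<^sub>0 'b :: comm_monoid_add"
proof (rule poly_mapping_eqI)
  fix v
  have "Poly_Mapping.lookup (\<Sum>u\<in>Poly_Mapping.keys p. Poly_Mapping.single u (Poly_Mapping.lookup p u)) v =
    (\<Sum>u\<in>Poly_Mapping.keys p. if u = v then Poly_Mapping.lookup p u else 0)"
    unfolding lookup_sum by (intro sum.cong refl) (simp add: lookup_single when_def)
  then show "Poly_Mapping.lookup (\<Sum>u\<in>Poly_Mapping.keys p. Poly_Mapping.single u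
    (Poly_Mapping.lookup p u)) v = Poly_Mapping.lookup p v"
    by (simp add: in_keys_iff)
qed

lemma poly_mapping_single_induct [case_names single add]:
  fixes p :: "'a \<Rightarrow>\<^sub>0 'b :: comm_monoid_add"
  assumes single: "\<And>u c. P (Poly_Mapping.single u c)" and add: "\<And>p q. P p \<Longrightarrow> P q \<Longrightarrow> P (p + q)"
  shows "P p"
proof -
  have "P (\<Sum>u\<in>U. Poly_Mapping.single u (Poly_Mapping.lookup p u))" if "finite U" for U
    using that
  proof (induction U)
    case empty
    show ?case using single[of undefined 0] by simp
  qed (simp add: single add)
  from this[OF finite_keys[of p]] show ?thesis by (simp only: sum_single_keys)
qed

text \<open>
  Only the exponents of the \<open>d div 2\<close> variables enter, so that \<open>eval_poly d\<close> is multiplicative on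
  all polynomials.
\<close>

definition eval_monomial :: "nat \<Rightarrow> (nat \<Rightarrow>\<^sub>0 nat) \<Rightarrow> perm_comb" where
  "eval_monomial d u = finprod (invariant_algebra d)
    (\<lambda>i. cycle_class d (i + 2) [^]\<^bsub>invariant_algebra d\<^esub> Poly_Mapping.lookup u i) {..<d div 2}"

definition eval_poly :: "nat \<Rightarrow> rat_mpoly \<Rightarrow> perm_comb" where
  "eval_poly d p = (\<Sum>u\<in>Poly_Mapping.keys p. scale (coeff p u) (eval_monomial d u))"

lemma eval_monomial_closed: "eval_monomial d u \<in> carrier (invariant_algebra d)"
proof -
  interpret cring "invariant_algebra d" by (rule invariant_algebra_cring)
  show ?thesis unfolding eval_monomial_def
    by (intro finprod_closed) (auto simp del: invariant_algebra_simps intro: nat_pow_closed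
      cycle_class_closed)
qed

lemma eval_monomial_zero: "eval_monomial d 0 = basis_elt id"
proof -
  interpret cring "invariant_algebra d" by (rule invariant_algebra_cring)
  have "eval_monomial d 0 = \<one>\<^bsub>invariant_algebra d\<^esub>"
    unfolding eval_monomial_def by (rule finprod_one_eqI) (simp del: invariant_algebra_simps)
  then show ?thesis by simp
qed

lemma eval_monomial_add:
  "eval_monomial d (u + v) = graded_mult d (eval_monomial d u) (eval_monomial d v)"
proof -
  interpret cring "invariant_algebra d" by (rule invariant_algebra_cring)
  let ?g = "\<lambda>i. cycle_class d (i + 2)"
  have "eval_monomial d (u + v) = finprod (invariant_algebra d)
     (\<lambda>i. ?g i [^]\<^bsub>invariant_algebra d\<^esub> Poly_Mapping.lookup u i \<otimes>\<^bsub>invariant_algebra d\<^esub> ?g i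
       [^]\<^bsub>invariant_algebra d\<^esub> Poly_Mapping.lookup v i) {..<d div 2}"
    unfolding eval_monomial_def by (simp only: lookup_add nat_pow_mult cycle_class_closed)
  also have "\<dots> = eval_monomial d u \<otimes>\<^bsub>invariant_algebra d\<^esub> eval_monomial d v"
    unfolding eval_monomial_def
    by (rule finprod_multf) (auto simp del: invariant_algebra_simps intro: nat_pow_closed
      cycle_class_closed)
  finally show ?thesis by simp
qed

lemma eval_monomial_var:
  assumes "i < d div 2"
  shows "eval_monomial d (Poly_Mapping.single i 1) = cycle_class d (i + 2)"
proof -
  interpret cring "invariant_algebra d" by (rule invariant_algebra_cring)
  have "eval_monomial d (Poly_Mapping.single i 1) = finprod (invariant_algebra d)
    (\<lambda>j. if i = j then cycle_class d (j + 2) else \<one>\<^bsub>invariant_algebra d\<^esub>) {..<d div 2}"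
    unfolding eval_monomial_def
    by (rule finprod_cong')
      (auto simp del: invariant_algebra_simps simp: lookup_single when_def cycle_class_closed
        One_nat_def)
  also have "\<dots> = cycle_class d (i + 2)"
    using assms by (intro finprod_singleton) (auto simp: cycle_class_closed)
  finally show ?thesis .
qed

lemma eval_poly_superset:
  assumes "finite U" "Poly_Mapping.keys p \<subseteq> U"
  shows "eval_poly d p = (\<Sum>u\<in>U. scale (coeff p u) (eval_monomial d u))"
proof -
  have "scale 0 f = 0" for f :: perm_comb by (rule poly_mapping_eqI) simp
  then show ?thesis unfolding eval_poly_def
    using assms by (intro sum.mono_neutral_left) (auto simp: in_keys_iff)
qed

lemma eval_poly_single: "eval_poly d (Poly_Mapping.single u c) = scale c (eval_monomial d u)"
  using eval_poly_superset[of "{u}" "Poly_Mapping.single u c" d] by simp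

lemma scale_add_left: "scale (a + b) f = scale a f + scale b f"
  by (rule poly_mapping_eqI) (simp add: lookup_add distrib_right)

lemma scale_add_right: "scale a (f + g) = scale a f + scale a g"
  by (rule poly_mapping_eqI) (simp add: lookup_add distrib_left)

lemma scale_scale: "scale a (scale b f) = scale (a * b) f"
  by (rule poly_mapping_eqI) simp

lemma scale_zero: "scale 0 f = 0"
  by (rule poly_mapping_eqI) simp

lemma scale_one: "scale 1 f = f"
  by (rule poly_mapping_eqI) simp

lemma scale_single: "scale a (Poly_Mapping.single u b) = Poly_Mapping.single u (a * b)"
  by (rule poly_mapping_eqI) (simp add: lookup_single when_def)

lemma eval_poly_add: "eval_poly d (p + q) = eval_poly d p + eval_poly d q"
proof -
  let ?U = "Poly_Mapping.keys p \<union> Poly_Mapping.keys q"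
  have "eval_poly d (p + q) = (\<Sum>u\<in>?U. scale (coeff (p + q) u) (eval_monomial d u))"
    by (rule eval_poly_superset) (simp_all add: keys_add)
  also have "\<dots> = (\<Sum>u\<in>?U. scale (coeff p u) (eval_monomial d u)) + (\<Sum>u\<in>?U. scale (coeff q u)
    (eval_monomial d u))"
    by (simp add: lookup_add scale_add_left sum.distrib)
  also have "\<dots> = eval_poly d p + eval_poly d q"
    using eval_poly_superset[of ?U p d] eval_poly_superset[of ?U q d] by simp
  finally show ?thesis .
qed

lemma eval_poly_closed: "eval_poly d p \<in> carrier (invariant_algebra d)"
  unfolding eval_poly_def by (intro invariant_sum_closed invariant_scale_closed eval_monomial_closed)

lemma eval_poly_mult: "eval_poly d (p * q) = graded_mult d (eval_poly d p) (eval_poly d q)"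
proof (induction p rule: poly_mapping_single_induct)
  case (single u a)
  show ?case
  proof (induction q rule: poly_mapping_single_induct)
    case (single v b)
    have "graded_mult d (scale a (eval_monomial d u)) (scale b (eval_monomial d v)) =
      scale a (scale b (graded_mult d (eval_monomial d u) (eval_monomial d v)))"
      by (simp add: invariant_mult_scale_left invariant_mult_comm[of "eval_monomial d u" d "scale b
        (eval_monomial d v)"]
         invariant_mult_comm[of "eval_monomial d v" d "eval_monomial d u"] eval_monomial_closed
           invariant_scale_closed)
    then show ?case by (simp add: mult_single eval_poly_single eval_monomial_add scale_scale)
  next
    case (add q r)
    have "graded_mult d (eval_poly d (Poly_Mapping.single u a)) (eval_poly d q + eval_poly d r) =
      graded_mult d (eval_poly d (Poly_Mapping.single u a)) (eval_poly d q) +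
      graded_mult d (eval_poly d (Poly_Mapping.single u a)) (eval_poly d r)"
      by (metis eval_poly_closed invariant_add_closed invariant_mult_add_left invariant_mult_comm)
    then show ?case using add by (simp add: distrib_left eval_poly_add)
  qed
next
  case (add p r)
  then show ?case by (simp add: distrib_right eval_poly_add invariant_mult_add_left eval_poly_closed)
qed

lemma eval_poly_scale: "eval_poly d (scale c p) = scale c (eval_poly d p)"
  by (induction p rule: poly_mapping_single_induct)
    (simp_all add: eval_poly_single eval_poly_add scale_single scale_add_right scale_scale)

lemma eval_poly_one: "eval_poly d 1 = basis_elt id"
  using eval_poly_single[of d 0 1] by (simp add: eval_monomial_zero scale_one)

lemma eval_poly_var: "i < d div 2 \<Longrightarrow> eval_poly d (var i) = cycle_class d (i + 2)"
  by (simp add: var_def eval_poly_single eval_monomial_var scale_one)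

lemma eval_poly_ring_hom: "eval_poly d \<in> ring_hom (polynomial_algebra m) (invariant_algebra d)"
  by (rule ring_hom_memI) (simp_all add: eval_poly_closed eval_poly_mult eval_poly_add eval_poly_one)

theorem eval_poly_generator_hom: "eval_poly d \<in> generator_homs d"
  by (simp add: generator_homs_def alg_hom_def eval_poly_ring_hom eval_poly_scale eval_poly_var)

text \<open>
  A homomorphism is determined by the images of the variables, by induction on the total degree for
  monomials and by linearity for polynomials.
\<close>

theorem generator_hom_unique:
  assumes \<phi>: "\<phi> \<in> generator_homs d" and p: "p \<in> carrier (polynomial_algebra (d div 2))"
  shows "\<phi> p = eval_poly d p"
proof -
  let ?P = "polynomial_algebra (d div 2)"
  have hom: "\<phi> \<in> ring_hom ?P (invariant_algebra d)"
    and scale: "\<And>c p. p \<in> carrier ?P \<Longrightarrow> \<phi> (scale c p) = scale c (\<phi> p)"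
    and var: "\<And>i. i < d div 2 \<Longrightarrow> \<phi> (var i) = cycle_class d (i + 2)"
    using \<phi> by (auto simp: generator_homs_def alg_hom_def)
  have add: "\<phi> (p + q) = \<phi> p + \<phi> q" if "p \<in> carrier ?P" "q \<in> carrier ?P" for p q
    using ring_hom_add[OF hom that] by simp
  have mult: "\<phi> (p * q) = graded_mult d (\<phi> p) (\<phi> q)" if "p \<in> carrier ?P" "q \<in> carrier ?P" for p q
    using ring_hom_mult[OF hom that] by simp
  have one: "\<phi> 1 = basis_elt id" using ring_hom_one[OF hom] by simp
  have zero: "\<phi> 0 = 0"
    using scale[of 0 0] polynomial_zero_closed by (simp add: scale_zero)
  have monomial: "\<phi> (Poly_Mapping.single u 1) = eval_monomial d u"
    if "Poly_Mapping.keys u \<subseteq> {..<d div 2}" for u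
    using that
  proof (induction "\<Sum>i<d div 2. Poly_Mapping.lookup u i" arbitrary: u rule: less_induct)
    case less
    show ?case
    proof (cases "u = 0")
      case True
      then show ?thesis by (simp add: one eval_monomial_zero)
    next
      case False
      then obtain i where i: "i \<in> Poly_Mapping.keys u" by
        (metis all_not_in_conv in_keys_iff lookup_zero poly_mapping_eqI)
      define v where "v = u - Poly_Mapping.single i 1"
      have u: "u = Poly_Mapping.single i 1 + v"
        using i by (intro poly_mapping_eqI) (auto simp: v_def lookup_add lookup_minus lookup_single
          when_def in_keys_iff)
      have "Poly_Mapping.keys v \<subseteq> Poly_Mapping.keys u"
        by (auto simp: u lookup_add in_keys_iff)
      then have v: "Poly_Mapping.keys v \<subseteq> {..<d div 2}" using less.prems by blast
      have "i < d div 2" using i less.prems by auto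
      have "(\<Sum>j<d div 2. Poly_Mapping.lookup u j) = (\<Sum>j<d div 2. if i = j then 1 else 0) +
        (\<Sum>j<d div 2. Poly_Mapping.lookup v j)"
        unfolding u by (simp add: lookup_add sum.distrib lookup_single when_def)
      then have "(\<Sum>j<d div 2. Poly_Mapping.lookup v j) < (\<Sum>j<d div 2. Poly_Mapping.lookup u j)"
        using \<open>i < d div 2\<close> by simp
      from less.hyps[OF this v] have IH: "\<phi> (Poly_Mapping.single v 1) = eval_monomial d v" .
      have "Poly_Mapping.single u 1 = var i * Poly_Mapping.single v (1 :: rat)"
        by (simp add: u var_def mult_single)
      then have "\<phi> (Poly_Mapping.single u 1) = graded_mult d (\<phi> (var i)) (\<phi> (Poly_Mapping.single v 1))"
        using mult[OF polynomial_var_closed[OF \<open>i < d div 2\<close>] polynomial_single_closed[OF v]] by simp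
      then show ?thesis using IH var \<open>i < d div 2\<close> by (simp add: u eval_monomial_add eval_monomial_var)
    qed
  qed
  have "\<phi> (\<Sum>u\<in>U. Poly_Mapping.single u (coeff p u)) = eval_poly d (\<Sum>u\<in>U. Poly_Mapping.single u
    (coeff p u))"
    if "finite U" "U \<subseteq> Poly_Mapping.keys p" for U
    using that
  proof (induction U)
    case empty
    then show ?case using eval_poly_scale[of d 0 0] by (simp add: zero scale_zero)
  next
    case (insert u U)
    have keys: "Poly_Mapping.keys v \<subseteq> {..<d div 2}" if "v \<in> insert u U" for v
      using insert.prems p that by (auto simp: polynomial_algebra_carrier)
    have "\<phi> (Poly_Mapping.single u (coeff p u)) = scale (coeff p u) (eval_monomial d u)"
      using scale[OF polynomial_single_closed[of u "d div 2" 1], of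
        "coeff p u"] monomial[of u] keys[of u]
      by (simp add: scale_single)
    moreover have "Poly_Mapping.single u (coeff p u) \<in> carrier ?P"
      "(\<Sum>u\<in>U. Poly_Mapping.single u (coeff p u)) \<in> carrier ?P"
      using keys by (auto intro!: polynomial_single_closed polynomial_sum_closed)
    ultimately show ?case using insert by (simp add: add eval_poly_add eval_poly_single)
  qed
  from this[of "Poly_Mapping.keys p"] show ?thesis by (simp add: sum_single_keys)
qed

declare keys_nth [simp del]

section \<open>Computing the values of monomials on conjugacy classes\<close>

fun wt_from :: "nat \<Rightarrow> nat list \<Rightarrow> nat" where
  "wt_from w [] = 0"
| "wt_from w (e # es) = e * w + wt_from (Suc w) es"

abbreviation wt :: "nat list \<Rightarrow> nat" where "wt \<equiv> wt_from 1"

fun monomials :: "nat \<Rightarrow> nat \<Rightarrow> nat \<Rightarrow> nat list list" where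
  "monomials w 0 k = (if k = 0 then [[]] else [])"
| "monomials w (Suc m) k = concat (map (\<lambda>e. map ((#) e) (monomials (Suc w) m (k - e * w))) [0..<Suc
  (k div w)])"

lemma set_monomials:
  "w > 0 \<Longrightarrow> e \<in> set (monomials w m k) \<longleftrightarrow> length e = m \<and> wt_from w e = k"
proof (induction w m k arbitrary: e rule: monomials.induct)
  case (1 w k)
  then show ?case by auto
next
  case (2 w m k)
  have "e \<in> set (monomials w (Suc m) k) \<longleftrightarrow>
    (\<exists>a es. e = a # es \<and> a < Suc (k div w) \<and> es \<in> set (monomials (Suc w) m (k - a * w)))"
    by (auto simp del: upt_Suc)
  also have "\<dots> \<longleftrightarrow> (\<exists>a es. e = a # es \<and> a < Suc (k div w) \<and> length es = m \<and> wt_from (Suc w) es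
    = k - a * w)"
  proof -
    have "es \<in> set (monomials (Suc w) m (k - a * w)) \<longleftrightarrow> length es = m \<and> wt_from (Suc w) es = k - a * w"
      if "a < Suc (k div w)" for a es
      using "2.IH"[of a es] that by (simp del: upt_Suc)
    then show ?thesis by blast
  qed
  also have "\<dots> \<longleftrightarrow> (\<exists>a es. e = a # es \<and> length es = m \<and> a * w + wt_from (Suc w) es = k)"
  proof -
    have "a < Suc (k div w) \<and> x = k - a * w \<longleftrightarrow> a * w + x = k" for a x
      using \<open>w > 0\<close> by (auto simp: less_Suc_eq_le less_eq_div_iff_mult_less_eq)
    then show ?thesis by blast
  qed
  also have "\<dots> \<longleftrightarrow> length e = Suc m \<and> wt_from w e = k"
    by (cases e) auto
  finally show ?case .
qed

lemma wt_from_sum: "wt_from w e = (\<Sum>i<length e. e ! i * (i + w))"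
proof (induction e arbitrary: w)
  case (Cons a e)
  then show ?case by (simp add: sum.lessThan_Suc_shift del: sum.lessThan_Suc)
qed simp

text \<open>
  From here on, monomials in \<open>m\<close> variables are given by lists of \<open>m\<close> exponents, on which one can
  compute.
\<close>

definition monom :: "nat list \<Rightarrow> rat_mpoly" where
  "monom e = Poly_Mapping.single (Poly_Mapping.nth e) 1"

lemma keys_nth_subset: "Poly_Mapping.keys (Poly_Mapping.nth e) \<subseteq> {..<length e}"
  by (auto simp: in_keys_iff nth_default_def simp del: keys_nth split: if_splits)

lemma monomial_norm_nth: "monomial_norm (Poly_Mapping.nth e) = wt e"
proof -
  have "monomial_norm (Poly_Mapping.nth e) = (\<Sum>i<length e. Poly_Mapping.lookup
    (Poly_Mapping.nth e) i * (i + 1))"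
    unfolding monomial_norm_def
    by (rule sum.mono_neutral_left) (use keys_nth_subset[of e] in \<open>auto simp: in_keys_iff simp del:
      keys_nth\<close>)
  then show ?thesis by (simp add: wt_from_sum nth_default_def)
qed

lemma nth_exponents:
  assumes "Poly_Mapping.keys u \<subseteq> {..<m}"
  shows "Poly_Mapping.nth (map (Poly_Mapping.lookup u) [0..<m]) = u"
  using assms by (intro poly_mapping_eqI) (auto simp: nth_default_def in_keys_iff subset_iff)

fun add_exps :: "nat list \<Rightarrow> nat list \<Rightarrow> nat list" where
  "add_exps (a # as) (b # bs) = (a + b) # add_exps as bs"
| "add_exps _ _ = []"

lemma add_exps_eq: "add_exps as bs = map2 (+) as bs"
  by (induction as bs rule: add_exps.induct) auto

lemma nth_add_exps:
  "length as = length bs \<Longrightarrow> Poly_Mapping.nth (add_exps as bs) = Poly_Mapping.nth as + Poly_Mapping.nth bs"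
  by (rule poly_mapping_eqI) (auto simp: lookup_add nth_default_def add_exps_eq)

lemma length_add_exps: "length as = length bs \<Longrightarrow> length (add_exps as bs) = length bs"
  by (simp add: add_exps_eq)

lemma monom_mult: "length as = length bs \<Longrightarrow> monom as * monom bs = monom (add_exps as bs)"
  by (simp add: monom_def mult_single nth_add_exps)

lemma wt_add_exps: "length as = length bs \<Longrightarrow> wt_from w (add_exps as bs) = wt_from w as + wt_from w bs"
  by (simp add: wt_from_sum add_exps_eq sum.distrib distrib_right)

primrec parts :: "nat \<Rightarrow> nat \<Rightarrow> nat \<Rightarrow> nat list list" where
  "parts 0 lo n = (if n = 0 then [[]] else [])"
| "parts (Suc L) lo n = concat (map (\<lambda>k. map ((#) k) (parts L k (n - k))) [lo..<Suc n])"

lemma set_parts: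
  "\<mu> \<in> set (parts L lo n) \<longleftrightarrow> length \<mu> = L \<and> sorted \<mu> \<and> (\<forall>x\<in>set \<mu>. lo \<le> x) \<and> sum_list \<mu> = n"
proof (induction L arbitrary: \<mu> lo n)
  case 0
  then show ?case by auto
next
  case (Suc L)
  have "\<mu> \<in> set (parts (Suc L) lo n) \<longleftrightarrow>
    (\<exists>k \<nu>. \<mu> = k # \<nu> \<and> lo \<le> k \<and> k \<le> n \<and> \<nu> \<in> set (parts L k (n - k)))" by auto
  also have "\<dots> \<longleftrightarrow> length \<mu> = Suc L \<and> sorted \<mu> \<and> (\<forall>x\<in>set \<mu>. lo \<le> x) \<and> sum_list \<mu> = n"
    unfolding Suc.IH by (cases \<mu>) auto
  finally show ?case .
qed

lemma distinct_concat_Cons: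
  "distinct ks \<Longrightarrow> (\<And>k. distinct (f k)) \<Longrightarrow> distinct (concat (map (\<lambda>k. map ((#) k) (f k)) ks))"
  by (induction ks) (auto simp: distinct_map)

lemma distinct_parts: "distinct (parts L lo n)"
  by (induction L arbitrary: lo n) (simp_all add: distinct_concat_Cons del: upt_Suc)

text \<open>
  The cycle types of norm \<open>k\<close>: a permutation with \<open>L\<close> cycles has norm \<open>d - L\<close>.
\<close>

definition class_list :: "nat \<Rightarrow> nat \<Rightarrow> nat list list" where
  "class_list d k = parts (d - k) 1 d"

lemma class_listD:
  assumes "\<mu> \<in> set (class_list d k)"
  shows "length \<mu> = d - k" "0 \<notin> set \<mu>" "sum_list \<mu> = d" "sorted \<mu>"
  using assms by (auto simp: class_list_def set_parts)

lemma length_le_sum_list: "0 \<notin> set ks \<Longrightarrow> length ks \<le> sum_list ks" for ks :: "nat list"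
  by (induction ks) auto

lemma class_listI:
  assumes "0 \<notin> set \<mu>" "sum_list \<mu> = d" "sorted \<mu>"
  shows "\<mu> \<in> set (class_list d (d - length \<mu>))"
  using assms length_le_sum_list[of \<mu>] by (auto simp: class_list_def set_parts Suc_le_eq One_nat_def
    intro: gr0I)

lemma class_val_of_class_list:
  assumes "\<mu> \<in> set (class_list d k)"
  shows "\<exists>\<rho>. \<rho> permutes {1..d} \<and> (\<forall>f \<in> carrier (invariant_algebra d). class_val d f (mset \<mu>)
    = coeff f \<rho>)"
proof -
  obtain \<rho> css where "cycle_form {1..d} \<rho> css" "map length css = \<mu>"
    using cycle_form_with_lengths[of \<mu>] class_listD[OF assms] by auto
  then show ?thesis using coeff_eq_class_val[of _ d \<rho> css] cycle_form_permutes by metis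
qed

lemma coeff_in_class_list:
  assumes "\<rho> permutes {1..d}" "d > 0"
  shows "\<exists>k<d. \<exists>\<mu>\<in>set (class_list d k). \<forall>f \<in> carrier (invariant_algebra d). coeff f \<rho>
    = class_val d f (mset \<mu>)"
proof -
  obtain css where form: "cycle_form {1..d} \<rho> css" using cycle_form_exists[OF assms(1)] by auto
  define \<mu> where "\<mu> = sort (map length css)"
  have "sum_list (map length css) = d" using cycle_form_length[OF form] by simp
  then have sum: "sum_list \<mu> = d" by (metis \<mu>_def mset_sort sum_mset_sum_list)
  have "0 \<notin> set \<mu>" using form by (auto simp: \<mu>_def cycle_form_def)
  then have "\<mu> \<in> set (class_list d (d - length \<mu>))" using sum
    by (intro class_listI) (simp_all add: \<mu>_def)
  moreover have "length \<mu> > 0" using sum assms(2) by auto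
  moreover have "coeff f \<rho> = class_val d f (mset \<mu>)" if "f \<in> carrier (invariant_algebra d)" for f
    using coeff_eq_class_val[OF that form] by (simp add: \<mu>_def)
  ultimately show ?thesis using assms(2) by (metis diff_less)
qed

lemma eq_if_class_vals_eq:
  assumes "f \<in> carrier (invariant_algebra d)" "g \<in> carrier (invariant_algebra d)" "d > 0"
    and "\<And>k \<mu>. k < d \<Longrightarrow> \<mu> \<in> set (class_list d k) \<Longrightarrow> class_val d f (mset \<mu>) = class_val d g (mset \<mu>)"
  shows "f = g"
proof (rule invariant_eqI)
  fix \<rho> assume "\<rho> permutes {1..d}"
  from coeff_in_class_list[OF this assms(3)] assms show "coeff f \<rho> = coeff g \<rho>" by metis
qed (use assms invariant_support in blast)+

lemma class_val_zero: "class_val d 0 M = 0"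
  by (simp add: class_val_def)

lemma class_val_add: "class_val d (f + g) M = class_val d f M + class_val d g M"
  by (simp add: class_val_def lookup_add)

lemma class_val_scale: "class_val d (scale c f) M = c * class_val d f M"
  by (simp add: class_val_def)

text \<open>
  The class function \<open>f\<close> is homogeneous of norm \<open>k\<close>, and \<open>v\<close> lists its values, which are integers,
  on the cycle types of norm \<open>k\<close>.
\<close>

definition has_vec :: "nat \<Rightarrow> perm_comb \<Rightarrow> nat \<Rightarrow> int list \<Rightarrow> bool" where
  "has_vec d f k v \<longleftrightarrow> f \<in> carrier (invariant_algebra d) \<and>
    map (\<lambda>\<mu>. class_val d f (mset \<mu>)) (class_list d k) = map of_int v \<and>
    (\<forall>j<d. j \<noteq> k \<longrightarrow> (\<forall>\<mu>\<in>set (class_list d j). class_val d f (mset \<mu>) = 0))"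

lemma has_vec_length: "has_vec d f k v \<Longrightarrow> length v = length (class_list d k)"
  by (metis has_vec_def length_map)

lemma has_vec_integral:
  assumes "has_vec d f k v" "d > 0"
  shows "coeff f \<rho> \<in> \<int>"
proof (cases "\<rho> permutes {1..d}")
  case True
  then obtain j \<mu> where \<mu>: "j < d" "\<mu> \<in> set (class_list d j)" "coeff f \<rho> = class_val d f (mset \<mu>)"
    using coeff_in_class_list[OF True assms(2)] assms(1) by (auto simp: has_vec_def)
  show ?thesis
  proof (cases "j = k")
    case True
    then have "class_val d f (mset \<mu>) \<in> set (map (\<lambda>\<mu>. class_val d f (mset \<mu>)) (class_list d k))"
      using \<mu> by auto
    also have "\<dots> \<subseteq> \<int>" using assms(1) by (auto simp: has_vec_def)
    finally show ?thesis by (simp add: \<mu>(3))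
  next
    case False
    then show ?thesis using \<mu> assms(1) by (simp add: has_vec_def)
  qed
next
  case False
  have "coeff_support f \<subseteq> {p. p permutes {1..d}}"
    using assms(1) by (intro invariant_support) (simp add: has_vec_def)
  then have "coeff f \<rho> = 0" using False by (auto simp: in_keys_iff)
  then show ?thesis by simp
qed

definition cut_part :: "nat \<Rightarrow> nat \<times> nat list \<Rightarrow> (nat \<times> nat list) list" where
  "cut_part i = (\<lambda>(l, rest). map (\<lambda>ks. (l, sort (ks @ rest))) (compositions i l))"

definition cut_terms :: "nat \<Rightarrow> nat list \<Rightarrow> (nat \<times> nat list) list" where
  "cut_terms i \<mu> = concat (map (cut_part i) (picks \<mu>))"

fun cut_coeff :: "(nat \<times> nat list) list \<Rightarrow> nat list \<Rightarrow> int" where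
  "cut_coeff [] \<nu> = 0"
| "cut_coeff ((l, \<nu>') # ts) \<nu> = (if \<nu> = \<nu>' then int l + cut_coeff ts \<nu> else cut_coeff ts \<nu>)"

definition cut_row :: "nat \<Rightarrow> nat list list \<Rightarrow> nat list \<Rightarrow> int list" where
  "cut_row i \<nu>s \<mu> = map (cut_coeff (cut_terms i \<mu>)) \<nu>s"

text \<open>
  This is \<open>i\<close> times the matrix of the multiplication by \<open>\<gamma>\<^sub>i\<close> from norm \<open>k\<close> to norm \<open>k + i - 1\<close>: the
  entry at \<open>\<mu>\<close> and \<open>\<nu>\<close> collects the compositions of a part of \<open>\<mu>\<close> that turn \<open>\<mu>\<close> into \<open>\<nu>\<close>.
\<close>

definition cut_mat :: "nat \<Rightarrow> nat \<Rightarrow> nat \<Rightarrow> int list list" where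
  "cut_mat d i k = map (cut_row i (class_list d k)) (class_list d (k + (i - 1)))"

fun dot :: "int list \<Rightarrow> int list \<Rightarrow> int" where
  "dot (x # xs) (y # ys) = x * y + dot xs ys"
| "dot _ _ = 0"

text \<open>
  The division by \<open>i\<close> is exact, because the product of two integral elements is integral (see
  \<open>has_vec_cycle_class_mult\<close>).
\<close>

definition cut_dot :: "nat \<Rightarrow> int list \<Rightarrow> int list \<Rightarrow> int" where
  "cut_dot i v row = dot row v div int i"

lemma compositionsD:
  "ks \<in> set (compositions i l) \<Longrightarrow> length ks = i \<and> sum_list ks = l \<and> 0 \<notin> set ks"
proof (induction i arbitrary: l ks)
  case 0
  then show ?case by (auto split: if_splits)
next
  case (Suc i)
  then obtain k ks' where "ks = k # ks'" "1 \<le> k" "k \<le> l" "ks' \<in> set (compositions i (l - k))"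
    by auto
  then show ?case using Suc.IH by fastforce
qed

lemma sum_cut_terms:
  fixes g :: "nat multiset \<Rightarrow> rat"
  shows "(\<Sum>(l, rest)\<leftarrow>picks \<mu>. of_nat l * (\<Sum>ks\<leftarrow>compositions i l. g (mset (ks @ rest)))) =
    (\<Sum>(l, \<nu>)\<leftarrow>cut_terms i \<mu>. of_nat l * g (mset \<nu>))"
  unfolding cut_terms_def sum_list_concat_map
  by (intro arg_cong[where f = sum_list] map_cong refl)
    (auto simp: cut_part_def comp_def sum_list_const_mult)

lemma cut_terms_class:
  assumes \<mu>: "\<mu> \<in> set (class_list d k)" "k < d" and i: "i \<ge> 1" and t: "(l, \<nu>) \<in> set (cut_terms i \<mu>)"
  shows "i - 1 \<le> k" "\<nu> \<in> set (class_list d (k - (i - 1)))"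
proof -
  obtain rest ks where *: "(l, rest) \<in> set (picks \<mu>)" "ks \<in> set (compositions i l)" "\<nu> = sort
    (ks @ rest)"
    using t by (auto simp: cut_terms_def cut_part_def)
  have ks: "length ks = i" "sum_list ks = l" "0 \<notin> set ks" using compositionsD[OF *(2)] by auto
  have m: "mset \<mu> = mset (l # rest)" using mset_picks[OF *(1)] by simp
  have "length \<mu> = Suc (length rest)" using mset_eq_length[OF m] by simp
  moreover have "sum_list \<mu> = l + sum_list rest"
    using arg_cong[OF m, of sum_mset] by (simp only: sum_mset_sum_list sum_list.Cons)
  moreover have "set rest \<subseteq> set \<mu>" using mset_eq_setD[OF m] by auto
  ultimately have rest: "Suc (length rest) = d - k" "l + sum_list rest = d" "0 \<notin> set rest"
    using class_listD[OF \<mu>(1)] by auto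
  have "sum_list \<nu> = sum_list (ks @ rest)" unfolding *(3) by (metis mset_sort sum_mset_sum_list)
  then have \<nu>: "0 \<notin> set \<nu>" "sum_list \<nu> = d" "sorted \<nu>" "length \<nu> = i + length rest"
    using ks rest *(3) by auto
  have "length \<nu> \<le> d" using length_le_sum_list[OF \<nu>(1)] \<nu>(2) by simp
  then show "i - 1 \<le> k" using \<nu>(4) rest(1) \<mu>(2) i by linarith
  then have "d - length \<nu> = k - (i - 1)" using \<nu>(4) rest(1) \<mu>(2) i by linarith
  then show "\<nu> \<in> set (class_list d (k - (i - 1)))" using class_listI[OF \<nu>(1-3)] by simp
qed

lemma sum_cut_coeff:
  fixes g :: "nat list \<Rightarrow> rat"
  assumes "distinct \<nu>s" "snd ` set ts \<subseteq> set \<nu>s"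
  shows "(\<Sum>(l, \<nu>)\<leftarrow>ts. of_nat l * g \<nu>) = (\<Sum>\<nu>\<leftarrow>\<nu>s. of_int (cut_coeff ts \<nu>) * g \<nu>)"
  using assms(2)
proof (induction ts)
  case (Cons t ts)
  obtain l \<nu>' where t: "t = (l, \<nu>')" by (cases t)
  have "\<nu>' \<in> set \<nu>s" using Cons.prems t by auto
  then have single: "(\<Sum>\<nu>\<leftarrow>\<nu>s. if \<nu> = \<nu>' then of_nat l * g \<nu> else 0) = of_nat l * g \<nu>'"
    using assms(1) by (simp add: sum.distinct_set_conv_list[symmetric])
  have "of_int (cut_coeff (t # ts) \<nu>) * g \<nu> =
      (if \<nu> = \<nu>' then of_nat l * g \<nu> else 0) + of_int (cut_coeff ts \<nu>) * g \<nu>" for \<nu>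
    by (simp add: t distrib_right)
  then have "(\<Sum>\<nu>\<leftarrow>\<nu>s. of_int (cut_coeff (t # ts) \<nu>) * g \<nu>) =
      of_nat l * g \<nu>' + (\<Sum>\<nu>\<leftarrow>\<nu>s. of_int (cut_coeff ts \<nu>) * g \<nu>)"
    using single by (simp add: sum_list_addf)
  then show ?case using Cons by (simp add: t)
qed simp

lemma of_int_dot:
  fixes g :: "'a \<Rightarrow> rat"
  assumes "map g \<nu>s = map of_int v"
  shows "of_int (dot (map c \<nu>s) v) = (\<Sum>\<nu>\<leftarrow>\<nu>s. of_int (c \<nu>) * g \<nu>)"
  using assms
proof (induction \<nu>s arbitrary: v)
  case (Cons \<nu> \<nu>s)
  then show ?case by (cases v) auto
qed simp

lemma has_vec_cycle_class_mult:
  assumes vec: "has_vec d f k v" and i: "i \<ge> 2" and d: "d > 0"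
  shows "has_vec d (graded_mult d (cycle_class d i) f) (k + (i - 1)) (map (cut_dot i v) (cut_mat d i k))"
proof -
  let ?g = "graded_mult d (cycle_class d i) f"
  have f: "f \<in> carrier (invariant_algebra d)" using vec by (simp add: has_vec_def)
  have g: "?g \<in> carrier (invariant_algebra d)" by (rule invariant_mult_closed[OF cycle_class_closed f])
  (* the formula for the product gives only its multiple by i; integrality comes from the definition *)
  have int: "coeff ?g \<rho> \<in> \<int>" for \<rho>
    unfolding lookup_mult_invariant[OF cycle_class_closed f]
    using has_vec_integral[OF vec d] by (auto simp: coeff_cycle_class intro!: Ints_sum)
  have val: "of_nat i * class_val d ?g (mset \<mu>) = (\<Sum>(l, \<nu>)\<leftarrow>cut_terms i \<mu>. of_nat l * class_val d f
    (mset \<nu>))"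
    if "\<mu> \<in> set (class_list d j)" for \<mu> j
    using class_val_cycle_class_mult[OF f i class_listD(2,3)[OF that]] by (simp only: sum_cut_terms)
  have "class_val d ?g (mset \<mu>) = of_int (cut_dot i v (cut_row i (class_list d k) \<mu>))"
    if \<mu>: "\<mu> \<in> set (class_list d (k + (i - 1)))" for \<mu>
  proof -
    have "k + (i - 1) < d"
    proof (rule ccontr)
      assume "\<not> k + (i - 1) < d"
      then show False using class_listD(1,3)[OF \<mu>] d by simp
    qed
    then have "snd ` set (cut_terms i \<mu>) \<subseteq> set (class_list d k)"
      using cut_terms_class[OF \<mu>, of i] i by fastforce
    from sum_cut_coeff[OF _ this, of "\<lambda>\<nu>. class_val d f (mset \<nu>)"]
    have "of_nat i * class_val d ?g (mset \<mu>) =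
      (\<Sum>\<nu>\<leftarrow>class_list d k. of_int (cut_coeff (cut_terms i \<mu>) \<nu>) * class_val d f (mset \<nu>))"
      by (simp add: val[OF \<mu>] class_list_def distinct_parts)
    also have "\<dots> = of_int (dot (cut_row i (class_list d k) \<mu>) v)"
      unfolding cut_row_def by (rule of_int_dot[symmetric]) (use vec in \<open>simp add: has_vec_def\<close>)
    finally have *: "of_nat i * class_val d ?g (mset \<mu>) = of_int (dot (cut_row i
      (class_list d k) \<mu>) v)" .
    have "class_val d ?g (mset \<mu>) \<in> \<int>" using class_val_of_class_list[OF \<mu>] g int by auto
    then obtain z where z: "class_val d ?g (mset \<mu>) = of_int z" by (auto elim: Ints_cases)
    have "of_int (int i * z) = (of_int (dot (cut_row i (class_list d k) \<mu>) v) :: rat)"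
      using * z by simp
    then have "int i * z = dot (cut_row i (class_list d k) \<mu>) v" by (simp only: of_int_eq_iff)
    then have "cut_dot i v (cut_row i (class_list d k) \<mu>) = int i * z div int i"
      by (simp only: cut_dot_def)
    also have "\<dots> = z" using i by simp
    finally have "cut_dot i v (cut_row i (class_list d k) \<mu>) = z" .
    then show ?thesis using z by simp
  qed
  moreover have "class_val d ?g (mset \<mu>) = 0"
    if \<mu>: "j < d" "j \<noteq> k + (i - 1)" "\<mu> \<in> set (class_list d j)" for j \<mu>
  proof -
    have "class_val d f (mset \<nu>) = 0" if "(l, \<nu>) \<in> set (cut_terms i \<mu>)" for l \<nu>
    proof -
      have "i - 1 \<le> j" "\<nu> \<in> set (class_list d (j - (i - 1)))"
        using cut_terms_class[OF \<mu>(3,1) _ that] i by simp_all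
      moreover have "j - (i - 1) < d" "j - (i - 1) \<noteq> k" using \<mu>(1,2) \<open>i - 1 \<le> j\<close> by linarith+
      ultimately show ?thesis using vec unfolding has_vec_def by blast
    qed
    then have "(\<Sum>(l, \<nu>)\<leftarrow>cut_terms i \<mu>. of_nat l * class_val d f (mset \<nu>)) = (\<Sum>t\<leftarrow>cut_terms i \<mu>. 0)"
      by (intro arg_cong[where f = sum_list] map_cong refl) auto
    then show ?thesis using val[OF \<mu>(3)] i by simp
  qed
  ultimately show ?thesis using g by (simp add: has_vec_def cut_mat_def)
qed

text \<open>
  The only permutation with \<open>d\<close> cycles is the identity.
\<close>

lemma has_vec_one:
  assumes "d > 0"
  shows "has_vec d (basis_elt id) 0 [1]"
proof -
  have form: "cycle_form {1..d} id (map (\<lambda>x. [x]) [1..<Suc d])"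
    using cycle_form_id[of "[1..<Suc d]"] by (simp add: atLeastLessThanSuc_atLeastAtMost del: upt_Suc)
  have ones: "class_list d 0 = [replicate d 1]"
  proof -
    have "\<mu> = replicate d 1" if "\<mu> \<in> set (class_list d 0)" for \<mu>
    proof -
      have *: "0 \<notin> set ks \<Longrightarrow> sum_list ks = length ks \<Longrightarrow> ks = replicate (length ks) 1" for ks :: "nat list"
      proof (induction ks)
        case (Cons k ks)
        then show ?case using length_le_sum_list[of ks] by (auto simp: One_nat_def)
      qed simp
      show ?thesis using *[of \<mu>] class_listD[OF that] by simp
    qed
    moreover have "replicate d 1 \<in> set (class_list d 0)"
      using class_listI[of "replicate d 1" d] by (simp add: sum_list_replicate)
    moreover have "distinct (class_list d 0)" by (simp add: class_list_def distinct_parts)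
    ultimately have set: "set (class_list d 0) = {replicate d 1}" and "distinct (class_list d 0)"
      by blast+
    then have "length (class_list d 0) = 1" 
      using distinct_card[of "class_list d 0"] by simp
    then obtain x where "class_list d 0 = [x]" by (cases "class_list d 0") (auto simp: One_nat_def)
    then show ?thesis using set by simp
  qed
  have "class_val d (basis_elt id) (mset (map length (map (\<lambda>x. [x]) [1..<Suc d]))) = 1"
    using coeff_eq_class_val[OF invariant_one_closed form] by simp
  moreover have "map length (map (\<lambda>x. [x]) [1..<Suc d]) = replicate d 1"
    by (simp add: comp_def map_replicate_const del: upt_Suc)
  ultimately have 1: "class_val d (basis_elt id) (mset (replicate d 1)) = 1" by (simp only:)
  have "class_val d (basis_elt id) (mset \<mu>) = 0" if \<mu>: "j < d" "j \<noteq> 0" "\<mu> \<in> set (class_list d j)" for j \<mu>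
  proof -
    obtain \<rho> css where \<rho>: "cycle_form {1..d} \<rho> css" "map length css = \<mu>"
      using cycle_form_with_lengths[of \<mu>] class_listD[OF \<mu>(3)] by auto
    have "\<rho> \<noteq> id"
    proof
      assume "\<rho> = id"
      then have "length css = d" using perm_norm_cycle_form[OF \<rho>(1)] by (simp add: perm_norm_id)
      then have "length \<mu> = d" using \<rho>(2) by auto
      then show False using class_listD(1)[OF \<mu>(3)] \<mu> by simp
    qed
    then show ?thesis using coeff_eq_class_val[OF invariant_one_closed \<rho>(1)] \<rho>(2)
      by (simp add: lookup_single when_def)
  qed
  with 1 show ?thesis by (simp add: has_vec_def invariant_one_closed ones)
qed

lemma has_vec_zero: "has_vec d 0 k (replicate (length (class_list d k)) 0)"
  by (simp add: has_vec_def class_val_zero invariant_zero_closed map_replicate_const)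

fun axpy :: "int \<Rightarrow> int list \<Rightarrow> int list \<Rightarrow> int list" where
  "axpy c (x # xs) (y # ys) = (c * x + y) # axpy c xs ys"
| "axpy c _ _ = []"

lemma map_of_int_axpy:
  "map f xs = map of_int v \<Longrightarrow> map g xs = map of_int w \<Longrightarrow>
    map (\<lambda>x. of_int c * f x + g x) xs = map of_int (axpy c v w)"
  for f g :: "'a \<Rightarrow> rat"
proof (induction xs arbitrary: v w)
  case (Cons x xs)
  then show ?case by (cases v; cases w) auto
qed simp

lemma has_vec_axpy:
  "has_vec d f k v \<Longrightarrow> has_vec d g k w \<Longrightarrow> has_vec d (scale (of_int c) f + g) k (axpy c v w)"
  by (simp add: has_vec_def class_val_add class_val_scale map_of_int_axpy invariant_add_closed
    invariant_scale_closed)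

lemma has_vec_eq_zero:
  assumes "has_vec d f k v" "\<forall>x\<in>set v. x = 0" "d > 0"
  shows "f = 0"
proof (rule eq_if_class_vals_eq[OF _ invariant_zero_closed assms(3)])
  show "f \<in> carrier (invariant_algebra d)" using assms(1) by (simp add: has_vec_def)
  fix j \<mu> assume *: "j < d" "\<mu> \<in> set (class_list d j)"
  have "class_val d f (mset \<mu>) = 0"
  proof (cases "j = k")
    case True
    then have "class_val d f (mset \<mu>) \<in> set (map of_int v)"
      using assms(1) * unfolding has_vec_def by (metis (no_types, lifting) True image_eqI list.set_map)
    then show ?thesis using assms(2) by auto
  qed (use assms(1) * in \<open>simp add: has_vec_def\<close>)
  then show "class_val d f (mset \<mu>) = class_val d 0 (mset \<mu>)" by (simp add: class_val_zero)
qed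

text \<open>
  Splits off the first variable that occurs in a monomial. For the constant monomial the result has
  no meaning.
\<close>

fun split_var :: "nat list \<Rightarrow> nat \<times> nat list" where
  "split_var [] = (0, [])"
| "split_var (0 # es) = map_prod Suc ((#) 0) (split_var es)"
| "split_var (Suc e # es) = (0, e # es)"

lemma split_var:
  assumes "split_var e = (i, e')" "wt_from w e > 0"
  shows "length e' = length e" "i < length e" "wt_from w e = wt_from w e' + (i + w)"
    "Poly_Mapping.nth e = Poly_Mapping.single i 1 + Poly_Mapping.nth e'"
proof -
  have *: "length e' = length e \<and> i < length e \<and> wt_from w e = wt_from w e' + (i + w) \<and>
      (\<forall>n. nth_default 0 e n = (if i = n then 1 else 0) + nth_default 0 e' n)"
    using assms
  proof (induction e arbitrary: i e' w rule: split_var.induct)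
    case (2 es)
    obtain j es' where j: "split_var es = (j, es')" by (cases "split_var es")
    from 2 j have eqs: "i = Suc j" "e' = 0 # es'" by auto
    have IH: "length es' = length es" "j < length es" "wt_from (Suc w) es = wt_from (Suc w) es' +
      (j + Suc w)"
        "\<forall>n. nth_default 0 es n = (if j = n then 1 else 0) + nth_default 0 es' n"
      using "2.IH"[OF j, of "Suc w"] "2.prems" by simp_all
    have "nth_default 0 (0 # es) n = (if i = n then 1 else 0) + nth_default 0 e' n" for n
      using IH(4) by (cases n) (simp_all add: eqs)
    then show ?case using IH(1-3) by (simp add: eqs)
  next
    case (3 a es)
    then have eqs: "i = 0" "e' = a # es" by auto
    have "nth_default 0 (Suc a # es) n = (if i = n then 1 else 0) + nth_default 0 e' n" for n
      by (cases n) (simp_all add: eqs One_nat_def)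
    then show ?case by (simp add: eqs)
  qed simp
  then show "length e' = length e" "i < length e" "wt_from w e = wt_from w e' + (i + w)" by blast+
  show "Poly_Mapping.nth e = Poly_Mapping.single i 1 + Poly_Mapping.nth e'"
    using * by (intro poly_mapping_eqI) (simp add: lookup_add lookup_single when_def)
qed

lemma nth_eq_zero: "wt_from w e = 0 \<Longrightarrow> w > 0 \<Longrightarrow> Poly_Mapping.nth e = 0"
  by (rule poly_mapping_eqI) (auto simp: wt_from_sum nth_default_def)

lemma has_vec_monomial_step:
  assumes e: "split_var e = (i, e')" "wt e > 0" "length e = d div 2" and d: "d > 0"
    and vec: "has_vec d (eval_monomial d (Poly_Mapping.nth e')) (wt e') v"
  shows "has_vec d (eval_monomial d (Poly_Mapping.nth e)) (wt e) (map (cut_dot (i + 2) v) (cut_mat d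
    (i + 2) (wt e')))"
proof -
  note s = split_var[OF e(1,2)]
  have "i < d div 2" using s(2) e(3) by simp
  then have "eval_monomial d (Poly_Mapping.nth e) = graded_mult d (cycle_class d (i + 2))
    (eval_monomial d (Poly_Mapping.nth e'))"
    by (simp only: s(4) eval_monomial_add eval_monomial_var)
  moreover have "wt e = wt e' + (i + 2 - 1)" using s(3) by simp
  ultimately show ?thesis using has_vec_cycle_class_mult[OF vec, of "i + 2"] d by simp
qed

lemma has_vec_monomial_exists:
  assumes "d > 0" "length e = d div 2"
  shows "\<exists>v. has_vec d (eval_monomial d (Poly_Mapping.nth e)) (wt e) v"
  using assms(2)
proof (induction "wt e" arbitrary: e rule: less_induct)
  case less
  show ?case
  proof (cases "wt e = 0")
    case True
    then show ?thesis using has_vec_one[OF assms(1)] nth_eq_zero[of 1 e]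
      by (auto simp: eval_monomial_zero)
  next
    case False
    obtain i e' where s: "split_var e = (i, e')" by (cases "split_var e")
    then have "wt e' < wt e" "length e' = d div 2"
      using split_var[OF s, of 1] False less.prems by simp_all
    then show ?thesis using less.hyps has_vec_monomial_step[OF s _ less.prems assms(1)] False by blast
  qed
qed

text \<open>
  There is no permutation of norm \<open>d\<close> or more.
\<close>

lemma eval_monomial_top:
  assumes "d > 0" "length e = d div 2" "wt e \<ge> d"
  shows "eval_monomial d (Poly_Mapping.nth e) = 0"
proof -
  obtain v where v: "has_vec d (eval_monomial d (Poly_Mapping.nth e)) (wt e) v"
    using has_vec_monomial_exists[OF assms(1,2)] by auto
  have "class_list d (wt e) = []" using assms by (simp add: class_list_def)
  then have "v = []" using has_vec_length[OF v] by simp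
  then show ?thesis using has_vec_eq_zero[OF v] assms(1) by simp
qed

fun table_get :: "(nat list \<times> int list) list \<Rightarrow> nat list \<Rightarrow> int list" where
  "table_get [] e = []"
| "table_get ((e', v) # T) e = (if e = e' then v else table_get T e)"

definition vec_at :: "(nat list \<times> int list) list list \<Rightarrow> nat list \<Rightarrow> int list" where
  "vec_at T e = table_get (T ! wt e) e"

definition next_vec :: "int list list list list \<Rightarrow> (nat list \<times> int list) list list \<Rightarrow> nat list \<Rightarrow> nat
  list \<times> int list" where
  "next_vec Ms T e = (case split_var e of (i, e') \<Rightarrow>
    (e, map (cut_dot (i + 2) (vec_at T e')) (Ms ! i ! wt e')))"

text \<open>
  Table number \<open>k\<close> contains the values of all monomials of norm \<open>k\<close>, computed from the tables of
  smaller norm. The step is a constant of its own, partially applied: evaluation by rewriting leaves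
  it alone until its last argument is known, whereas it would start to work inside an abstraction.
\<close>

primrec tables :: "int list list list list \<Rightarrow> nat \<Rightarrow> nat \<Rightarrow> (nat list \<times> int list) list list" where
  "tables Ms m 0 = [[(replicate m 0, [1])]]"
| "tables Ms m (Suc k) = (let T = tables Ms m k in T @ [map (next_vec Ms T) (monomials 1 m (Suc k))])"

definition cut_mats_of :: "nat \<Rightarrow> nat \<Rightarrow> int list list list" where
  "cut_mats_of d i = map (cut_mat d i) [0..<d - (i - 1)]"

definition cut_mats :: "nat \<Rightarrow> int list list list list" where
  "cut_mats d = map (cut_mats_of d) [2..<d div 2 + 2]"

definition value_tables :: "nat \<Rightarrow> (nat list \<times> int list) list list" where
  "value_tables d = tables (cut_mats d) (d div 2) (d - 1)"

lemma table_get_map: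
  "(\<And>e. fst (f e) = e) \<Longrightarrow> e \<in> set es \<Longrightarrow> table_get (map f es) e = snd (f e)"
proof (induction es)
  case (Cons a es)
  then show ?case by (cases "f a") (metis (mono_tags, lifting) fst_conv list.map(2) set_ConsD
    snd_conv table_get.simps(2))
qed simp

lemma length_tables: "length (tables Ms m k) = Suc k"
  by (induction k) (simp_all add: Let_def)

lemma has_vec_tables:
  assumes "k < d" "length e = d div 2" "wt e \<le> k"
  shows "has_vec d (eval_monomial d (Poly_Mapping.nth e)) (wt e) (vec_at (tables (cut_mats d)
    (d div 2) k) e)"
  using assms
proof (induction k arbitrary: e)
  case 0
  then have "wt e = 0" by simp
  then have "e = replicate (d div 2) 0" using 0(2) by (intro nth_equalityI) (auto simp: wt_from_sum)
  then show ?case using has_vec_one[of d] nth_eq_zero[of 1 e] 0 \<open>wt e = 0\<close>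
    by (simp add: vec_at_def eval_monomial_zero)
next
  case (Suc k)
  define T where "T = tables (cut_mats d) (d div 2) k"
  define L where "L = map (next_vec (cut_mats d) T) (monomials 1 (d div 2) (Suc k))"
  have T': "tables (cut_mats d) (d div 2) (Suc k) = T @ [L]" by (simp add: T_def L_def Let_def)
  have len: "length T = Suc k" by (simp add: T_def length_tables)
  show ?case
  proof (cases "wt e = Suc k")
    case False
    then have "wt e \<le> k" using Suc.prems by simp
    then show ?thesis using Suc.IH[of e] Suc.prems len by
      (simp add: T' vec_at_def nth_append flip: T_def)
  next
    case True
    obtain i e' where s: "split_var e = (i, e')" by (cases "split_var e")
    have e': "length e' = d div 2" "wt e = wt e' + (i + 1)" "i < d div 2"
      using split_var[OF s, of 1] True Suc.prems by simp_all
    have "fst (next_vec (cut_mats d) T e) = e" for e by (simp add: next_vec_def split: prod.split)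
    moreover have "e \<in> set (monomials 1 (d div 2) (Suc k))" using Suc.prems True
      by (simp add: set_monomials)
    ultimately have "table_get L e = snd (next_vec (cut_mats d) T e)" by (simp add: L_def table_get_map)
    also have "\<dots> = map (cut_dot (i + 2) (vec_at T e')) (cut_mats d ! i ! wt e')"
      by (simp add: next_vec_def s)
    also have "cut_mats d ! i = cut_mats_of d (i + 2)"
      using e'(3) by (simp add: cut_mats_def add.commute del: upt_Suc)
    also have "cut_mats_of d (i + 2) ! wt e' = cut_mat d (i + 2) (wt e')"
    proof -
      have "wt e' < d - (i + 2 - 1)" using e'(2) True Suc.prems(1) by linarith
      then show ?thesis by (simp add: cut_mats_of_def del: diff_diff_left)
    qed
    finally have "vec_at (T @ [L]) e = map (cut_dot (i + 2) (vec_at T e')) (cut_mat d (i + 2) (wt e'))"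
      using True len by (simp add: vec_at_def nth_append)
    moreover have "has_vec d (eval_monomial d (Poly_Mapping.nth e')) (wt e') (vec_at T e')"
      unfolding T_def using Suc.IH[of e'] Suc.prems(1) e' True by simp
    ultimately show ?thesis
      using has_vec_monomial_step[OF s _ Suc.prems(2)] True Suc.prems(1)
        by (simp add: T' del: tables.simps)
  qed
qed

lemma has_vec_value_tables:
  assumes "length e = d div 2" "wt e < d"
  shows "has_vec d (eval_monomial d (Poly_Mapping.nth e)) (wt e) (vec_at (value_tables d) e)"
  unfolding value_tables_def using assms by (intro has_vec_tables) auto

section \<open>A finite certificate for a minimal presentation\<close>

text \<open>
  Polynomials with integer coefficients as lists of coefficients and exponents.
\<close>

type_synonym term_list = "(int \<times> nat list) list"

definition poly_of :: "term_list \<Rightarrow> rat_mpoly" where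
  "poly_of t = (\<Sum>(c, e)\<leftarrow>t. scale (of_int c) (monom e))"

text \<open>
  Read off the last term, as all terms of a homogeneous polynomial have the same degree.
\<close>

definition deg :: "term_list \<Rightarrow> nat" where
  "deg t = wt (snd (last t))"

definition term_ok :: "nat \<Rightarrow> nat \<Rightarrow> int \<times> nat list \<Rightarrow> bool" where
  "term_ok m k t \<longleftrightarrow> length (snd t) = m \<and> wt (snd t) = k"

definition homogeneous_ok :: "nat \<Rightarrow> term_list \<Rightarrow> bool" where
  "homogeneous_ok m t \<longleftrightarrow> t \<noteq> [] \<and> list_all (term_ok m (deg t)) t"

text \<open>
  The values of a homogeneous polynomial, from the table \<open>T\<close> of the values of monomials.
\<close>

fun comb :: "(nat list \<times> int list) list list \<Rightarrow> nat \<Rightarrow> term_list \<Rightarrow> int list" where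
  "comb T n [] = replicate n 0"
| "comb T n ((c, e) # t) = axpy c (vec_at T e) (comb T n t)"

definition relation_ok :: "nat \<Rightarrow> (nat list \<times> int list) list list \<Rightarrow> term_list \<Rightarrow> bool" where
  "relation_ok d T r \<longleftrightarrow>
    (if deg r < d then list_all ((=) 0) (comb T (length (class_list d (deg r))) r) else True)"

fun divides :: "nat list \<Rightarrow> nat list \<Rightarrow> bool" where
  "divides (a # as) (b # bs) \<longleftrightarrow> a \<le> b \<and> divides as bs"
| "divides _ _ \<longleftrightarrow> True"

definition divisible :: "nat list list \<Rightarrow> nat list \<Rightarrow> bool" where
  "divisible ls e \<longleftrightarrow> list_ex (\<lambda>l. divides l e) ls"

definition standard :: "nat list list \<Rightarrow> nat list \<Rightarrow> bool" where
  "standard ls e \<longleftrightarrow> \<not> divisible ls e"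

text \<open>
  The leading term of a polynomial is its last one.
\<close>

definition leads :: "term_list list \<Rightarrow> nat list list" where
  "leads Gs = map (\<lambda>g. snd (last g)) Gs"

text \<open>
  Instead of a term order, leading monomials are compared by a linear weight, which suffices for
  finitely many polynomials and makes the reduction terminate for a trivial reason.
\<close>

fun weight :: "nat list \<Rightarrow> nat list \<Rightarrow> nat" where
  "weight (w # ws) (e # es) = w * e + weight ws es"
| "weight _ _ = 0"

definition lighter :: "nat list \<Rightarrow> nat \<Rightarrow> int \<times> nat list \<Rightarrow> bool" where
  "lighter ws b t \<longleftrightarrow> weight ws (snd t) < b"

definition lead_ok :: "nat list \<Rightarrow> term_list \<Rightarrow> bool" where
  "lead_ok ws g \<longleftrightarrow> fst (last g) \<noteq> 0 \<and> list_all (lighter ws (weight ws (snd (last g)))) (butlast g)"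

definition degree_divisible :: "nat \<Rightarrow> nat list list \<Rightarrow> nat \<Rightarrow> bool" where
  "degree_divisible m ls k \<longleftrightarrow> list_all (divisible ls) (monomials 1 m k)"

fun row_comb :: "nat \<Rightarrow> int list \<Rightarrow> int list list \<Rightarrow> int list" where
  "row_comb n (c # cs) (r # rs) = axpy c r (row_comb n cs rs)"
| "row_comb n _ _ = replicate n 0"

definition times_mat :: "nat \<Rightarrow> int list list \<Rightarrow> int list \<Rightarrow> int list" where
  "times_mat n B row = row_comb n row B"

definition mat_mul :: "nat \<Rightarrow> int list list \<Rightarrow> int list list \<Rightarrow> int list list" where
  "mat_mul n A B = map (times_mat n B) A"

definition scalar_mat :: "nat \<Rightarrow> int \<Rightarrow> int list list" where
  "scalar_mat n D = map (\<lambda>i. map (\<lambda>j. if i = j then D else 0) [0..<n]) [0..<n]"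

definition has_length :: "nat \<Rightarrow> 'a list \<Rightarrow> bool" where
  "has_length n xs \<longleftrightarrow> length xs = n"

text \<open>
  The matrix \<open>V\<close> of the values of the standard monomials of norm \<open>k\<close> on the cycle types of norm \<open>k\<close>
  is invertible over the rationals, with inverse \<open>W / D\<close>. Both products are checked: \<open>V W = D\<close> gives
  the linear independence of the values and \<open>W V = D\<close> that they span.
\<close>

definition inverse_ok :: "nat \<Rightarrow> (nat list \<times> int list) list list \<Rightarrow> nat list list \<Rightarrow> nat \<Rightarrow> int \<Rightarrow> int
  list list \<Rightarrow> bool" where
  "inverse_ok d T ls k D W \<longleftrightarrow>
    (let V = map (vec_at T) (filter (standard ls) (monomials 1 (d div 2) k));
         n = length (class_list d k); S = scalar_mat n D
     in D \<noteq> 0 \<and> list_all (has_length n) W \<and> mat_mul n V W = S \<and> mat_mul n W V = S)"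

fun inverses_ok :: "nat \<Rightarrow> (nat list \<times> int list) list list \<Rightarrow> nat list list \<Rightarrow> nat \<Rightarrow>
  (int \<times> int list list) list \<Rightarrow> bool" where
  "inverses_ok d T ls k [] \<longleftrightarrow> k = d"
| "inverses_ok d T ls k ((D, W) # X) \<longleftrightarrow> inverse_ok d T ls k D W \<and> inverses_ok d T ls (Suc k) X"

definition values_ok :: "nat \<Rightarrow> term_list list \<Rightarrow> nat list list \<Rightarrow> (int \<times> int list list) list \<Rightarrow> bool" where
  "values_ok d Rs ls X \<longleftrightarrow>
    (let T = value_tables d in list_all (relation_ok d T) Rs \<and> inverses_ok d T ls 0 X)"

fun term_coeff :: "term_list \<Rightarrow> nat list \<Rightarrow> int" where
  "term_coeff [] e = 0"
| "term_coeff ((c, e') # l) e = (if e = e' then c + term_coeff l e else term_coeff l e)"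

text \<open>
  The value of the functional with coefficients \<open>l\<close> on the product of the monomial \<open>q\<close> and the
  polynomial \<open>r\<close>.
\<close>

fun pairing :: "term_list \<Rightarrow> nat list \<Rightarrow> term_list \<Rightarrow> int" where
  "pairing l q [] = 0"
| "pairing l q ((c, e) # r) = c * term_coeff l (add_exps q e) + pairing l q r"

definition pairing_ok :: "term_list \<Rightarrow> term_list \<Rightarrow> bool \<Rightarrow> nat list \<Rightarrow> bool" where
  "pairing_ok l r b q \<longleftrightarrow> (pairing l q r = 0) = b"

text \<open>
  The functional \<open>l\<close> of degree \<open>k\<close> vanishes on all multiples of degree \<open>k\<close> of \<open>r\<close> by monomials, or,
  if \<open>b\<close> is false, on none. The second case is applied to \<open>r\<close> of degree \<open>k\<close> only, where the only
  multiple is \<open>r\<close> itself.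
\<close>

definition relation_pairings_ok :: "nat \<Rightarrow> nat \<Rightarrow> term_list \<Rightarrow> term_list \<Rightarrow> bool \<Rightarrow> bool" where
  "relation_pairings_ok m k l r b \<longleftrightarrow>
    (if deg r \<le> k then list_all (pairing_ok l r b) (monomials 1 m (k - deg r)) else True)"

fun functional_ok :: "nat \<Rightarrow> nat \<Rightarrow> nat \<Rightarrow> term_list \<Rightarrow> nat \<Rightarrow> term_list list \<Rightarrow> bool" where
  "functional_ok m k i l j [] \<longleftrightarrow> True"
| "functional_ok m k i l j (r # rs) \<longleftrightarrow> relation_pairings_ok m k l r (i \<noteq> j) \<and> functional_ok m k i l
  (Suc j) rs"

fun functionals_ok :: "nat \<Rightarrow> term_list list \<Rightarrow> nat \<Rightarrow> term_list list \<Rightarrow> term_list list \<Rightarrow> bool" where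
  "functionals_ok m Rs i [] [] \<longleftrightarrow> True"
| "functionals_ok m Rs i (r # rs) (l # ls) \<longleftrightarrow>
    list_all (term_ok m (deg r)) l \<and> functional_ok m (deg r) i l 0 Rs \<and> functionals_ok m Rs
      (Suc i) rs ls"
| "functionals_ok m Rs i _ _ \<longleftrightarrow> False"

lemma functional_ok_nth:
  "functional_ok m k i l j rs \<Longrightarrow> n < length rs \<Longrightarrow> relation_pairings_ok m k l (rs ! n) (i \<noteq> j + n)"
proof (induction rs arbitrary: j n)
  case (Cons r rs)
  then show ?case using Cons.IH[of "Suc j"] by (cases n) auto
qed simp

lemma functionals_ok_nth:
  "functionals_ok m Rs i rs ls \<Longrightarrow> n < length rs \<Longrightarrow>
    n < length ls \<and> list_all (term_ok m (deg (rs ! n))) (ls ! n) \<and> functional_ok m (deg (rs ! n))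
      (i + n) (ls ! n) 0 Rs"
proof (induction m Rs i rs ls arbitrary: n rule: functionals_ok.induct)
  case (2 m Rs i r rs l ls)
  then show ?case by (cases n) auto
qed auto

lemma inverses_ok_nth:
  "inverses_ok d T ls k X \<Longrightarrow> k \<le> d \<Longrightarrow> k + length X = d \<and>
    (\<forall>n < length X. inverse_ok d T ls (k + n) (fst (X ! n)) (snd (X ! n)))"
proof (induction d T ls k X rule: inverses_ok.induct)
  case (2 d T ls k D W X)
  from "2.prems" have ok: "inverse_ok d T ls k D W" "inverses_ok d T ls (Suc k) X" by simp_all
  have *: "inverses_ok d T ls k' X \<Longrightarrow> k' + length X = d" for k'
    by (induction d T ls k' X rule: inverses_ok.induct) auto
  from *[OF ok(2)] have "k \<noteq> d" by auto
  then have "Suc k \<le> d" using "2.prems" by simp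
  note IH = "2.IH"[OF ok(2) this]
  show ?case
  proof (intro conjI allI impI)
    show "k + length ((D, W) # X) = d" using IH by simp
    fix n assume "n < length ((D, W) # X)"
    then show "inverse_ok d T ls (k + n) (fst (((D, W) # X) ! n)) (snd (((D, W) # X) ! n))"
      using IH ok(1) by (cases n) auto
  qed
qed simp

lemma poly_of_Nil: "poly_of [] = 0"
  by (simp add: poly_of_def)

lemma poly_of_Cons: "poly_of ((c, e) # t) = scale (of_int c) (monom e) + poly_of t"
  by (simp add: poly_of_def)

lemma poly_of_append: "poly_of (t @ u) = poly_of t + poly_of u"
  by (simp add: poly_of_def)

lemma monom_closed: "length e = m \<Longrightarrow> monom e \<in> carrier (polynomial_algebra m)"
  using keys_nth_subset[of e] by (auto simp: monom_def intro: polynomial_single_closed)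

lemma poly_of_closed:
  "(\<And>t. t \<in> set ts \<Longrightarrow> length (snd t) = m) \<Longrightarrow> poly_of ts \<in> carrier (polynomial_algebra m)"
proof (induction ts)
  case (Cons t ts)
  obtain c e where t: "t = (c, e)" by (cases t)
  have "length e = m" using Cons.prems[of t] t by simp
  moreover have "poly_of ts \<in> carrier (polynomial_algebra m)" using Cons by simp
  ultimately show ?case
    by (simp add: t poly_of_Cons polynomial_add_closed polynomial_scale_closed monom_closed)
qed (simp add: poly_of_Nil polynomial_zero_closed)

lemma eval_poly_monom: "eval_poly d (monom e) = eval_monomial d (Poly_Mapping.nth e)"
  by (simp add: monom_def eval_poly_single scale_one)

lemma eval_poly_zero: "eval_poly d 0 = 0"
  by (simp add: eval_poly_def)

lemma eval_poly_sum: "eval_poly d (sum f I) = (\<Sum>i\<in>I. eval_poly d (f i))"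
  by (induction I rule: infinite_finite_induct) (simp_all add: eval_poly_zero eval_poly_add)

lemma has_vec_comb:
  assumes "k < d" "\<And>t. t \<in> set ts \<Longrightarrow> length (snd t) = d div 2 \<and> wt (snd t) = k"
  shows "has_vec d (eval_poly d (poly_of ts)) k (comb (value_tables d) (length (class_list d k)) ts)"
  using assms(2)
proof (induction ts)
  case Nil
  then show ?case by (simp add: poly_of_Nil eval_poly_zero has_vec_zero)
next
  case (Cons t ts)
  obtain c e where t: "t = (c, e)" by (cases t)
  then have e: "length e = d div 2" "wt e = k" using Cons.prems[of t] by simp_all
  have "has_vec d (eval_poly d (monom e)) k (vec_at (value_tables d) e)"
    using has_vec_value_tables[of e d] e assms(1) by (simp add: eval_poly_monom)
  then show ?case
    using Cons by (simp add: t poly_of_Cons eval_poly_add eval_poly_scale has_vec_axpy)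
qed

lemma relation_ok_sound:
  assumes "homogeneous_ok (d div 2) r" "relation_ok d (value_tables d) r" "d > 0"
  shows "eval_poly d (poly_of r) = 0"
proof -
  have r: "length (snd t) = d div 2 \<and> wt (snd t) = deg r" if "t \<in> set r" for t
    using assms(1) that by (auto simp: homogeneous_ok_def term_ok_def list_all_iff)
  show ?thesis
  proof (cases "deg r < d")
    case True
    have "list_all ((=) 0) (comb (value_tables d) (length (class_list d (deg r))) r)"
      using assms(2) True by (simp add: relation_ok_def)
    then show ?thesis
      by (intro has_vec_eq_zero[OF has_vec_comb[OF True r] _ assms(3)]) (auto simp: list_all_iff)
  next
    case False
    have "eval_poly d (poly_of ts) = 0" if "set ts \<subseteq> set r" for ts
      using that
    proof (induction ts)
      case (Cons t ts)
      obtain c e where t: "t = (c, e)" by (cases t)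
      then have "eval_monomial d (Poly_Mapping.nth e) = 0"
        using r[of t] Cons.prems False by (intro eval_monomial_top[OF assms(3)]) auto
      then have "scale (of_int c) (eval_monomial d (Poly_Mapping.nth e)) = 0"
        by (intro poly_mapping_eqI) simp
      then show ?case using Cons by (simp add: t poly_of_Cons eval_poly_add eval_poly_scale
        eval_poly_monom)
    qed (simp add: poly_of_Nil eval_poly_zero)
    then show ?thesis by simp
  qed
qed

lemma divides_split:
  "length l = length e \<Longrightarrow> divides l e \<Longrightarrow> \<exists>q. length q = length e \<and> e = add_exps q l"
proof (induction l e rule: divides.induct)
  case (1 a as b bs)
  then obtain q where "length q = length bs" "bs = add_exps q as" by auto
  then show ?case using 1 by (intro exI[of _ "(b - a) # q"]) simp
qed auto

lemma weight_add_exps: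
  "length a = length b \<Longrightarrow> weight ws (add_exps a b) = weight ws a + weight ws b"
proof (induction a b arbitrary: ws rule: add_exps.induct)
  case (1 a as b bs)
  then show ?case by (cases ws) (auto simp: distrib_left)
qed auto

lemma divides_trans_add: "length q = length e \<Longrightarrow> length l = length e \<Longrightarrow> divides l e \<Longrightarrow> divides l
  (add_exps q e)"
proof (induction l e arbitrary: q rule: divides.induct)
  case (1 a as b bs)
  then show ?case by (cases q) auto
qed auto

lemma length_axpy: "length v = n \<Longrightarrow> length w = n \<Longrightarrow> length (axpy c v w) = n"
  by (induction c v w arbitrary: n rule: axpy.induct) auto

lemma nth_axpy: "j < length v \<Longrightarrow> j < length w \<Longrightarrow> axpy c v w ! j = c * v ! j + w ! j"
proof (induction c v w arbitrary: j rule: axpy.induct)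
  case (1 c x xs y ys)
  then show ?case by (cases j) auto
qed auto

lemma row_comb_nth:
  assumes "\<And>r. r \<in> set rs \<Longrightarrow> length r = n" "length cs = length rs"
  shows "length (row_comb n cs rs) = n"
    "j < n \<Longrightarrow> row_comb n cs rs ! j = (\<Sum>t<length rs. cs ! t * rs ! t ! j)"
proof -
  have "length (row_comb n cs rs) = n \<and> (\<forall>j<n. row_comb n cs rs ! j =
    (\<Sum>t<length rs. cs ! t * rs ! t ! j))"
    using assms
  proof (induction n cs rs rule: row_comb.induct)
    case (1 n c cs r rs)
    then have IH: "length (row_comb n cs rs) = n" "\<And>j. j < n \<Longrightarrow> row_comb n cs rs ! j =
      (\<Sum>t<length rs. cs ! t * rs ! t ! j)"
      and r: "length r = n" by simp_all
    then show ?case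
      by (simp add: length_axpy nth_axpy sum.lessThan_Suc_shift del: sum.lessThan_Suc)
  qed auto
  then show "length (row_comb n cs rs) = n"
    "j < n \<Longrightarrow> row_comb n cs rs ! j = (\<Sum>t<length rs. cs ! t * rs ! t ! j)" by auto
qed

lemma scalar_mat_nth: "i < n \<Longrightarrow> j < n \<Longrightarrow> scalar_mat n D ! i ! j = (if i = j then D else 0)"
  by (simp add: scalar_mat_def)

lemma mat_mul_scalar_entry:
  assumes "mat_mul n A B = scalar_mat n D" "length B = n" "length A = n"
    and "\<And>r. r \<in> set A \<Longrightarrow> length r = n" "\<And>r. r \<in> set B \<Longrightarrow> length r = n" "i < n" "j < n"
  shows "(\<Sum>t<n. A ! i ! t * B ! t ! j) = (if i = j then D else 0)"
proof -
  have "scalar_mat n D ! i = row_comb n (A ! i) B"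
    using assms(1,3,6) by (simp add: mat_mul_def times_mat_def flip: assms(1))
  then have "scalar_mat n D ! i ! j = (\<Sum>t<n. A ! i ! t * B ! t ! j)"
    using row_comb_nth(2)[of B n "A ! i" j] assms by simp
  then show ?thesis using assms(6,7) by (simp add: scalar_mat_nth)
qed

lemma monomial_norm_eq_0_iff: "monomial_norm u = 0 \<longleftrightarrow> u = 0"
proof
  assume "monomial_norm u = 0"
  then have "Poly_Mapping.lookup u i = 0" for i
    by (cases "i \<in> Poly_Mapping.keys u") (auto simp: monomial_norm_def in_keys_iff)
  then show "u = 0" by (intro poly_mapping_eqI) simp
qed (simp add: monomial_norm_def)

lemma polynomial_a_inv:
  assumes "p \<in> carrier (polynomial_algebra m)"
  shows "\<ominus>\<^bsub>polynomial_algebra m\<^esub> p = - p"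
proof -
  interpret cring "polynomial_algebra m" by (rule polynomial_algebra_cring)
  show ?thesis using assms by (intro minus_equality) (simp_all add: polynomial_uminus_closed)
qed

lemma polynomial_idealI:
  assumes sub: "I \<subseteq> carrier (polynomial_algebra m)" and zero: "0 \<in> I"
    and add: "\<And>p q. p \<in> I \<Longrightarrow> q \<in> I \<Longrightarrow> p + q \<in> I"
    and mult: "\<And>p q. p \<in> I \<Longrightarrow> q \<in> carrier (polynomial_algebra m) \<Longrightarrow> q * p \<in> I"
  shows "ideal I (polynomial_algebra m)"
proof -
  interpret cring "polynomial_algebra m" by (rule polynomial_algebra_cring)
  show ?thesis
  proof (rule idealI)
    show "ring (polynomial_algebra m)" by (rule ring_axioms)
    show "subgroup I (add_monoid (polynomial_algebra m))"
    proof (rule add.subgroupI)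
      fix p assume p: "p \<in> I"
      have "(- 1) * p \<in> I" using mult[OF p polynomial_uminus_closed[OF polynomial_one_closed]] .
      then show "\<ominus>\<^bsub>polynomial_algebra m\<^esub> p \<in> I" using p sub by (simp add: polynomial_a_inv subset_iff)
    qed (use sub zero add in auto)
  qed (use mult in \<open>simp_all add: mult.commute\<close>)
qed

text \<open>
  The constant monomial is the only one of norm zero.
\<close>

lemma positive_ideal_ideal: "ideal (positive_ideal m) (polynomial_algebra m)"
proof (rule polynomial_idealI)
  fix p q assume p: "p \<in> positive_ideal m" and q: "q \<in> carrier (polynomial_algebra m)"
  have "monomial_norm u > 0" if u: "u \<in> Poly_Mapping.keys (q * p)" for u
  proof (rule ccontr)
    assume "\<not> monomial_norm u > 0"
    then have "u = 0" using monomial_norm_eq_0_iff by auto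
    moreover obtain a b where ab: "u = a + b" "b \<in> Poly_Mapping.keys p" using u keys_mult[of q p]
      by blast
    ultimately have "Poly_Mapping.lookup a i + Poly_Mapping.lookup b i = 0" for i
      by (metis lookup_add lookup_zero)
    then have "b = 0" by (intro poly_mapping_eqI) simp
    then show False using ab(2) p monomial_norm_eq_0_iff[of 0] by (auto simp: positive_ideal_def)
  qed
  then show "q * p \<in> positive_ideal m" using p q by (simp add: positive_ideal_def polynomial_mult_closed)
next
  fix p q assume "p \<in> positive_ideal m" "q \<in> positive_ideal m"
  then show "p + q \<in> positive_ideal m"
    using keys_add[of p q] by (auto simp: positive_ideal_def polynomial_add_closed)
qed (auto simp: positive_ideal_def polynomial_zero_closed)

lemma class_val_sum: "class_val d (sum f I) M = (\<Sum>i\<in>I. class_val d (f i) M)"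
  by (induction I rule: infinite_finite_induct) (simp_all add: class_val_zero class_val_add)

lemma distinct_monomials: "distinct (monomials w m k)"
  by (induction m arbitrary: w k) (simp_all add: distinct_concat_Cons del: upt_Suc)

definition certificate_ok :: "nat \<Rightarrow> term_list list \<Rightarrow> term_list list \<Rightarrow> nat list \<Rightarrow>
    (int \<times> int list list) list \<Rightarrow> term_list list \<Rightarrow> bool" where
  "certificate_ok d Rs Gs ws inverses functionals \<longleftrightarrow>
    0 < d \<and> list_all (homogeneous_ok (d div 2)) (Rs @ Gs) \<and> values_ok d Rs (leads Gs) inverses \<and>
    list_all (lead_ok ws) Gs \<and>
    list_all (degree_divisible (d div 2) (leads Gs)) [d..<d + d div 2] \<and>
    functionals_ok (d div 2) Rs 0 Rs functionals"

text \<open>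
  The relations are \<open>Rs\<close>, and \<open>Gs\<close> is a Groebner basis of the ideal generated by them.
\<close>

locale presentation_certificate =
  fixes d :: nat and Rs Gs :: "term_list list" and ws :: "nat list"
    and inverses :: "(int \<times> int list list) list" and functionals :: "term_list list"
  assumes ok: "certificate_ok d Rs Gs ws inverses functionals"
    and basis: "\<And>g. g \<in> set Gs \<Longrightarrow> poly_of g \<in> genideal (polynomial_algebra (d div 2)) (poly_of ` set Rs)"
begin

lemma d_pos: "d > 0"
  and homogeneous: "list_all (homogeneous_ok (d div 2)) (Rs @ Gs)"
  and vals: "values_ok d Rs (leads Gs) inverses"
  and lead: "list_all (lead_ok ws) Gs"
  and top_degrees: "list_all (degree_divisible (d div 2) (leads Gs)) [d..<d + d div 2]"
  and functionals: "functionals_ok (d div 2) Rs 0 Rs functionals"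
  using ok by (simp_all only: certificate_ok_def)

abbreviation "m \<equiv> d div 2"
abbreviation "P \<equiv> polynomial_algebra m"
abbreviation "A \<equiv> invariant_algebra d"
abbreviation "R \<equiv> poly_of ` set Rs"
abbreviation "J \<equiv> genideal P R"
abbreviation "T \<equiv> value_tables d"

definition B :: "nat list set" where
  "B = {e. length e = m \<and> standard (leads Gs) e}"

lemma term_of_relation:
  "r \<in> set (Rs @ Gs) \<Longrightarrow> t \<in> set r \<Longrightarrow> length (snd t) = m \<and> wt (snd t) = deg r"
  using homogeneous by (auto simp: list_all_iff homogeneous_ok_def term_ok_def)

lemma relation_nonempty: "r \<in> set (Rs @ Gs) \<Longrightarrow> r \<noteq> []"
  using homogeneous by (auto simp: list_all_iff homogeneous_ok_def)

lemma R_closed: "R \<subseteq> carrier P"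
  using term_of_relation by (auto intro!: poly_of_closed)

lemma J_ideal: "ideal J P"
proof -
  interpret cring P by (rule polynomial_algebra_cring)
  show ?thesis by (rule genideal_ideal[OF R_closed])
qed

lemma R_subset_J: "R \<subseteq> J"
proof -
  interpret cring P by (rule polynomial_algebra_cring)
  show ?thesis by (rule genideal_self[OF R_closed])
qed

lemma J_minimal: "ideal K P \<Longrightarrow> R \<subseteq> K \<Longrightarrow> J \<subseteq> K"
proof -
  interpret cring P by (rule polynomial_algebra_cring)
  show "ideal K P \<Longrightarrow> R \<subseteq> K \<Longrightarrow> J \<subseteq> K" by (rule genideal_minimal)
qed

lemma J_add: "p \<in> J \<Longrightarrow> q \<in> J \<Longrightarrow> p + q \<in> J"
  using additive_subgroup.a_closed[OF ideal.axioms(1)[OF J_ideal]] by simp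

lemma J_zero: "0 \<in> J"
  using additive_subgroup.zero_closed[OF ideal.axioms(1)[OF J_ideal]] by simp

lemma J_mult: "p \<in> J \<Longrightarrow> q \<in> carrier P \<Longrightarrow> q * p \<in> J"
  using ideal.I_l_closed[OF J_ideal] by simp

lemma const_closed: "Poly_Mapping.single 0 c \<in> carrier P"
  by (rule polynomial_single_closed) simp

lemma J_scale: "p \<in> J \<Longrightarrow> scale c p \<in> J"
  unfolding scale_eq_mult by (rule J_mult[OF _ const_closed])

lemma kernel_ideal: "ideal {p \<in> carrier P. eval_poly d p = 0} P"
proof (rule polynomial_idealI)
  fix p q assume *: "p \<in> {p \<in> carrier P. eval_poly d p = 0}" "q \<in> carrier P"
  have "eval_poly d (q * p) = graded_mult d (eval_poly d p) (eval_poly d q)"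
    by (simp add: eval_poly_mult mult.commute[of q])
  also have "\<dots> = graded_mult d (scale 0 (eval_poly d p)) (eval_poly d q)" using *
    by (simp add: scale_zero)
  also have "\<dots> = scale 0 (graded_mult d (eval_poly d p) (eval_poly d q))"
    by (rule invariant_mult_scale_left[OF eval_poly_closed eval_poly_closed])
  also have "\<dots> = 0" by (rule scale_zero)
  finally show "q * p \<in> {p \<in> carrier P. eval_poly d p = 0}" using * by (simp add: polynomial_mult_closed)
qed (auto simp: eval_poly_add eval_poly_zero polynomial_add_closed polynomial_zero_closed)

lemma relations_hold: "r \<in> set Rs \<Longrightarrow> eval_poly d (poly_of r) = 0"
  using vals homogeneous d_pos
  by (intro relation_ok_sound) (auto simp: values_ok_def Let_def list_all_iff)

lemma J_subset_kernel: "J \<subseteq> {p \<in> carrier P. eval_poly d p = 0}"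
  using R_closed relations_hold by (intro J_minimal kernel_ideal) auto

lemma divisible_iff: "divisible (leads Gs) e \<longleftrightarrow> (\<exists>g\<in>set Gs. divides (snd (last g)) e)"
  by (auto simp: divisible_def leads_def list_ex_iff)

lemma lead_length: "g \<in> set Gs \<Longrightarrow> length (snd (last g)) = m"
  using term_of_relation[of g "last g"] relation_nonempty[of g] by simp

lemma divisible_add_exps:
  "length e = m \<Longrightarrow> length q = m \<Longrightarrow> divisible (leads Gs) e \<Longrightarrow> divisible (leads Gs) (add_exps q e)"
  unfolding divisible_iff using divides_trans_add lead_length by metis

text \<open>
  The variables have norm at most \<open>m\<close>. So a monomial of norm at least \<open>d + m\<close> remains of norm at
  least \<open>d\<close> when one variable is removed, and it suffices to check the degrees from \<open>d\<close> to
  \<open>d + m - 1\<close>.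
\<close>

lemma divisible_high_degree:
  "length e = m \<Longrightarrow> wt e \<ge> d \<Longrightarrow> divisible (leads Gs) e"
proof (induction "wt e" arbitrary: e rule: less_induct)
  case less
  show ?case
  proof (cases "wt e < d + m")
    case True
    then have "degree_divisible m (leads Gs) (wt e)" using top_degrees less.prems
      by (simp add: list_all_iff)
    then show ?thesis using less.prems by (auto simp: degree_divisible_def list_all_iff set_monomials)
  next
    case False
    obtain i e' where s: "split_var e = (i, e')" by (cases "split_var e")
    then have e': "length e' = m" "i < m" "wt e = wt e' + (i + 1)" "Poly_Mapping.nth e
      = Poly_Mapping.single i 1 + Poly_Mapping.nth e'"
      using split_var[OF s, of 1] False less.prems d_pos by simp_all
    have "divisible (leads Gs) e'" using less.hyps[of e'] e' False by simp
    moreover define q where "q = (replicate m (0 :: nat))[i := 1]"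
    have "e = add_exps q e'"
    proof (rule nth_equalityI)
      show "length e = length (add_exps q e')" using e' less.prems by (simp add: q_def length_add_exps)
      fix j assume "j < length e"
      then have "j < m" using less.prems by simp
      have "Poly_Mapping.lookup (Poly_Mapping.nth e) j = Poly_Mapping.lookup
        (Poly_Mapping.single i 1 + Poly_Mapping.nth e') j"
        by (simp only: e'(4))
      then show "e ! j = add_exps q e' ! j"
        using \<open>j < m\<close> e'(1-3) less.prems
        by (simp add: q_def add_exps_eq lookup_add lookup_single when_def nth_default_def
          nth_list_update split: if_splits)
    qed
    ultimately show ?thesis using divisible_add_exps[of e' q] e' by (simp add: q_def)
  qed
qed

lemma B_degree: "b \<in> B \<Longrightarrow> wt b < d"
  using divisible_high_degree[of b] by (force simp: B_def standard_def)

lemma B_eq: "B = (\<Union>k<d. set (filter (standard (leads Gs)) (monomials 1 m k)))"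
  using B_degree by (auto simp: B_def set_monomials)

lemma B_finite: "finite B"
  unfolding B_eq by simp

definition reducible :: "rat_mpoly \<Rightarrow> bool" where
  "reducible p \<longleftrightarrow> (\<exists>j\<in>J. \<exists>c. p = j + (\<Sum>b\<in>B. scale (c b) (monom b)))"

lemma reducible_J: "p \<in> J \<Longrightarrow> reducible p"
  unfolding reducible_def by (intro bexI[of _ p] exI[of _ "\<lambda>_. 0"]) (simp_all add: scale_zero)

lemma reducible_add:
  assumes "reducible p" "reducible q" shows "reducible (p + q)"
proof -
  obtain j c j' c' where "j \<in> J" "p = j + (\<Sum>b\<in>B. scale (c b) (monom b))"
      "j' \<in> J" "q = j' + (\<Sum>b\<in>B. scale (c' b) (monom b))"
    using assms unfolding reducible_def by blast
  then have "p + q = (j + j') + (\<Sum>b\<in>B. scale (c b + c' b) (monom b))" "j + j' \<in> J"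
    by (simp_all add: scale_add_left sum.distrib J_add)
  then show ?thesis unfolding reducible_def
    by (intro bexI[of _ "j + j'"] exI[of _ "\<lambda>b. c b + c' b"])
qed

lemma scale_sum: "scale a (sum f I) = (\<Sum>i\<in>I. scale a (f i))"
proof (induction I rule: infinite_finite_induct)
  case (insert x F)
  then show ?case by (simp add: scale_add_right)
qed (auto intro: poly_mapping_eqI)

lemma reducible_scale:
  assumes "reducible p" shows "reducible (scale a p)"
proof -
  obtain j c where "j \<in> J" "p = j + (\<Sum>b\<in>B. scale (c b) (monom b))"
    using assms unfolding reducible_def by blast
  then have "scale a p = scale a j + (\<Sum>b\<in>B. scale (a * c b) (monom b))" "scale a j \<in> J"
    by (simp_all only: scale_add_right scale_sum scale_scale J_scale)
  then show ?thesis unfolding reducible_def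
    by (intro bexI[of _ "scale a j"] exI[of _ "\<lambda>b. a * c b"])
qed

lemma monom_times_poly_of:
  assumes "\<And>t. t \<in> set ts \<Longrightarrow> length (snd t) = length q"
  shows "monom q * poly_of ts = poly_of (map (\<lambda>(c, e). (c, add_exps q e)) ts)"
  using assms
proof (induction ts)
  case (Cons t ts)
  obtain c e where t: "t = (c, e)" by (cases t)
  have "monom q * scale (of_int c) (monom e) = scale (of_int c) (monom (add_exps q e))"
    using Cons.prems[of t] by (simp add: t scale_eq_mult mult.left_commute monom_mult)
  then show ?case using Cons by (simp add: t poly_of_Cons distrib_left)
qed (simp add: poly_of_Nil)

text \<open>
  Division by the Groebner basis: a nonstandard monomial is a multiple of a leading monomial, and
  modulo the ideal it is a combination of monomials of smaller weight.
\<close>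

lemma reducible_monom: "length e = m \<Longrightarrow> reducible (monom e)"
proof (induction "weight ws e" arbitrary: e rule: less_induct)
  case less
  show ?case
  proof (cases "standard (leads Gs) e")
    case True
    then have "e \<in> B" using less.prems by (simp add: B_def)
    have "scale (if b = e then 1 else 0) (monom b) = (if b = e then monom e else 0)" for b
      by (simp add: scale_one scale_zero)
    then have "(\<Sum>b\<in>B. scale (if b = e then 1 else 0) (monom b)) = monom e"
      using \<open>e \<in> B\<close> B_finite by simp
    then show ?thesis unfolding reducible_def
      by (intro bexI[of _ 0] exI[of _ "\<lambda>b. if b = e then 1 else 0"]) (simp_all add: J_zero)
  next
    case False
    then obtain g where g: "g \<in> set Gs" "divides (snd (last g)) e"
      by (auto simp: standard_def divisible_iff)
    define c0 l where "c0 = fst (last g)" and "l = snd (last g)"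
    have l: "length l = m" using lead_length[OF g(1)] by (simp add: l_def)
    obtain q where q: "length q = m" "e = add_exps q l"
      using divides_split[of l e] g(2) l less.prems by (auto simp: l_def)
    have lead_ok: "c0 \<noteq> 0" "\<And>t. t \<in> set (butlast g) \<Longrightarrow> weight ws (snd t) < weight ws l"
      using lead g(1) by (auto simp: list_all_iff lead_ok_def lighter_def c0_def l_def)
    have len: "length (snd t) = m" if "t \<in> set g" for t using term_of_relation[of g t] g(1) that by simp
    have g_eq: "g = butlast g @ [(c0, l)]"
      using relation_nonempty[of g] g(1) by (simp add: c0_def l_def)
    have "poly_of g = poly_of (butlast g) + scale (of_int c0) (monom l)"
      by (subst g_eq) (simp add: poly_of_append poly_of_Cons poly_of_Nil)
    then have eq: "scale (of_int c0) (monom e) = monom q * poly_of g + scale (- 1)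
      (monom q * poly_of (butlast g))"
    proof -
      have "scale (- 1) p = - p" for p :: rat_mpoly by (rule poly_mapping_eqI) simp
      moreover have "monom q * scale (of_int c0) (monom l) = scale (of_int c0) (monom e)"
        using l q by (simp add: scale_eq_mult mult.left_commute monom_mult)
      ultimately show ?thesis using \<open>poly_of g = _\<close> by (simp add: distrib_left)
    qed
    have tail: "reducible (poly_of (map (\<lambda>(c, e). (c, add_exps q e)) ts))"
      if "set ts \<subseteq> set (butlast g)" for ts
      using that
    proof (induction ts)
      case Nil
      then show ?case by (simp add: poly_of_Nil reducible_J J_zero)
    next
      case (Cons t ts)
      obtain c t' where t: "t = (c, t')" by (cases t)
      have "length t' = m" using len[of t] Cons.prems t by (auto dest: in_set_butlastD)
      moreover have "weight ws (add_exps q t') < weight ws e"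
        using lead_ok(2)[of t] Cons.prems t \<open>length t' = m\<close> q l by (simp add: weight_add_exps)
      ultimately have "reducible (monom (add_exps q t'))"
        using less.hyps q(1) by (simp add: length_add_exps)
      then show ?case using Cons by (simp add: t poly_of_Cons reducible_add reducible_scale)
    qed
    have "reducible (monom q * poly_of (butlast g))"
      using tail[of "butlast g"] len q(1) by (subst monom_times_poly_of) (auto dest: in_set_butlastD)
    moreover have "reducible (monom q * poly_of g)"
      using basis[OF g(1)] q(1) by (intro reducible_J J_mult monom_closed)
    ultimately have "reducible (scale (of_int c0) (monom e))" unfolding eq
      by (intro reducible_add reducible_scale)
    then have "reducible (scale (1 / of_int c0) (scale (of_int c0) (monom e)))" by (rule reducible_scale)
    then show ?thesis using lead_ok(1) by (simp add: scale_scale scale_one)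
  qed
qed

lemma reducible_polynomial:
  assumes "p \<in> carrier P"
  shows "reducible p"
proof -
  have "reducible (\<Sum>u\<in>U. Poly_Mapping.single u (coeff p u))" if "finite U" "U \<subseteq> Poly_Mapping.keys p"
    for U
    using that
  proof (induction U)
    case (insert u U)
    have "Poly_Mapping.keys u \<subseteq> {..<m}" using assms insert.prems
      by (auto simp: polynomial_algebra_carrier)
    then have "Poly_Mapping.single u (coeff p u) = scale (coeff p u) (monom (map
      (Poly_Mapping.lookup u) [0..<m]))"
      by (simp add: monom_def nth_exponents scale_single)
    then have "reducible (Poly_Mapping.single u (coeff p u))"
      by (simp add: reducible_scale reducible_monom)
    then show ?case using insert by (simp add: reducible_add)
  qed (simp add: reducible_J J_zero)
  from this[of "Poly_Mapping.keys p"] show ?thesis by (simp add: sum_single_keys)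
qed

text \<open>
  The two matrix identities of the certificate, entry by entry. They also imply that there are as
  many standard monomials as cycle types in each norm.
\<close>

lemma standard_list:
  assumes "k < d"
  defines "Bk \<equiv> filter (standard (leads Gs)) (monomials 1 m k)"
  shows "\<exists>D W. D \<noteq> 0 \<and> length Bk = length (class_list d k) \<and>
    (\<forall>i<length Bk. \<forall>j<length Bk.
      (\<Sum>t<length Bk. vec_at T (Bk ! i) ! t * W ! t ! j) = (if i = j then D else 0)) \<and>
    (\<forall>i<length Bk. \<forall>j<length Bk.
      (\<Sum>t<length Bk. W ! i ! t * vec_at T (Bk ! t) ! j) = (if i = j then (D :: int) else 0))"
proof -
  let ?n = "length (class_list d k)" and ?V = "map (vec_at T) Bk"
  have "inverses_ok d T (leads Gs) 0 inverses" using vals by (simp add: values_ok_def Let_def)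
  from inverses_ok_nth[OF this] have "length inverses = d"
      "\<forall>n<length inverses. inverse_ok d T (leads Gs) n (fst (inverses ! n)) (snd (inverses ! n))"
        by simp_all
  then obtain D W where ok: "inverse_ok d T (leads Gs) k D W" using assms(1) by blast
  then have D: "D \<noteq> 0" and W: "\<And>r. r \<in> set W \<Longrightarrow> length r = ?n"
    and VW: "mat_mul ?n ?V W = scalar_mat ?n D" and WV: "mat_mul ?n W ?V = scalar_mat ?n D"
    by (auto simp: inverse_ok_def Let_def Bk_def list_all_iff has_length_def)
  have len: "length Bk = ?n" "length W = ?n"
    using arg_cong[OF VW, of length] arg_cong[OF WV, of length]
      by (simp_all add: mat_mul_def scalar_mat_def)
  have V: "length r = ?n" if "r \<in> set ?V" for r
  proof -
    obtain b where "b \<in> set Bk" "r = vec_at T b" using \<open>r \<in> set ?V\<close> by auto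
    then show ?thesis using has_vec_length[OF has_vec_value_tables[of b d]] assms(1)
      by (auto simp: Bk_def set_monomials)
  qed
  show ?thesis
  proof (intro exI[of _ D] exI[of _ W] conjI allI impI D len(1))
    fix i j assume ij: "i < length Bk" "j < length Bk"
    then show "(\<Sum>t<length Bk. vec_at T (Bk ! i) ! t * W ! t ! j) = (if i = j then D else 0)"
      using mat_mul_scalar_entry[OF VW len(2) _ V W, of i j] len(1) by simp
  next
    fix i j assume ij: "i < length Bk" "j < length Bk"
    show "(\<Sum>t<length Bk. W ! i ! t * vec_at T (Bk ! t) ! j) = (if i = j then D else 0)"
      using mat_mul_scalar_entry[OF WV _ len(2) W V, of i j] ij len(1) by simp
  qed
qed

lemma class_val_monom:
  assumes "length b = m" "wt b < d" "k < d" "t < length (class_list d k)"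
  shows "class_val d (eval_poly d (monom b)) (mset (class_list d k ! t)) =
    (if wt b = k then of_int (vec_at T b ! t) else 0)"
proof -
  have vec: "has_vec d (eval_poly d (monom b)) (wt b) (vec_at T b)"
    using has_vec_value_tables[OF assms(1,2)] by (simp add: eval_poly_monom)
  show ?thesis
  proof (cases "wt b = k")
    case True
    then have "map (\<lambda>\<mu>. class_val d (eval_poly d (monom b)) (mset \<mu>)) (class_list d k) ! t
      = map of_int (vec_at T b) ! t"
      using vec by (simp add: has_vec_def)
    then show ?thesis using assms(4) has_vec_length[OF vec] True by simp
  next
    case False
    then show ?thesis using vec assms(3,4) nth_mem unfolding has_vec_def by auto
  qed
qed

lemma sum_over_B:
  assumes "k < d" and zero: "\<And>b. b \<in> B \<Longrightarrow> wt b \<noteq> k \<Longrightarrow> f b = (0 :: rat)"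
  defines "Bk \<equiv> filter (standard (leads Gs)) (monomials 1 m k)"
  shows "(\<Sum>b\<in>B. f b) = (\<Sum>t<length Bk. f (Bk ! t))"
proof -
  have "distinct Bk" by (simp add: Bk_def distinct_monomials)
  then have bij: "bij_betw ((!) Bk) {..<length Bk} (set Bk)" by (intro bij_betw_nth) auto
  have "(\<Sum>b\<in>B. f b) = (\<Sum>b\<in>set Bk. f b)"
  proof (rule sum.mono_neutral_right[OF B_finite])
    show "set Bk \<subseteq> B" by (auto simp: Bk_def B_def set_monomials)
    show "\<forall>b\<in>B - set Bk. f b = 0" using zero by (auto simp: Bk_def B_def set_monomials)
  qed
  also have "\<dots> = (\<Sum>t<length Bk. f (Bk ! t))" by (rule sum.reindex_bij_betw[OF bij, symmetric])
  finally show ?thesis .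
qed

text \<open>
  Modulo \<open>J\<close>, the polynomial \<open>p\<close> is a combination of standard monomials. The values of this
  combination on the cycle types vanish, and applying the inverse matrix \<open>W\<close> shows that its
  coefficients vanish.
\<close>

lemma kernel_subset_J:
  assumes p: "p \<in> carrier P" "eval_poly d p = 0"
  shows "p \<in> J"
proof -
  obtain j c where j: "j \<in> J" "p = j + (\<Sum>b\<in>B. scale (c b) (monom b))"
    using reducible_polynomial[OF p(1)] unfolding reducible_def by blast
  have "eval_poly d j = 0" using J_subset_kernel j(1) by auto
  then have zero: "(\<Sum>b\<in>B. scale (c b) (eval_poly d (monom b))) = 0"
    using p(2) j(2) by (simp add: eval_poly_add eval_poly_sum eval_poly_scale)
  have "c b0 = 0" if b0: "b0 \<in> B" for b0
  proof -
    define k where "k = wt b0"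
    have k: "k < d" using B_degree[OF b0] by (simp add: k_def)
    define Bk where "Bk = filter (standard (leads Gs)) (monomials 1 m k)"
    obtain D W where DW: "D \<noteq> 0" "length Bk = length (class_list d k)"
      "\<forall>i<length Bk. \<forall>j<length Bk. (\<Sum>t<length Bk. vec_at T (Bk ! i) ! t * W ! t ! j) = (if i
        = j then D else 0)"
      "\<forall>i<length Bk. \<forall>j<length Bk. (\<Sum>t<length Bk. W ! i ! t * vec_at T (Bk ! t) ! j) = (if i
        = j then (D :: int) else 0)"
      using standard_list[OF k] unfolding Bk_def[symmetric] by blast
    let ?n = "length Bk"
    have "b0 \<in> set Bk" using b0 by (simp add: Bk_def B_def set_monomials k_def)
    then obtain i where i: "i < ?n" "Bk ! i = b0" by (auto simp: in_set_conv_nth)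
    have Bk: "Bk ! s \<in> B" "wt (Bk ! s) = k" if "s < ?n" for s
      using nth_mem[OF that] by (auto simp: Bk_def B_def set_monomials)
    (* only standard monomials of the norm of b0 have nonzero values on cycle types of this norm *)
    have row: "(\<Sum>s<?n. c (Bk ! s) * of_int (vec_at T (Bk ! s) ! t)) = 0" if t: "t < ?n" for t
    proof -
      let ?\<mu> = "mset (class_list d k ! t)"
      have val: "class_val d (eval_poly d (monom b)) ?\<mu> = (if wt b = k then of_int
        (vec_at T b ! t) else 0)"
        if "b \<in> B" for b
        using class_val_monom[of b k t] B_degree[OF that] that k t DW(2) by (simp add: B_def)
      have "0 = class_val d (\<Sum>b\<in>B. scale (c b) (eval_poly d (monom b))) ?\<mu>"
        by (simp add: zero class_val_zero)
      also have "\<dots> = (\<Sum>b\<in>B. c b * class_val d (eval_poly d (monom b)) ?\<mu>)"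
        by (simp add: class_val_sum class_val_scale)
      also have "\<dots> = (\<Sum>s<?n. c (Bk ! s) * class_val d (eval_poly d (monom (Bk ! s))) ?\<mu>)"
        unfolding Bk_def by (rule sum_over_B[OF k]) (simp add: val)
      also have "\<dots> = (\<Sum>s<?n. c (Bk ! s) * of_int (vec_at T (Bk ! s) ! t))"
        by (intro sum.cong refl) (simp add: val Bk)
      finally show ?thesis by simp
    qed
    have "0 = (\<Sum>t<?n. (\<Sum>s<?n. c (Bk ! s) * of_int (vec_at T (Bk ! s) ! t)) * of_int (W ! t ! i))"
      by (simp add: row)
    also have "\<dots> = (\<Sum>t<?n. \<Sum>s<?n. c (Bk ! s) * of_int (vec_at T (Bk ! s) ! t * W ! t ! i))"
      by (simp add: sum_distrib_right mult.assoc)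
    also have "\<dots> = (\<Sum>s<?n. \<Sum>t<?n. c (Bk ! s) * of_int (vec_at T (Bk ! s) ! t * W ! t ! i))"
      by (rule sum.swap)
    also have "\<dots> = (\<Sum>s<?n. c (Bk ! s) * of_int (\<Sum>t<?n. vec_at T (Bk ! s) ! t * W ! t ! i))"
      by (simp only: of_int_sum sum_distrib_left)
    also have "\<dots> = (\<Sum>s<?n. if s = i then c (Bk ! s) * of_int D else 0)"
      by (intro sum.cong refl) (simp add: DW(3) i)
    also have "\<dots> = c b0 * of_int D" using i by simp
    finally show "c b0 = 0" using DW(1) by simp
  qed
  then have "(\<Sum>b\<in>B. scale (c b) (monom b)) = 0" by (simp add: scale_zero)
  then show "p \<in> J" using j by simp
qed

lemma kernel_eq_J: "{p \<in> carrier P. eval_poly d p = 0} = J"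
  using J_subset_kernel kernel_subset_J by blast

text \<open>
  The rows of \<open>W / D\<close> are the coefficients of combinations of standard monomials that are the
  indicator functions of the cycle types.
\<close>

lemma degree_preimage:
  assumes k: "k < d"
  shows "\<exists>p\<in>carrier P. \<forall>j<d. \<forall>\<mu>\<in>set (class_list d j).
    class_val d (eval_poly d p) (mset \<mu>) = (if j = k then F \<mu> else 0)"
proof -
  define Bk where "Bk = filter (standard (leads Gs)) (monomials 1 m k)"
  obtain D W where DW: "D \<noteq> 0" "length Bk = length (class_list d k)"
      "\<forall>i<length Bk. \<forall>j<length Bk. (\<Sum>t<length Bk. vec_at T (Bk ! i) ! t * W ! t ! j) = (if i
        = j then D else 0)"
      "\<forall>i<length Bk. \<forall>j<length Bk. (\<Sum>t<length Bk. W ! i ! t * vec_at T (Bk ! t) ! j) = (if i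
        = j then (D :: int) else 0)"
    using standard_list[OF k] unfolding Bk_def[symmetric] by blast
  let ?n = "length Bk" and ?c = "\<lambda>i. F (class_list d k ! i) / of_int D"
  have Bk: "length (Bk ! s) = m" "wt (Bk ! s) = k" if "s < ?n" for s
    using nth_mem[OF that] by (auto simp: Bk_def set_monomials)
  define p where "p = (\<Sum>i<?n. \<Sum>s<?n. scale (?c i * of_int (W ! i ! s)) (monom (Bk ! s)))"
  have "p \<in> carrier P" unfolding p_def
    using Bk by (auto intro!: polynomial_sum_closed polynomial_scale_closed monom_closed)
  moreover have "class_val d (eval_poly d p) (mset \<mu>) = (if j = k then F \<mu> else 0)"
    if j: "j < d" and \<mu>: "\<mu> \<in> set (class_list d j)" for j \<mu>
  proof -
    obtain t where t: "t < length (class_list d j)" "\<mu> = class_list d j ! t" using \<mu>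
      by (auto simp: in_set_conv_nth)
    have "class_val d (eval_poly d p) (mset \<mu>) =
      (\<Sum>i<?n. \<Sum>s<?n. ?c i * of_int (W ! i ! s) * class_val d (eval_poly d (monom (Bk ! s))) (mset \<mu>))"
      by (simp add: p_def eval_poly_sum eval_poly_scale class_val_sum class_val_scale)
    also have "\<dots> = (\<Sum>i<?n. \<Sum>s<?n. ?c i * of_int (W ! i ! s) * (if k = j then of_int (vec_at T
      (Bk ! s) ! t) else 0))"
      using Bk k j t by (intro sum.cong refl) (simp add: class_val_monom)
    also have "\<dots> = (if j = k then F \<mu> else 0)"
    proof (cases "k = j")
      case True
      have "(\<Sum>i<?n. \<Sum>s<?n. ?c i * of_int (W ! i ! s) * (if k = j then of_int (vec_at T
        (Bk ! s) ! t) else 0))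
        = (\<Sum>i<?n. ?c i * of_int (\<Sum>s<?n. W ! i ! s * vec_at T (Bk ! s) ! t))"
        by (simp add: True sum_distrib_left mult.assoc)
      also have "\<dots> = (\<Sum>i<?n. if i = t then ?c i * of_int D else 0)"
      proof (intro sum.cong refl)
        fix i assume "i \<in> {..<?n}"
        then have "(\<Sum>s<?n. W ! i ! s * vec_at T (Bk ! s) ! t) = (if i = t then D else 0)"
          using t DW(2,4) True by simp
        then show "?c i * of_int (\<Sum>s<?n. W ! i ! s * vec_at T (Bk ! s) ! t) = (if i
          = t then ?c i * of_int D else 0)"
          by (simp only:) simp
      qed
      also have "\<dots> = F \<mu>" using t DW True by simp
      finally show ?thesis using True by simp
    qed simp
    finally show ?thesis .
  qed
  ultimately show ?thesis by blast
qed

lemma eval_poly_surjective: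
  assumes f: "f \<in> carrier A"
  shows "f \<in> eval_poly d ` carrier P"
proof -
  have "\<forall>k\<in>{..<d}. \<exists>p. p \<in> carrier P \<and> (\<forall>j<d. \<forall>\<mu>\<in>set (class_list d j).
    class_val d (eval_poly d p) (mset \<mu>) = (if j = k then class_val d f (mset \<mu>) else 0))"
    using degree_preimage[where F = "\<lambda>\<mu>. class_val d f (mset \<mu>)"] by blast
  then obtain p where p: "\<And>k. k < d \<Longrightarrow> p k \<in> carrier P"
    "\<And>k j \<mu>. k < d \<Longrightarrow> j < d \<Longrightarrow> \<mu> \<in> set (class_list d j) \<Longrightarrow>
      class_val d (eval_poly d (p k)) (mset \<mu>) = (if j = k then class_val d f (mset \<mu>) else 0)"
    by (auto dest!: bchoice)
  have "eval_poly d (\<Sum>k<d. p k) = f"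
  proof (rule eq_if_class_vals_eq[OF eval_poly_closed f d_pos])
    fix j \<mu> assume "j < d" "\<mu> \<in> set (class_list d j)"
    then show "class_val d (eval_poly d (\<Sum>k<d. p k)) (mset \<mu>) = class_val d f (mset \<mu>)"
      by (simp add: eval_poly_sum class_val_sum p(2))
  qed
  moreover have "(\<Sum>k<d. p k) \<in> carrier P" using p(1) by (intro polynomial_sum_closed) auto
  ultimately show ?thesis by blast
qed

section \<open>Minimality\<close>

lemma PJ_ideal: "ideal (positive_ideal m \<cdot>\<^bsub>P\<^esub> J) P"
proof -
  interpret cring P by (rule polynomial_algebra_cring)
  show ?thesis by (rule ideal_prod_is_ideal[OF positive_ideal_ideal J_ideal])
qed

lemma PJ_add: "p \<in> positive_ideal m \<cdot>\<^bsub>P\<^esub> J \<Longrightarrow> q \<in> positive_ideal m \<cdot>\<^bsub>P\<^esub> J \<Longrightarrow> p + q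
  \<in> positive_ideal m \<cdot>\<^bsub>P\<^esub> J"
  using additive_subgroup.a_closed[OF ideal.axioms(1)[OF PJ_ideal]] by simp

lemma J_sum: "(\<And>i. i \<in> I \<Longrightarrow> f i \<in> J) \<Longrightarrow> sum f I \<in> J"
  by (induction I rule: infinite_finite_induct) (auto intro: J_add J_zero)

text \<open>
  A multiple \<open>q r\<close> of a relation is congruent to \<open>q\<^sub>0 r\<close> modulo \<open>P\<^sub>+ \<cdot> J\<close>, where \<open>q\<^sub>0\<close> is the
  constant term of \<open>q\<close>.
\<close>

lemma relations_span:
  assumes "p \<in> J"
  shows "\<exists>c. p - (\<Sum>r\<in>R. scale (c r) r) \<in> positive_ideal m \<cdot>\<^bsub>P\<^esub> J"
proof -
  define K where "K = {p \<in> carrier P. \<exists>c. p - (\<Sum>r\<in>R. scale (c r) r) \<in> positive_ideal m \<cdot>\<^bsub>P\<^esub> J}"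
  have zero: "0 \<in> positive_ideal m \<cdot>\<^bsub>P\<^esub> J"
    using additive_subgroup.zero_closed[OF ideal.axioms(1)[OF PJ_ideal]] by simp
  have "ideal K P"
  proof (rule polynomial_idealI)
    show "0 \<in> K" unfolding K_def
      using zero by (auto intro!: exI[of _ "\<lambda>_. 0"] simp: polynomial_zero_closed scale_zero)
  next
    fix p q assume "p \<in> K" "q \<in> K"
    then obtain c c' where *: "p \<in> carrier P" "p - (\<Sum>r\<in>R. scale (c r) r) \<in> positive_ideal m \<cdot>\<^bsub>P\<^esub> J"
      "q \<in> carrier P" "q - (\<Sum>r\<in>R. scale (c' r) r) \<in> positive_ideal m \<cdot>\<^bsub>P\<^esub> J"
      by (auto simp: K_def)
    have eq: "p + q - (\<Sum>r\<in>R. scale (c r + c' r) r) =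
      (p - (\<Sum>r\<in>R. scale (c r) r)) + (q - (\<Sum>r\<in>R. scale (c' r) r))"
      by (simp add: scale_add_left sum.distrib)
    have "p + q - (\<Sum>r\<in>R. scale (c r + c' r) r) \<in> positive_ideal m \<cdot>\<^bsub>P\<^esub> J"
      unfolding eq by (rule PJ_add[OF *(2,4)])
    then show "p + q \<in> K" using *(1,3) unfolding K_def
      by (intro CollectI conjI polynomial_add_closed exI[of _ "\<lambda>r. c r + c' r"])
  next
    fix p q assume "p \<in> K" and q: "q \<in> carrier P"
    then obtain c where c: "p \<in> carrier P" "p - (\<Sum>r\<in>R. scale (c r) r) \<in> positive_ideal m \<cdot>\<^bsub>P\<^esub> J"
      by (auto simp: K_def)
    define a q' where "a = coeff q 0" and "q' = q - Poly_Mapping.single 0 a"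
    have "q' \<in> carrier P" unfolding q'_def by (rule polynomial_diff_closed[OF q const_closed])
    moreover have "u \<noteq> 0" if "u \<in> Poly_Mapping.keys q'" for u
      using that by (auto simp: q'_def a_def in_keys_iff lookup_minus)
    ultimately have q': "q' \<in> positive_ideal m"
      using monomial_norm_eq_0_iff by (auto simp: positive_ideal_def)
    have "(\<Sum>r\<in>R. scale (c r) r) \<in> J" using R_subset_J by (auto intro!: J_sum J_scale)
    then have 1: "q' * (\<Sum>r\<in>R. scale (c r) r) \<in> positive_ideal m \<cdot>\<^bsub>P\<^esub> J"
      using ideal_prod.prod[OF q', of _ J P] by simp
    have 2: "q * (p - (\<Sum>r\<in>R. scale (c r) r)) \<in> positive_ideal m \<cdot>\<^bsub>P\<^esub> J"
      using ideal.I_l_closed[OF PJ_ideal c(2) q] by simp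
    have "(\<Sum>r\<in>R. scale (a * c r) r) = scale a (\<Sum>r\<in>R. scale (c r) r)"
      by (simp add: scale_sum scale_scale)
    also have "\<dots> = (q - q') * (\<Sum>r\<in>R. scale (c r) r)" by (simp add: scale_eq_mult q'_def)
    finally have eq: "q * p - (\<Sum>r\<in>R. scale (a * c r) r) =
      q * (p - (\<Sum>r\<in>R. scale (c r) r)) + q' * (\<Sum>r\<in>R. scale (c r) r)"
      by (simp add: algebra_simps)
    have "q * p - (\<Sum>r\<in>R. scale (a * c r) r) \<in> positive_ideal m \<cdot>\<^bsub>P\<^esub> J"
      unfolding eq by (rule PJ_add[OF 2 1])
    then show "q * p \<in> K" using q c(1) unfolding K_def
      by (intro CollectI conjI polynomial_mult_closed exI[of _ "\<lambda>r. a * c r"])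
  qed (auto simp: K_def)
  moreover have "R \<subseteq> K"
  proof
    fix r assume r: "r \<in> R"
    have "(\<Sum>r'\<in>R. scale (if r' = r then 1 else 0) r') = (\<Sum>r'\<in>R. if r' = r then r else 0)"
      by (intro sum.cong refl) (simp add: scale_one scale_zero)
    also have "\<dots> = r" using r by simp
    finally have "r - (\<Sum>r'\<in>R. scale (if r' = r then 1 else 0) r') \<in> positive_ideal m \<cdot>\<^bsub>P\<^esub> J"
      using zero by simp
    then show "r \<in> K" using R_closed r unfolding K_def
      by (intro CollectI conjI exI[of _ "\<lambda>r'. if r' = r then 1 else 0"]) auto
  qed
  ultimately have "p \<in> K" using J_minimal assms by blast
  then show ?thesis by (simp add: K_def)
qed

definition functional :: "term_list \<Rightarrow> rat_mpoly \<Rightarrow> rat" where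
  "functional l p = (\<Sum>(c, e)\<leftarrow>l. of_int c * coeff p (Poly_Mapping.nth e))"

lemma functional_Nil: "functional [] p = 0"
  by (simp add: functional_def)

lemma functional_Cons: "functional ((c, e) # l) p = of_int c * coeff p
  (Poly_Mapping.nth e) + functional l p"
  by (simp add: functional_def)

lemma functional_add: "functional l (p + q) = functional l p + functional l q"
  by (induction l) (auto simp: functional_def lookup_add distrib_left)

lemma functional_scale: "functional l (scale a p) = a * functional l p"
  by (induction l) (auto simp: functional_def distrib_left)

lemma functional_zero: "functional l 0 = 0"
  by (induction l) (auto simp: functional_def)

lemma functional_sum: "functional l (sum f I) = (\<Sum>i\<in>I. functional l (f i))"
  by (induction I rule: infinite_finite_induct) (auto simp: functional_add functional_zero)

lemma nth_inject: "length e = length e' \<Longrightarrow> Poly_Mapping.nth e = Poly_Mapping.nth e' \<longleftrightarrow> e = e'"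
proof
  assume *: "length e = length e'" "Poly_Mapping.nth e = Poly_Mapping.nth e'"
  then have "nth_default 0 e i = nth_default 0 e' i" for i by (metis lookup_nth)
  then show "e = e'" using *(1) by (intro nth_equalityI)
    (auto simp: nth_default_def split: if_splits, metis)
qed simp

lemma functional_monom:
  assumes "\<And>t. t \<in> set l \<Longrightarrow> length (snd t) = length e"
  shows "functional l (monom e) = of_int (term_coeff l e)"
  using assms
proof (induction l)
  case (Cons t l)
  obtain c e' where t: "t = (c, e')" by (cases t)
  have "length e' = length e" using Cons.prems[of t] t by simp
  moreover have "functional l (monom e) = of_int (term_coeff l e)" using Cons by simp
  ultimately show ?case
    by (auto simp: functional_Cons t monom_def lookup_single when_def nth_inject)
qed (simp add: functional_Nil)

lemma functional_pairing:
  assumes "\<And>t. t \<in> set l \<Longrightarrow> length (snd t) = length q" "\<And>t. t \<in> set r \<Longrightarrow> length (snd t) = length q"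
  shows "functional l (monom q * poly_of r) = of_int (pairing l q r)"
  using assms(2)
proof (induction r)
  case (Cons t r)
  obtain c e where t: "t = (c, e)" by (cases t)
  have "length e = length q" using Cons.prems[of t] t by simp
  moreover have "functional l (monom q * poly_of r) = of_int (pairing l q r)" using Cons by simp
  moreover have "monom q * scale (of_int c) (monom e) = scale (of_int c) (monom q * monom e)"
    by (simp add: scale_eq_mult mult.left_commute)
  ultimately show ?case
    using functional_monom[of l "add_exps q e"] assms(1)
    by (simp add: t poly_of_Cons distrib_left functional_add functional_scale monom_mult length_add_exps)
qed (simp add: poly_of_Nil functional_zero)

lemma functionals_nth:
  assumes "i < length Rs"
  shows "t \<in> set (functionals ! i) \<Longrightarrow> length (snd t) = m \<and> wt (snd t) = deg (Rs ! i)"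
    "j < length Rs \<Longrightarrow> relation_pairings_ok m (deg (Rs ! i)) (functionals ! i) (Rs ! j) (i \<noteq> j)"
  using functionals_ok_nth[OF functionals assms] functional_ok_nth[of m _ i "functionals ! i" 0 Rs j]
  by (auto simp: list_all_iff term_ok_def)

lemma term_coeff_zero: "(\<And>t. t \<in> set l \<Longrightarrow> snd t \<noteq> e) \<Longrightarrow> term_coeff l e = 0"
proof (induction l)
  case (Cons t l)
  then show ?case by (cases t) force
qed simp

text \<open>
  Products of another degree than that of the functional are not covered by the check, but on these
  the functional vanishes since it only reads coefficients of its own degree.
\<close>

lemma pairing_vanishes:
  assumes ij: "i < length Rs" "j < length Rs" and q: "length q = m" and "i \<noteq> j \<or> wt q > 0"
  shows "pairing (functionals ! i) q (Rs ! j) = 0"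
proof (cases "wt q + deg (Rs ! j) = deg (Rs ! i)")
  case True
  then have "q \<in> set (monomials 1 m (deg (Rs ! i) - deg (Rs ! j)))" "deg (Rs ! j) \<le> deg (Rs ! i)"
    using q by (auto simp: set_monomials)
  then have "(pairing (functionals ! i) q (Rs ! j) = 0) = (i \<noteq> j)"
    using functionals_nth(2)[OF ij] by (auto simp: relation_pairings_ok_def list_all_iff pairing_ok_def)
  moreover have "i \<noteq> j" using assms(4) True by auto
  ultimately show ?thesis by simp
next
  case False
  have "pairing (functionals ! i) q ts = 0" if "set ts \<subseteq> set (Rs ! j)" for ts
    using that
  proof (induction ts)
    case (Cons t ts)
    obtain c e where t: "t = (c, e)" by (cases t)
    then have e: "length e = m" "wt e = deg (Rs ! j)"
      using term_of_relation[of "Rs ! j" t] Cons.prems ij by auto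
    have "wt (add_exps q e) \<noteq> deg (Rs ! i)" using e q False by (simp add: wt_add_exps)
    then have "term_coeff (functionals ! i) (add_exps q e) = 0"
      using functionals_nth(1)[OF ij(1)] by (intro term_coeff_zero) auto
    then show ?case using Cons by (simp add: t)
  qed simp
  then show ?thesis by simp
qed

lemma functional_relation:
  assumes ij: "i < length Rs" "j < length Rs" and q: "length q = m" and "i \<noteq> j \<or> wt q > 0"
  shows "functional (functionals ! i) (monom q * poly_of (Rs ! j)) = 0"
  using functional_pairing[of "functionals ! i" q "Rs ! j"] pairing_vanishes[OF assms]
    functionals_nth(1)[OF ij(1)] term_of_relation[of "Rs ! j"] ij q by simp

lemma monom_zero: "monom (replicate n 0) = 1"
  using nth_eq_zero[of 1 "replicate n 0"] by (simp add: monom_def wt_from_sum)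

lemma functional_own_relation:
  assumes i: "i < length Rs"
  shows "functional (functionals ! i) (poly_of (Rs ! i)) \<noteq> 0"
proof -
  let ?q = "replicate m (0 :: nat)"
  have "?q \<in> set (monomials 1 m 0)" by (simp add: set_monomials wt_from_sum)
  then have "pairing (functionals ! i) ?q (Rs ! i) \<noteq> 0"
    using functionals_nth(2)[OF i i] by (auto simp: relation_pairings_ok_def list_all_iff pairing_ok_def)
  then have "functional (functionals ! i) (monom ?q * poly_of (Rs ! i)) \<noteq> 0"
    using functional_pairing[of "functionals ! i" ?q "Rs ! i"]
      functionals_nth(1)[OF i] term_of_relation[of "Rs ! i"] i by simp
  then show ?thesis by (simp add: monom_zero)
qed

text \<open>
  The polynomials \<open>p\<close> for which the functional vanishes on \<open>P\<^sub>+ \<cdot> p\<close> form an ideal. As this ideal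
  contains the relations, it contains \<open>J\<close>.
\<close>

lemma functional_vanishes:
  assumes i: "i < length Rs" and p: "p \<in> positive_ideal m \<cdot>\<^bsub>P\<^esub> J"
  shows "functional (functionals ! i) p = 0"
proof -
  let ?L = "functional (functionals ! i)"
  define K where "K = {p \<in> carrier P. \<forall>q\<in>positive_ideal m. ?L (q * p) = 0}"
  have "ideal K P"
  proof (rule polynomial_idealI)
    fix p q assume p: "p \<in> K" and q: "q \<in> carrier P"
    have "?L (q' * (q * p)) = 0" if "q' \<in> positive_ideal m" for q'
    proof -
      have "q' * q \<in> positive_ideal m" using ideal.I_r_closed[OF positive_ideal_ideal that q] by simp
      then show ?thesis using p by (simp add: K_def mult.assoc[symmetric])
    qed
    then show "q * p \<in> K" using p q by (simp add: K_def polynomial_mult_closed)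
  qed (auto simp: K_def polynomial_zero_closed polynomial_add_closed functional_zero functional_add
    distrib_left)
  moreover have "R \<subseteq> K"
  proof
    fix r assume "r \<in> R"
    then obtain j where j: "j < length Rs" "r = poly_of (Rs ! j)" by (auto simp: in_set_conv_nth)
    have "?L (q * r) = 0" if q: "q \<in> positive_ideal m" for q
    proof -
      have "?L (Poly_Mapping.single u (coeff q u) * r) = 0" if u: "u \<in> Poly_Mapping.keys q" for u
      proof -
        have "Poly_Mapping.keys u \<subseteq> {..<m}" "monomial_norm u > 0"
          using q u by (auto simp: positive_ideal_def polynomial_algebra_carrier)
        moreover define e where "e = map (Poly_Mapping.lookup u) [0..<m]"
        ultimately have e: "Poly_Mapping.nth e = u" "length e = m" "wt e > 0"
          using monomial_norm_nth[of e] by (simp_all add: nth_exponents)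
        have "Poly_Mapping.single u (coeff q u) * r = scale (coeff q u) (monom e * r)"
          by (simp add: monom_def e(1) scale_eq_mult mult_single mult.assoc[symmetric])
        then show ?thesis using functional_relation[OF i j(1) e(2)] e(3) j(2)
          by (simp add: functional_scale)
      qed
      then have "?L (\<Sum>u\<in>Poly_Mapping.keys q. Poly_Mapping.single u (coeff q u) * r) = 0"
        by (simp add: functional_sum)
      then show ?thesis by (simp add: sum_distrib_right[symmetric] sum_single_keys)
    qed
    then show "r \<in> K" using \<open>r \<in> R\<close> R_closed by (auto simp: K_def)
  qed
  ultimately have "J \<subseteq> K" by (rule J_minimal)
  show ?thesis using p
  proof (induction p rule: ideal_prod.induct)
    case (prod q p)
    then show ?case using \<open>J \<subseteq> K\<close> by (auto simp: K_def)
  qed (simp add: functional_add)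
qed

lemma relations_independent:
  assumes F: "finite F" "F \<subseteq> R" "(\<Sum>r\<in>F. scale (c r) r) \<in> positive_ideal m \<cdot>\<^bsub>P\<^esub> J" and r: "r \<in> F"
  shows "c r = 0"
proof -
  have "r \<in> R" using F(2) r by blast
  then obtain i where i: "i < length Rs" "r = poly_of (Rs ! i)" by (auto simp: in_set_conv_nth)
  let ?L = "functional (functionals ! i)"
  have other: "?L r' = 0" if "r' \<in> F" "r' \<noteq> r" for r'
  proof -
    have "r' \<in> R" using F(2) that(1) by blast
    then obtain j where j: "j < length Rs" "r' = poly_of (Rs ! j)" by (auto simp: in_set_conv_nth)
    then have "i \<noteq> j" using i that by auto
    then show ?thesis using functional_relation[OF i(1) j(1), of "replicate m 0"] j(2)
      by (simp add: monom_zero)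
  qed
  have "0 = ?L (\<Sum>r\<in>F. scale (c r) r)" using functional_vanishes[OF i(1) F(3)] by simp
  also have "\<dots> = (\<Sum>r'\<in>F. if r' = r then c r * ?L r else 0)"
    unfolding functional_sum by (intro sum.cong refl) (auto simp: functional_scale other)
  also have "\<dots> = c r * ?L r" using F(1) r by simp
  finally show ?thesis using functional_own_relation[OF i(1)] i(2) by simp
qed

lemma relation_homogeneous:
  assumes "r \<in> set Rs"
  shows "Defs.homogeneous (poly_of r)"
proof -
  have "monomial_norm u = deg r" if "u \<in> Poly_Mapping.keys (poly_of ts)" "set ts \<subseteq> set r" for u ts
    using that
  proof (induction ts)
    case (Cons t ts)
    obtain c e where t: "t = (c, e)" by (cases t)
    have "u \<in> Poly_Mapping.keys (scale (of_int c) (monom e)) \<or> u \<in> Poly_Mapping.keys (poly_of ts)"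
      using Cons.prems(1) keys_add[of "scale (of_int c) (monom e)" "poly_of ts"]
        by (auto simp: t poly_of_Cons)
    then show ?case
    proof
      assume "u \<in> Poly_Mapping.keys (scale (of_int c) (monom e))"
      then have "u = Poly_Mapping.nth e" by (auto simp: in_keys_iff monom_def lookup_single when_def
        split: if_splits)
      then show ?thesis using term_of_relation[of r t] assms Cons.prems(2) t
        by (simp add: monomial_norm_nth)
    next
      assume "u \<in> Poly_Mapping.keys (poly_of ts)"
      then show ?thesis using Cons by simp
    qed
  qed (simp add: poly_of_Nil)
  then show ?thesis unfolding homogeneous_def by blast
qed

theorem minimal_presentation: "minimal_presentation d R"
proof -
  interpret hom: ring_hom_ring P A "eval_poly d"
    using polynomial_algebra_cring invariant_algebra_cring eval_poly_ring_hom
    by (intro ring_hom_ringI2) (auto simp: cring_def)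
  have surj: "eval_poly d ` carrier P = carrier A"
    using eval_poly_surjective eval_poly_closed by blast
  have kernel: "a_kernel P A (eval_poly d) = J"
    unfolding a_kernel_def' invariant_algebra_simps by (rule kernel_eq_J)
  have "\<phi> ` carrier P = carrier A \<and> minimal_relations m (a_kernel P A \<phi>) R \<and> a_kernel P A \<phi> = J"
    if \<phi>: "\<phi> \<in> generator_homs d" for \<phi>
  proof (intro conjI)
    have eq: "\<phi> p = eval_poly d p" if "p \<in> carrier P" for p by (rule generator_hom_unique[OF \<phi> that])
    have "\<phi> ` carrier P = eval_poly d ` carrier P" by (rule image_cong[OF refl eq])
    then show "\<phi> ` carrier P = carrier A" using surj by simp
    have "a_kernel P A \<phi> = a_kernel P A (eval_poly d)"
      unfolding a_kernel_def' by (intro Collect_cong conj_cong refl) (simp add: eq)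
    then show kernel': "a_kernel P A \<phi> = J" using kernel by simp
    show "minimal_relations m (a_kernel P A \<phi>) R"
      unfolding kernel' minimal_relations_def
    proof (intro conjI allI ballI impI)
      show "R \<subseteq> J" by (rule R_subset_J)
      show "Defs.homogeneous r" if "r \<in> R" for r using that relation_homogeneous by auto
      show "c r = 0" if "finite F \<and> F \<subseteq> R \<and> (\<Sum>r\<in>F. scale (c r) r) \<in> positive_ideal m \<cdot>\<^bsub>P\<^esub> J" "r \<in> F"
        for F c r
        using relations_independent that by blast
      show "\<exists>F c. finite F \<and> F \<subseteq> R \<and> p - (\<Sum>r\<in>F. scale (c r) r) \<in> positive_ideal m \<cdot>\<^bsub>P\<^esub> J" if "p \<in> J"
        for p
      proof -
        obtain c where "p - (\<Sum>r\<in>R. scale (c r) r) \<in> positive_ideal m \<cdot>\<^bsub>P\<^esub> J"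
          using relations_span[OF \<open>p \<in> J\<close>] by blast
        then show ?thesis by (intro exI[of _ R] exI[of _ c]) simp
      qed
    qed
  qed
  moreover have "P Quot J \<simeq> A" using hom.FactRing_iso[OF surj] by (simp add: kernel)
  moreover have "generator_homs d \<noteq> {}" using eval_poly_generator_hom by blast
  ultimately show ?thesis unfolding minimal_presentation_def Let_def by blast
qed

end

section \<open>The presentations\<close>

fun var_powers :: "nat \<Rightarrow> nat list \<Rightarrow> rat_mpoly" where
  "var_powers k [] = 1"
| "var_powers k (e # es) = var k ^ e * var_powers (k + 1) es"

lemma var_power: "var k ^ e = Poly_Mapping.single (Poly_Mapping.single k e) 1"
proof (induction e)
  case (Suc e)
  then show ?case by (simp add: var_def mult_single single_add[symmetric] One_nat_def)
qed simp

lemma monom_eq_var_powers: "monom e = var_powers 0 e"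
proof -
  have "var_powers k e = Poly_Mapping.single (Poly_Mapping.nth (replicate k 0 @ e)) 1" for k
  proof (induction e arbitrary: k)
    case Nil
    have "Poly_Mapping.nth (replicate k (0 :: nat)) = 0"
      by (rule poly_mapping_eqI) (simp add: nth_default_def)
    then show ?case by simp
  next
    case (Cons n e)
    have "Poly_Mapping.single k n + Poly_Mapping.nth (replicate (k + 1) 0 @ e) = Poly_Mapping.nth
      (replicate k 0 @ n # e)"
      by (rule poly_mapping_eqI)
        (auto simp: lookup_add lookup_single when_def nth_default_def nth_append nth_Cons' simp
          flip: One_nat_def)
    then show ?case by (simp add: Cons.IH var_power mult_single)
  qed
  from this[of 0] show ?thesis by (simp add: monom_def)
qed

lemma poly_of_Cons_var: "poly_of ((c, e) # t) = of_int c * var_powers 0 e + poly_of t"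
  by (simp add: poly_of_Cons scale_eq_mult monom_eq_var_powers single_of_int)

lemmas poly_of_vars = poly_of_Cons_var poly_of_Nil var_powers.simps

lemma relations_in_ideal:
  assumes "list_all (homogeneous_ok m) Rs" "r \<in> set Rs"
  shows "poly_of r \<in> genideal (polynomial_algebra m) (poly_of ` set Rs)"
proof -
  interpret cring "polynomial_algebra m" by (rule polynomial_algebra_cring)
  have "poly_of ` set Rs \<subseteq> carrier (polynomial_algebra m)"
    using assms(1) by (auto simp: list_all_iff homogeneous_ok_def term_ok_def intro!: poly_of_closed)
  from genideal_self[OF this] assms(2) show ?thesis by auto
qed

text \<open>
  For each \<open>d\<close> the data consist of the relations, each with its leading term last, of a pair
  \<open>(D, W)\<close> for each norm, where \<open>W / D\<close> is the inverse of the matrix of the values of the standard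
  monomials, and of the coefficients of one functional for every relation. A functional solves the
  linear equations which say that it vanishes on the multiples of the other relations and does not
  vanish on its own one.
\<close>

definition rels1 :: "term_list list" where
 "rels1 = []"

definition inverses1 :: "(int * int list list) list" where
 "inverses1 = [(1, [[1]])]"

definition functionals1 :: "term_list list" where
 "functionals1 = []"

lemma certificate1: "certificate_ok 1 rels1 rels1 [] inverses1 functionals1"
  by code_simp

definition rels2 :: "term_list list" where
 "rels2 = [[(1,[2])]]"

definition inverses2 :: "(int * int list list) list" where
 "inverses2 = [(1, [[1]]),
  (1, [[1]])]"

definition functionals2 :: "term_list list" where
 "functionals2 = [[(1,[2])]]"

lemma certificate2: "certificate_ok 2 rels2 rels2 [0] inverses2 functionals2"
  by code_simp

definition rels3 :: "term_list list" where
 "rels3 = [[(1,[3])]]"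

definition inverses3 :: "(int * int list list) list" where
 "inverses3 = [(1, [[1]]),
  (1, [[1]]),
  (3, [[1]])]"

definition functionals3 :: "term_list list" where
 "functionals3 = [[(1,[3])]]"

lemma certificate3: "certificate_ok 3 rels3 rels3 [0] inverses3 functionals3"
  by code_simp

definition rels4 :: "term_list list" where
 "rels4 = [[(1,[3,0]),(-4,[1,1])],
  [(1,[4,0])],
  [(1,[0,2])]]"

definition inverses4 :: "(int * int list list) list" where
 "inverses4 = [(1, [[1]]),
  (1, [[1]]),
  (2, [[2,0],[-3,1]]),
  (16, [[1]])]"

definition functionals4 :: "term_list list" where
 "functionals4 = [[(1,[3,0])],
  [(4,[4,0]),(1,[2,1])],
  [(1,[0,2])]]"

lemma certificate4: "certificate_ok 4 rels4 rels4 [0, 1] inverses4 functionals4"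
  by code_simp

definition rels5 :: "term_list list" where
 "rels5 = [[(1,[4,0]),(-5,[2,1])],
  [(1,[4,0]),(-25,[0,2])],
  [(1,[5,0])]]"

definition inverses5 :: "(int * int list list) list" where
 "inverses5 = [(1, [[1]]),
  (1, [[1]]),
  (2, [[2,0],[-3,1]]),
  (20, [[9,-1],[-16,4]]),
  (125, [[1]])]"

definition functionals5 :: "term_list list" where
 "functionals5 = [[(-1,[2,1])],
  [(-1,[0,2])],
  [(25,[5,0]),(5,[3,1]),(1,[1,2])]]"

lemma certificate5: "certificate_ok 5 rels5 rels5 [0, 1] inverses5 functionals5"
  by code_simp

definition rels6 :: "term_list list" where
 "rels6 = [[(1,[4,0,0]),(-11,[2,1,0]),(24,[1,0,1]),(6,[0,2,0])],
  [(1,[5,0,0]),(-6,[3,1,0])],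
  [(1,[5,0,0]),(-36,[2,0,1])],
  [(1,[5,0,0]),(-216,[0,1,1])],
  [(1,[6,0,0])],
  [(1,[0,0,2])]]"

definition inverses6 :: "(int * int list list) list" where
 "inverses6 = [(1, [[1]]),
  (1, [[1]]),
  (2, [[2,0],[-3,1]]),
  (6, [[6,0,0],[-24,6,0],[20,-9,1]]),
  (120, [[-16,18,-2],[200,-90,10],[-200,65,-5]]),
  (1296, [[1]])]"

definition functionals6 :: "term_list list" where
 "functionals6 = [[(1,[4,0,0])],
  [(-6,[3,1,0]),(-11,[1,2,0])],
  [(-1,[2,0,1]),(4,[1,2,0])],
  [(-1,[0,1,1])],
  [(216,[6,0,0]),(36,[4,1,0]),(6,[3,0,1]),(6,[2,2,0]),(1,[1,1,1]),(1,[0,3,0])],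
  [(1,[0,0,2])]]"

lemma certificate6: "certificate_ok 6 rels6 rels6 [0, 1, 1] inverses6 functionals6"
  by code_simp

definition rels7 :: "term_list list" where
 "rels7 = [[(1,[5,0,0]),(-13,[3,1,0]),(28,[2,0,1]),(14,[1,2,0])],
  [(11,[5,0,0]),(-129,[3,1,0]),(280,[2,0,1]),(588,[0,1,1])],
  [(1,[6,0,0]),(-7,[4,1,0])],
  [(1,[6,0,0]),(-49,[3,0,1])],
  [(1,[6,0,0]),(-343,[0,3,0])],
  [(1,[6,0,0]),(-2401,[0,0,2])],
  [(1,[7,0,0])]]"

definition inverses7 :: "(int * int list list) list" where
 "inverses7 = [(1, [[1]]),
  (1, [[1]]),
  (2, [[2,0],[-3,1]]),
  (6, [[6,0,0],[-24,6,0],[20,-9,1]]),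
  (420, [[54,160,-36,2],[-270,-380,180,-10],[75,-400,90,-5],[180,720,-330,30]]),
  (123480, [[-3500,2925,-295],[36288,-13392,1224],[-37800,9540,-540]]),
  (16807, [[1]])]"

definition functionals7 :: "term_list list" where
 "functionals7 = [[(1,[1,2,0])],
  [(1,[0,1,1])],
  [(-196,[4,1,0]),(-182,[2,2,0]),(-43,[1,1,1])],
  [(-21,[3,0,1]),(42,[2,2,0]),(10,[1,1,1])],
  [(-1,[0,3,0])],
  [(-1,[0,0,2])],
  [(2401,[7,0,0]),(343,[5,1,0]),(49,[4,0,1]),(49,[3,2,0]),(7,[2,1,1]),(7,[1,3,0]),(1,[1,0,2]),
    (1,[0,2,1])]]"

lemma certificate7: "certificate_ok 7 rels7 rels7 [0, 1, 1] inverses7 functionals7"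
  by code_simp

definition rels8 :: "term_list list" where
 "rels8 = [[(1,[5,0,0,0]),(-21,[3,1,0,0]),(92,[2,0,1,0]),(54,[1,2,0,0]),(-240,[1,0,0,1]),
   (-96,[0,1,1,0])],
  [(1,[6,0,0,0]),(-15,[4,1,0,0]),(32,[3,0,1,0]),(24,[2,2,0,0])],
  [(1,[6,0,0,0]),(9,[4,1,0,0]),(-304,[3,0,1,0]),(1440,[2,0,0,1]),(-96,[0,3,0,0])],
  [(-1,[6,0,0,0]),(87,[4,1,0,0]),(-1232,[3,0,1,0]),(5472,[2,0,0,1]),(-5376,[0,1,0,1])],
  [(17,[6,0,0,0]),(-135,[4,1,0,0]),(-784,[3,0,1,0]),(5760,[2,0,0,1]),(3584,[0,0,2,0])],
  [(1,[7,0,0,0]),(-8,[5,1,0,0])],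
  [(1,[7,0,0,0]),(-64,[4,0,1,0])],
  [(1,[7,0,0,0]),(-512,[3,0,0,1])],
  [(1,[7,0,0,0]),(-32768,[0,0,1,1])],
  [(1,[8,0,0,0])],
  [(1,[0,0,0,2])]]"

definition inverses8 :: "(int * int list list) list" where
 "inverses8 = [(1, [[1]]),
  (1, [[1]]),
  (2, [[2,0],[-3,1]]),
  (6, [[6,0,0],[-24,6,0],[20,-9,1]]),
  (24, [[24,0,0,0,0],[-120,0,24,0,0],[-60,12,0,0,0],[360,-36,-96,12,0],[-210,27,80,-18,1]]),
  (4032, [[-600,270,500,-135,7],[7632,-1620,-3000,810,-42],[-6480,648,864,-72,0],
    [-17640,2268,6720,-1512,84],[17640,-1386,-4956,693,-21]]),
  (1806336, [[8640,-8736,4806,-426],[-329280,123872,-18522,1078],[1778112,-352800,-4410,2646],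
    [-1481760,228144,17199,-2793]]),
  (262144, [[1]])]"

definition functionals8 :: "term_list list" where
 "functionals8 = [[(1,[5,0,0,0])],
  [(16,[2,2,0,0]),(9,[1,1,1,0])],
  [(-1,[0,3,0,0])],
  [(-1,[0,1,0,1])],
  [(1,[0,0,2,0])],
  [(-7168,[5,1,0,0]),(-4480,[3,2,0,0]),(-952,[2,1,1,0]),(-672,[1,3,0,0]),(-116,[1,1,0,1]),
    (-270,[1,0,2,0]),(-95,[0,2,1,0])],
  [(-576,[4,0,1,0]),(768,[3,2,0,0]),(-120,[2,1,1,0]),(1824,[1,3,0,0]),(132,[1,1,0,1]),
    (-126,[1,0,2,0]),(413,[0,2,1,0])],
  [(-336,[3,0,0,1]),(840,[2,1,1,0]),(-5040,[1,3,0,0]),(-342,[1,1,0,1]),(540,[1,0,2,0]),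
    (-1175,[0,2,1,0])],
  [(-1,[0,0,1,1])],
  [(32768,[8,0,0,0]),(4096,[6,1,0,0]),(512,[5,0,1,0]),(512,[4,2,0,0]),(64,[4,0,0,1]),(64,[3,1,1,0]),
    (64,[2,3,0,0]),(8,[2,1,0,1]),(8,[2,0,2,0]),(8,[1,2,1,0]),(1,[1,0,1,1]),(8,[0,4,0,0]),
      (1,[0,2,0,1]),(1,[0,1,2,0])],
  [(1,[0,0,0,2])]]"

lemma certificate8: "certificate_ok 8 rels8 rels8 [0, 2, 3, 2] inverses8 functionals8"
  by code_simp

definition rels9 :: "term_list list" where
 "rels9 = [[(-1,[6,0,0,0]),(24,[4,1,0,0]),(-104,[3,0,1,0]),(-87,[2,2,0,0]),(270,[2,0,0,1]),
   (216,[1,1,1,0]),(18,[0,3,0,0])],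
  [(-11,[6,0,0,0]),(258,[4,1,0,0]),(-1120,[3,0,1,0]),(-837,[2,2,0,0]),(2910,[2,0,0,1]),
    (1488,[1,1,1,0]),(2160,[0,1,0,1]),(864,[0,0,2,0])],
  [(1,[7,0,0,0]),(-17,[5,1,0,0]),(36,[4,0,1,0]),(36,[3,2,0,0])],
  [(1,[7,0,0,0]),(-11,[5,1,0,0]),(-30,[4,0,1,0]),(270,[3,0,0,1]),(162,[2,1,1,0])],
  [(251,[7,0,0,0]),(-3895,[5,1,0,0]),(16284,[4,0,1,0]),(-50328,[3,0,0,1]),(326592,[1,1,0,1])],
  [(37,[7,0,0,0]),(-1001,[5,1,0,0]),(9636,[4,0,1,0]),(-37800,[3,0,0,1]),(46656,[0,2,1,0])],
  [(85,[7,0,0,0]),(-857,[5,1,0,0]),(-2652,[4,0,1,0]),(26712,[3,0,0,1]),(373248,[0,0,1,1])],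
  [(1,[8,0,0,0]),(-9,[6,1,0,0])],
  [(1,[8,0,0,0]),(-81,[5,0,1,0])],
  [(1,[8,0,0,0]),(-729,[4,0,0,1])],
  [(1,[8,0,0,0]),(-59049,[0,2,0,1])],
  [(1,[8,0,0,0]),(-531441,[0,0,0,2])],
  [(1,[9,0,0,0])]]"

definition inverses9 :: "(int * int list list) list" where
 "inverses9 = [(1, [[1]]),
  (1, [[1]]),
  (2, [[2,0],[-3,1]]),
  (6, [[6,0,0],[-24,6,0],[20,-9,1]]),
  (24, [[24,0,0,0,0],[-120,0,24,0,0],[-60,12,0,0,0],[360,-36,-96,12,0],[-210,27,80,-18,1]]),
  (3024, [[600,1050,-135,-200,30,-1],[-3600,-3276,810,1200,-180,6],[-576,-6300,810,1200,-180,6],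
    [8064,6930,-2835,-2688,630,-21],[504,14490,-1323,-4200,630,-21],[-5376,-13440,3024,5152,-1176,56]]),
  (163296, [[-1620,-5976,-12510,4455,6024,-1530,69],[11340,74232,144270,-38475,-52968,12330,-537],
    [174636,41832,87570,-31185,-42168,10710,-483],[-198450,-119700,-231210,63504,84756,-19026,798],
      [-290304,-361728,-608832,168480,233472,-52560,2256],
        [725760,759168,1159200,-339552,-444576,99648,-4128],
          [-423360,-382368,-525000,173124,213472,-50568,2156]]),
  (1316818944, [[864360,-712068,315217,-24941],[-29491200,10076160,-1323008,65536],
    [126443520,-25138176,464128,87808],[-101154816,15052800,501760,-100352]]),
  (4782969, [[1]])]"

definition functionals9 :: "term_list list" where
 "functionals9 = [[(1,[0,3,0,0])],
  [(1,[0,0,2,0])],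
  [(96,[3,2,0,0]),(464,[1,3,0,0]),(93,[1,0,2,0])],
  [(18,[2,1,1,0]),(-216,[1,3,0,0]),(-31,[1,0,2,0])],
  [(2,[1,1,0,1]),(-5,[1,0,2,0])],
  [(1,[0,2,1,0])],
  [(1,[0,0,1,1])],
  [(-15676416,[6,1,0,0]),(-7402752,[4,2,0,0]),(-1064448,[3,1,1,0]),(-2104704,[2,3,0,0]),
    (-186960,[2,1,0,1]),(-189648,[2,0,2,0]),(-336336,[1,2,1,0]),(-35994,[1,0,1,1]),
      (-483024,[0,4,0,0]),(-198875,[0,1,2,0])],
  [(-1306368,[5,0,1,0]),(1306368,[4,2,0,0]),(-241920,[3,1,1,0]),(1669248,[2,3,0,0]),
    (65136,[2,1,0,1]),(-174096,[2,0,2,0]),(269808,[1,2,1,0]),(-9282,[1,0,1,1]),(713712,[0,4,0,0]),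
      (229337,[0,1,2,0])],
  [(-72576,[4,0,0,1]),(120960,[3,1,1,0]),(-362880,[2,3,0,0]),(-11184,[2,1,0,1]),(64080,[2,0,2,0]),
    (-58800,[1,2,1,0]),(5194,[1,0,1,1]),(-181680,[0,4,0,0]),(-55805,[0,1,2,0])],
  [(-2,[0,2,0,1]),(5,[0,1,2,0])],
  [(-1,[0,0,0,2])],
  [(531441,[9,0,0,0]),(59049,[7,1,0,0]),(6561,[6,0,1,0]),(6561,[5,2,0,0]),(729,[5,0,0,1]),
    (729,[4,1,1,0]),(729,[3,3,0,0]),(81,[3,1,0,1]),(81,[3,0,2,0]),(81,[2,2,1,0]),(9,[2,0,1,1]),
      (81,[1,4,0,0]),(9,[1,2,0,1]),(9,[1,1,2,0]),(1,[1,0,0,2]),(9,[0,3,1,0]),(1,[0,1,1,1]),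
        (1,[0,0,3,0])]]"

lemma certificate9: "certificate_ok 9 rels9 rels9 [0, 2, 3, 2] inverses9 functionals9"
  by code_simp

definition rels10 :: "term_list list" where
 "rels10 = [[(1,[6,0,0,0,0]),(-34,[4,1,0,0,0]),(224,[3,0,1,0,0]),(207,[2,2,0,0,0]),
   (-1170,[2,0,0,1,0]),(-1136,[1,1,1,0,0]),(3360,[1,0,0,0,1]),(-108,[0,3,0,0,0]),(1200,[0,1,0,1,0]),
     (480,[0,0,2,0,0])],
  [(-1,[7,0,0,0,0]),(27,[5,1,0,0,0]),(-116,[4,0,1,0,0]),(-126,[3,2,0,0,0]),(300,[3,0,0,1,0]),
    (360,[2,1,1,0,0]),(60,[1,3,0,0,0])],
  [(-3,[7,0,0,0,0]),(86,[5,1,0,0,0]),(-468,[4,0,1,0,0]),(-393,[3,2,0,0,0]),(1950,[3,0,0,1,0]),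
    (1420,[2,1,1,0,0]),(-4200,[2,0,0,0,1]),(600,[0,2,1,0,0])],
  [(-7,[7,0,0,0,0]),(229,[5,1,0,0,0]),(-1652,[4,0,1,0,0]),(-1152,[3,2,0,0,0]),(9450,[3,0,0,1,0]),
    (6080,[2,1,1,0,0]),(-29460,[2,0,0,0,1]),(-6600,[1,1,0,1,0]),(21600,[0,1,0,0,1])],
  [(-59,[7,0,0,0,0]),(1283,[5,1,0,0,0]),(-2404,[4,0,1,0,0]),(-3654,[3,2,0,0,0]),
    (-18450,[3,0,0,1,0]),(-10040,[2,1,1,0,0]),(140700,[2,0,0,0,1]),(46200,[1,1,0,1,0]),
      (108000,[0,0,1,1,0])],
  [(1,[8,0,0,0,0]),(-19,[6,1,0,0,0]),(40,[5,0,1,0,0]),(50,[4,2,0,0,0])],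
  [(7,[8,0,0,0,0]),(-83,[6,1,0,0,0]),(-320,[5,0,1,0,0]),(2500,[4,0,0,1,0]),(2000,[3,1,1,0,0])],
  [(21,[8,0,0,0,0]),(-249,[6,1,0,0,0]),(40,[5,0,1,0,0]),(-5500,[4,0,0,1,0]),(60000,[3,0,0,0,1]),
    (30000,[2,1,0,1,0])],
  [(221,[8,0,0,0,0]),(-2049,[6,1,0,0,0]),(-1960,[5,0,1,0,0]),(-167500,[4,0,0,1,0]),
    (1680000,[3,0,0,0,1]),(30000,[0,4,0,0,0])],
  [(1457,[8,0,0,0,0]),(-14133,[6,1,0,0,0]),(-5320,[5,0,1,0,0]),(-1049500,[4,0,0,1,0]),
    (10320000,[3,0,0,0,1]),(2700000,[0,2,0,1,0])],
  [(-2659,[8,0,0,0,0]),(10671,[6,1,0,0,0]),(191840,[5,0,1,0,0]),(2835500,[4,0,0,1,0]),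
    (-32592000,[3,0,0,0,1]),(97200000,[0,0,1,0,1])],
  [(18341,[8,0,0,0,0]),(-142329,[6,1,0,0,0]),(-813160,[5,0,1,0,0]),(-8483500,[4,0,0,1,0]),
    (122640000,[3,0,0,0,1]),(243000000,[0,0,0,2,0])],
  [(1,[9,0,0,0,0]),(-10,[7,1,0,0,0])],
  [(1,[9,0,0,0,0]),(-100,[6,0,1,0,0])],
  [(1,[9,0,0,0,0]),(-1000,[5,0,0,1,0])],
  [(1,[9,0,0,0,0]),(-10000000,[0,0,0,1,1])],
  [(1,[10,0,0,0,0])],
  [(1,[0,0,0,0,2])]]"

definition extra10 :: "term_list" where
 "extra10 = [(-720,[9,0,0,0,0]),(7200000,[4,0,0,0,1])]"

definition inverses10 :: "(int * int list list) list" where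
 "inverses10 = [(1, [[1]]),
  (1, [[1]]),
  (2, [[2,0],[-3,1]]),
  (6, [[6,0,0],[-24,6,0],[20,-9,1]]),
  (24, [[24,0,0,0,0],[-120,0,24,0,0],[-60,12,0,0,0],[360,-36,-96,12,0],[-210,27,80,-18,1]]),
  (120, [[120,0,0,0,0,0,0],[-720,0,120,0,0,0,0],[-720,120,0,0,0,0,0],[2520,-180,-600,0,60,0,0],
    [2520,-480,-300,60,0,0,0],[-6720,1120,1800,-180,-240,20,0],[3024,-600,-1050,135,200,-30,1]]),
  (181440, [[-1800,1620,-32256,19200,21600,-4320,-4800,780,-24],
    [12600,-11340,407232,-134400,-151200,30240,33600,-5460,168],
      [194040,-11340,225792,-134400,-151200,30240,33600,-5460,168],
        [-220500,14742,-522144,147504,145530,-24003,-25536,3696,-105],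
          [-322560,45360,-1991808,537600,695520,-120960,-134400,21840,-672],
            [806400,-72576,2185344,-460992,-559440,71064,69888,-7728,168],
              [-470400,45360,-301056,179200,201600,-40320,-44800,7280,-224],
                [0,0,2286144,-453600,-793800,102060,151200,-22680,756],
                  [0,-13608,-2286144,290304,589680,-36288,-72576,4536,0]]),
  (54432000, [[-205800,-20580,-344960,-507150,204624,229124,-57673,2359],
    [1106400,-9512160,5603680,8107200,-1912392,-2333392,476684,-17972],
      [18278400,74403840,-12561920,-19756800,1266048,2330048,-115696,-1232],
        [-21638400,-70748160,7819840,13356000,204624,-621376,-185248,10864],
          [-28576800,-17146080,-9344160,-10886400,4939704,5506704,-1317708,52164],
            [36741600,-95528160,26943840,40824000,-8123976,-9824976,1789452,-61236],
              [42865200,197179920,-20003760,-43205400,244944,3079944,275562,-21546],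
                [-48988800,-78382080,2449440,12927600,3170664,1469664,-898128,40824]]),
  (122472000000, [[-9408000,9002000,-5719840,2153004,-153916],
    [964467000,-336798000,75116160,-10241721,525609],
      [-11337408000,1850202000,-114423840,14635404,-1023516],
        [41150592000,-3653748000,-190239840,-32822496,4735584],
          [-30862944000,2097333000,230655600,26178390,-3929310]]),
  (100000000, [[1]])]"

definition functionals10 :: "term_list list" where
 "functionals10 = [[(1,[6,0,0,0,0])],
  [(40,[1,3,0,0,0]),(9,[1,0,2,0,0])],
  [(1,[0,2,1,0,0])],
  [(1,[0,1,0,0,1])],
  [(1,[0,0,1,1,0])],
  [(24000,[4,2,0,0,0]),(50400,[2,3,0,0,0]),(990,[2,0,2,0,0]),(15720,[1,2,1,0,0]),(1280,[1,1,0,0,1]),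
    (812,[1,0,1,1,0]),(8209,[0,1,2,0,0])],
  [(10800,[3,1,1,0,0]),(-64800,[2,3,0,0,0]),(10980,[2,0,2,0,0]),(-25560,[1,2,1,0,0]),
    (-3040,[1,1,0,0,1]),(1004,[1,0,1,1,0]),(-16307,[0,1,2,0,0])],
  [(720,[2,1,0,1,0]),(-1800,[2,0,2,0,0]),(220,[1,1,0,0,1]),(-308,[1,0,1,1,0]),(215,[0,1,2,0,0])],
  [(40,[0,4,0,0,0]),(9,[0,1,2,0,0])],
  [(2,[0,2,0,1,0]),(-5,[0,1,2,0,0])],
  [(1,[0,0,1,0,1])],
  [(1,[0,0,0,2,0])],
  [(-3456000000,[7,1,0,0,0]),(-1313280000,[5,2,0,0,0]),(-143424000,[4,1,1,0,0]),
    (-2894400,[4,0,0,0,1]),(-342144000,[3,3,0,0,0]),(-22896000,[3,1,0,1,0]),(-17366400,[3,0,2,0,0]),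
      (-45662400,[2,2,1,0,0]),(-3974040,[2,1,0,0,1]),(-3144600,[2,0,1,1,0]),(-73958400,[1,4,0,0,0]),
        (-7027200,[1,2,0,1,0]),(-6474240,[1,1,2,0,0]),(-591104,[1,0,1,0,1]),(-563456,[1,0,0,2,0]),
          (-10356840,[0,3,1,0,0]),(-1110989,[0,2,0,0,1]),(-1028045,[0,1,1,1,0]),(-972749,[0,0,3,0,0])],
  [(-2332800000,[6,0,1,0,0]),(1866240000,[5,2,0,0,0]),(-373248000,[4,1,1,0,0]),
    (-13348800,[4,0,0,0,1]),(1648512000,[3,3,0,0,0]),(29808000,[3,1,0,1,0]),
      (-209692800,[3,0,2,0,0]),(192715200,[2,2,1,0,0]),(17080920,[2,1,0,0,1]),
        (-18844200,[2,0,1,1,0]),(595123200,[1,4,0,0,0]),(46425600,[1,2,0,1,0]),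
          (22475520,[1,1,2,0,0]),(128192,[1,0,1,0,1]),(-1069312,[1,0,0,2,0]),(87745320,[0,3,1,0,0]),
            (9783797,[0,2,0,0,1]),(6191285,[0,1,1,1,0]),(3796277,[0,0,3,0,0])],
  [(-186624000,[5,0,0,1,0]),(233280000,[4,1,1,0,0]),(-14904000,[4,0,0,0,1]),
    (-466560000,[3,3,0,0,0]),(-4406400,[3,1,0,1,0]),(107568000,[3,0,2,0,0]),(-49896000,[2,2,1,0,0]),
      (-5689800,[2,1,0,0,1]),(11106360,[2,0,1,1,0]),(-207360000,[1,4,0,0,0]),
        (-15575040,[1,2,0,1,0]),(-4377600,[1,1,2,0,0]),(446720,[1,0,1,0,1]),(1006592,[1,0,0,2,0]),
          (-31059000,[0,3,1,0,0]),(-3588295,[0,2,0,0,1]),(-1908679,[0,1,1,1,0]),(-788935,[0,0,3,0,0])],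
  [(-1,[0,0,0,1,1])],
  [(10000000,[10,0,0,0,0]),(1000000,[8,1,0,0,0]),(100000,[7,0,1,0,0]),(100000,[6,2,0,0,0]),
    (10000,[6,0,0,1,0]),(10000,[5,1,1,0,0]),(1000,[5,0,0,0,1]),(10000,[4,3,0,0,0]),
      (1000,[4,1,0,1,0]),(1000,[4,0,2,0,0]),(1000,[3,2,1,0,0]),(100,[3,1,0,0,1]),(100,[3,0,1,1,0]),
        (1000,[2,4,0,0,0]),(100,[2,2,0,1,0]),(100,[2,1,2,0,0]),(10,[2,0,1,0,1]),(10,[2,0,0,2,0]),
          (100,[1,3,1,0,0]),(10,[1,2,0,0,1]),(10,[1,1,1,1,0]),(10,[1,0,3,0,0]),(1,[1,0,0,1,1]),
            (100,[0,5,0,0,0]),(10,[0,3,0,1,0]),(10,[0,2,2,0,0]),(1,[0,1,1,0,1]),(1,[0,1,0,2,0]),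
              (1,[0,0,2,1,0])],
  [(1,[0,0,0,0,2])]]"

lemma homogeneous10: "list_all (homogeneous_ok (10 div 2)) rels10"
  by code_simp

text \<open>
  In norm 9 every monomial is a rational multiple of \<open>a\<^sup>9\<close> modulo the kernel, but no relation has a
  leading term dividing \<open>a\<^sup>4e\<close>. The combination below was found by solving a system of linear
  equations in the multiples of norm 9 of the relations.
\<close>

lemma extra10_in_ideal: "poly_of extra10 \<in> genideal (polynomial_algebra (10 div 2))
  (poly_of ` set rels10)"
proof -
  let ?J = "genideal (polynomial_algebra (10 div 2)) (poly_of ` set rels10)"
  interpret cring "polynomial_algebra (10 div 2)" by (rule polynomial_algebra_cring)
  have sub: "poly_of ` set rels10 \<subseteq> carrier (polynomial_algebra (10 div 2))"
    using homogeneous10 by (auto simp: list_all_iff homogeneous_ok_def term_ok_def intro!: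
      poly_of_closed)
  interpret J: ideal ?J "polynomial_algebra (10 div 2)" by (rule genideal_ideal[OF sub])
  have add: "p + q \<in> ?J" if "p \<in> ?J" "q \<in> ?J" for p q using J.a_closed[OF that] by simp
  have mult: "poly_of t * poly_of r \<in> ?J"
    if "list_all (has_length 5 \<circ> snd) t" "r \<in> set rels10" for t r
  proof -
    have "poly_of t \<in> carrier (polynomial_algebra (10 div 2))"
      using that(1) by (auto simp: list_all_iff has_length_def intro!: poly_of_closed)
    then show ?thesis using J.I_l_closed[OF relations_in_ideal[OF homogeneous10 that(2)]] by simp
  qed
  let ?q = "\<lambda>ts i. poly_of ts * poly_of (rels10 ! i)"
  let ?a = "[1, 0, 0, 0, 0]" and ?aa = "[2, 0, 0, 0, 0]" and ?b = "[0, 1, 0, 0, 0]" and ?o =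
    "[0, 0, 0, 0, 0]"
  have "poly_of extra10 = ?q [(-5000, ?b), (-10500, ?aa)] 1 + ?q [(3000, ?aa)] 2 + ?q [(-180, ?a)] 5
    + ?q [(-530, ?a)] 6
      + ?q [(50, ?a)] 7 + ?q [(10, ?a)] 8 + ?q [(-603, ?o)] 12 + ?q [(-412, ?o)] 13 + ?q [(-575, ?o)] 14"
    by (simp add: extra10_def rels10_def poly_of_vars algebra_simps power_numeral_reduce)
  also have "\<dots> \<in> ?J"
    by (intro add mult nth_mem) (simp_all add: has_length_def rels10_def)
  finally show ?thesis .
qed

lemma certificate10: "certificate_ok 10 rels10 (rels10 @ [extra10]) [0, 3, 5, 4, 6] inverses10
  functionals10"
  by code_simp

lemma presentation:
  assumes "certificate_ok d Rs Rs ws inverses functionals" "poly_of ` set Rs = S"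
  shows "minimal_presentation d S"
proof -
  have "list_all (homogeneous_ok (d div 2)) Rs" using assms(1) by (simp add: certificate_ok_def)
  then interpret presentation_certificate d Rs Rs ws inverses functionals
    using assms(1) relations_in_ideal by unfold_locales
  show ?thesis using minimal_presentation assms(2) by simp
qed

text \<open>
  Here the relations themselves are not a Groebner basis, and \<open>extra10\<close> is added.
\<close>

lemma presentation10: "poly_of ` set rels10 = S \<Longrightarrow> minimal_presentation 10 S"
proof -
  interpret presentation_certificate 10 rels10 "rels10 @ [extra10]"
    "[0, 3, 5, 4, 6]" inverses10 functionals10
    using certificate10 relations_in_ideal[OF homogeneous10] extra10_in_ideal by unfold_locales auto
  show "poly_of ` set rels10 = S \<Longrightarrow> minimal_presentation 10 S" using minimal_presentation by simp
qed

theorem proposition6p1: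
  shows
   "(let x = var 0; y = var 1; z = var 2; w = var 3 in
     minimal_presentation 1 {} \<and>
     minimal_presentation 2 {x^2} \<and>
     minimal_presentation 3 {x^3} \<and>
     minimal_presentation 4 {x^3 - 4*x*y, x^4, y^2} \<and>
     minimal_presentation 5 {x^4 - 5*x^2*y, x^4 - 25*y^2, x^5} \<and>
     minimal_presentation 6
       {x^4 - 11*x^2*y + 24*x*z + 6*y^2,
        x^5 - 6*x^3*y,
        x^5 - 36*x^2*z,
        x^5 - 216*y*z,
        x^6,
        z^2} \<and>
     minimal_presentation 7
       {x^5 - 13*x^3*y + 28*x^2*z + 14*x*y^2,
        11*x^5 - 129*x^3*y + 280*x^2*z + 588*y*z,
        x^6 - 7*x^4*y,
        x^6 - 49*x^3*z,
        x^6 - 343*y^3,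
        x^6 - 2401*z^2,
        x^7} \<and>
     minimal_presentation 8
       {x^5 - 21*x^3*y + 92*x^2*z + 54*x*y^2 - 240*x*w - 96*y*z,
        x^6 - 15*x^4*y + 32*x^3*z + 24*x^2*y^2,
        x^6 + 9*x^4*y - 304*x^3*z + 1440*x^2*w - 96*y^3,
        -(x^6) + 87*x^4*y - 1232*x^3*z + 5472*x^2*w - 5376*y*w,
        17*x^6 - 135*x^4*y - 784*x^3*z + 5760*x^2*w + 3584*z^2,
        x^7 - 8*x^5*y,
        x^7 - 64*x^4*z,
        x^7 - 512*x^3*w,
        x^7 - 32768*z*w,
        x^8,
        w^2}) \<and>
    (let a = var 0; b = var 1; c = var 2; d = var 3; e = var 4 in
     minimal_presentation 9
       {-(a^6) + 24*a^4*b - 104*a^3*c - 87*a^2*b^2 + 270*a^2*d + 216*a*b*c + 18*b^3,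
        -(11*a^6) + 258*a^4*b - 1120*a^3*c - 837*a^2*b^2 + 2910*a^2*d + 1488*a*b*c + 2160*b*d + 864*c^2,
        a^7 - 17*a^5*b + 36*a^4*c + 36*a^3*b^2,
        a^7 - 11*a^5*b - 30*a^4*c + 270*a^3*d + 162*a^2*b*c,
        251*a^7 - 3895*a^5*b + 16284*a^4*c - 50328*a^3*d + 326592*a*b*d,
        37*a^7 - 1001*a^5*b + 9636*a^4*c - 37800*a^3*d + 46656*b^2*c,
        85*a^7 - 857*a^5*b - 2652*a^4*c + 26712*a^3*d + 373248*c*d,
        a^8 - 9*a^6*b,
        a^8 - 81*a^5*c,
        a^8 - 729*a^4*d,
        a^8 - 59049*b^2*d,
        a^8 - 531441*d^2,
        a^9} \<and>
     minimal_presentation 10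
       {a^6 - 34*a^4*b + 224*a^3*c + 207*a^2*b^2 - 1170*a^2*d - 1136*a*b*c + 3360*a*e - 108*b^3 + 1200*b*d + 480*c^2,
        -(a^7) + 27*a^5*b - 116*a^4*c - 126*a^3*b^2 + 300*a^3*d + 360*a^2*b*c + 60*a*b^3,
        -(3*a^7) + 86*a^5*b - 468*a^4*c - 393*a^3*b^2 + 1950*a^3*d + 1420*a^2*b*c - 4200*a^2*e + 600*b^2*c,
        -(7*a^7) + 229*a^5*b - 1652*a^4*c - 1152*a^3*b^2 + 9450*a^3*d + 6080*a^2*b*c - 29460*a^2*e - 6600*a*b*d + 21600*b*e,
        -(59*a^7) + 1283*a^5*b - 2404*a^4*c - 3654*a^3*b^2 - 18450*a^3*d - 10040*a^2*b*c + 140700*a^2*e + 46200*a*b*d + 108000*c*d,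
        a^8 - 19*a^6*b + 40*a^5*c + 50*a^4*b^2,
        7*a^8 - 83*a^6*b - 320*a^5*c + 2500*a^4*d + 2000*a^3*b*c,
        21*a^8 - 249*a^6*b + 40*a^5*c - 5500*a^4*d + 60000*a^3*e + 30000*a^2*b*d,
        221*a^8 - 2049*a^6*b - 1960*a^5*c - 167500*a^4*d + 1680000*a^3*e + 30000*b^4,
        1457*a^8 - 14133*a^6*b - 5320*a^5*c - 1049500*a^4*d + 10320000*a^3*e + 2700000*b^2*d,
        -(2659*a^8) + 10671*a^6*b + 191840*a^5*c + 2835500*a^4*d - 32592000*a^3*e + 97200000*c*e,
        18341*a^8 - 142329*a^6*b - 813160*a^5*c - 8483500*a^4*d + 122640000*a^3*e + 243000000*d^2,
        a^9 - 10*a^7*b,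
        a^9 - 100*a^6*c,
        a^9 - 1000*a^5*d,
        a^9 - 10^7*d*e,
        a^10,
        e^2})"
  unfolding Let_def
  apply (intro conjI)
  subgoal by (rule presentation[OF certificate1]) (simp add: rels1_def poly_of_vars algebra_simps)
  subgoal by (rule presentation[OF certificate2]) (simp add: rels2_def poly_of_vars algebra_simps)
  subgoal by (rule presentation[OF certificate3]) (simp add: rels3_def poly_of_vars algebra_simps)
  subgoal by (rule presentation[OF certificate4]) (simp add: rels4_def poly_of_vars algebra_simps)
  subgoal by (rule presentation[OF certificate5]) (simp add: rels5_def poly_of_vars algebra_simps)
  subgoal by (rule presentation[OF certificate6]) (simp add: rels6_def poly_of_vars algebra_simps)
  subgoal by (rule presentation[OF certificate7]) (simp add: rels7_def poly_of_vars algebra_simps)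
  subgoal by (rule presentation[OF certificate8]) (simp add: rels8_def poly_of_vars algebra_simps)
  subgoal by (rule presentation[OF certificate9]) (simp add: rels9_def poly_of_vars algebra_simps)
  subgoal by (rule presentation10) (simp add: rels10_def poly_of_vars algebra_simps)
  done

end
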